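(* Let $(M,J,g)$ be a closed non-Kähler, nearly Kähler manifold of real dimension $6$. Then its Hermitian scalar curvature vanishes: $s^H=0$.
   Context: An almost Hermitian manifold $(M,J,g)$ (with $J$ an almost complex structure orthogonal for the Riemannian metric $g$) is nearly Kähler if $(D^g_XJ)Y+(D^g_YJ)X=0$ for all $X,Y$, where $D^g$ is the Levi-Civita connection. The Chern connection $\nabla$ is the unique connection on $TM$ with $\nabla g=0$, $\nabla J=0$ whose torsion $T_{XY}=\nabla_XY-\nabla_YX-[X,Y]$ satisfies $T_{JX,JY}=-T_{XY}$; its curvature is $R_{XY}=[\nabla_X,\nabla_Y]-\nabla_{[X,Y]}$. For a local $g$-orthonormal frame $(e_i)$ with $e_{2\alpha}=Je_{2\alpha-1}$, the Hermitian scalar curvature is $s^H=2s^C$ with $s^C=-\frac14\sum_{i,j}g(R_{e_i,Je_i}e_j,Je_j)$. Closed means compact without boundary.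
   Formalization: The manifold is assumed connected; without this the claim fails, e.g. for the disjoint union of the nearly Kähler six-sphere and complex projective 3-space with its Kähler metric, where the Hermitian scalar curvature is non-zero on the second component. *)

theory Defs
  imports "HOL-Analysis.Analysis" "HOL-Library.Function_Algebras"
begin

text \<open>
  Almost Hermitian geometry on an abstract smooth manifold.  The manifold is the whole type
  \<open>'m\<close>, equipped with a smooth (not necessarily maximal) atlas \<open>A\<close> of charts into a Euclidean
  space \<open>'e\<close>.
\<close>

instantiation "fun" :: (type, real_vector) real_vector
begin

definition scaleR_fun :: "real \<Rightarrow> ('a \<Rightarrow> 'b) \<Rightarrow> 'a \<Rightarrow> 'b"
  where "scaleR_fun r f = (\<lambda>x. r *\<^sub>R f x)"

instance
  by standard (auto simp: scaleR_fun_def fun_eq_iff algebra_simps)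

end

text \<open>\<open>Ck_on k\<close> and \<open>smooth_on\<close> are used for open sets only.\<close>

fun Ck_on :: "nat \<Rightarrow> 'a::euclidean_space set \<Rightarrow> ('a \<Rightarrow> 'b::real_normed_vector) \<Rightarrow> bool" where
  "Ck_on 0 S f \<longleftrightarrow> continuous_on S f"
| "Ck_on (Suc k) S f \<longleftrightarrow>
     (\<forall>x\<in>S. f differentiable (at x)) \<and> (\<forall>v. Ck_on k S (\<lambda>x. frechet_derivative f (at x) v))"

definition smooth_on :: "'a::euclidean_space set \<Rightarrow> ('a \<Rightarrow> 'b::real_normed_vector) \<Rightarrow> bool"
  where "smooth_on S f \<longleftrightarrow> (\<forall>k. Ck_on k S f)"


subsection \<open>Smooth manifolds, tangent vectors, vector fields\<close>

text \<open>A chart is a pair of a domain and a coordinate map; the values of the coordinate map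
  outside the domain are irrelevant.\<close>

type_synonym ('m, 'e) chart = "'m set \<times> ('m \<Rightarrow> 'e)"

abbreviation cdom :: "('m, 'e) chart \<Rightarrow> 'm set"
  where "cdom c \<equiv> fst c"

abbreviation coord :: "('m, 'e) chart \<Rightarrow> 'm \<Rightarrow> 'e"
  where "coord c \<equiv> snd c"

abbreviation param :: "('m, 'e) chart \<Rightarrow> 'e \<Rightarrow> 'm"
  where "param c \<equiv> inv_into (cdom c) (coord c)"

definition is_chart :: "('m::topological_space, 'e::euclidean_space) chart \<Rightarrow> bool" where
  "is_chart c \<longleftrightarrow> open (cdom c) \<and> open (coord c ` cdom c) \<and>
     homeomorphism (cdom c) (coord c ` cdom c) (coord c) (param c)"

definition smooth_atlas :: "('m::topological_space, 'e::euclidean_space) chart set \<Rightarrow> bool" where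
  "smooth_atlas A \<longleftrightarrow>
     (\<forall>c\<in>A. is_chart c) \<and> (\<Union>c\<in>A. cdom c) = UNIV \<and>
     (\<forall>c\<in>A. \<forall>d\<in>A. smooth_on (coord c ` (cdom c \<inter> cdom d)) (coord d \<circ> param c))"

text \<open>A tangent vector at \<open>p\<close> is the family of its components in the charts around \<open>p\<close>, related by
  the Jacobians of the coordinate changes.  It is set to \<open>0\<close> at all other charts, so that
  equality of tangent vectors is equality of functions.\<close>

type_synonym ('m, 'e) tvec = "('m, 'e) chart \<Rightarrow> 'e"

definition tangent_space ::
    "('m::topological_space, 'e::euclidean_space) chart set \<Rightarrow> 'm \<Rightarrow> ('m, 'e) tvec set" where
  "tangent_space A p = {v.
     (\<forall>c\<in>A. \<forall>d\<in>A. p \<in> cdom c \<longrightarrow> p \<in> cdom d \<longrightarrow>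
        v d = frechet_derivative (coord d \<circ> param c) (at (coord c p)) (v c)) \<and>
     (\<forall>c. \<not> (c \<in> A \<and> p \<in> cdom c) \<longrightarrow> v c = 0)}"

text \<open>Local functions and local vector fields are total functions of which only the values on an
  open set \<open>U\<close> matter.\<close>

type_synonym ('m, 'e) vfield = "'m \<Rightarrow> ('m, 'e) tvec"

definition smooth_fun ::
    "('m::topological_space, 'e::euclidean_space) chart set \<Rightarrow> 'm set \<Rightarrow> ('m \<Rightarrow> real) \<Rightarrow> bool" where
  "smooth_fun A U f \<longleftrightarrow> (\<forall>c\<in>A. smooth_on (coord c ` (U \<inter> cdom c)) (f \<circ> param c))"

definition smooth_vf ::
    "('m::topological_space, 'e::euclidean_space) chart set \<Rightarrow> 'm set \<Rightarrow> ('m, 'e) vfield \<Rightarrow> bool" where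
  "smooth_vf A U X \<longleftrightarrow>
     (\<forall>p\<in>U. X p \<in> tangent_space A p) \<and>
     (\<forall>c\<in>A. smooth_on (coord c ` (U \<inter> cdom c)) (\<lambda>x. X (param c x) c))"

text \<open>The derivative \<open>X f\<close>; by the chain rule it does not depend on the chart chosen.\<close>

definition vf_deriv ::
    "('m::topological_space, 'e::euclidean_space) chart set \<Rightarrow> ('m, 'e) vfield \<Rightarrow> ('m \<Rightarrow> real) \<Rightarrow> 'm \<Rightarrow> real" where
  "vf_deriv A X f p =
     (let c = (SOME c. c \<in> A \<and> p \<in> cdom c)
      in frechet_derivative (f \<circ> param c) (at (coord c p)) (X p c))"

definition lie_bracket ::
    "('m::topological_space, 'e::euclidean_space) chart set \<Rightarrow>
     ('m, 'e) vfield \<Rightarrow> ('m, 'e) vfield \<Rightarrow> ('m, 'e) vfield" where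
  "lie_bracket A X Y p c =
     (if c \<in> A \<and> p \<in> cdom c then
        frechet_derivative (\<lambda>x. Y (param c x) c) (at (coord c p)) (X p c) -
        frechet_derivative (\<lambda>x. X (param c x) c) (at (coord c p)) (Y p c)
      else 0)"


subsection \<open>Almost Hermitian structures\<close>

text \<open>Only the restrictions of \<open>J p\<close> and \<open>g p\<close> to the tangent space at \<open>p\<close> matter.\<close>

type_synonym ('m, 'e) endo = "'m \<Rightarrow> ('m, 'e) tvec \<Rightarrow> ('m, 'e) tvec"

type_synonym ('m, 'e) metric_tensor = "'m \<Rightarrow> ('m, 'e) tvec \<Rightarrow> ('m, 'e) tvec \<Rightarrow> real"

definition endo_vf :: "('m, 'e) endo \<Rightarrow> ('m, 'e) vfield \<Rightarrow> ('m, 'e) vfield"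
  where "endo_vf J X = (\<lambda>p. J p (X p))"

definition almost_complex ::
    "('m::topological_space, 'e::euclidean_space) chart set \<Rightarrow> ('m, 'e) endo \<Rightarrow> bool" where
  "almost_complex A J \<longleftrightarrow>
     (\<forall>p. \<forall>v\<in>tangent_space A p. J p v \<in> tangent_space A p \<and> J p (J p v) = - v) \<and>
     (\<forall>p. \<forall>v\<in>tangent_space A p. \<forall>w\<in>tangent_space A p. \<forall>a b.
        J p (a *\<^sub>R v + b *\<^sub>R w) = a *\<^sub>R J p v + b *\<^sub>R J p w) \<and>
     (\<forall>U X. open U \<longrightarrow> smooth_vf A U X \<longrightarrow> smooth_vf A U (endo_vf J X))"

definition riemannian_metric ::
    "('m::topological_space, 'e::euclidean_space) chart set \<Rightarrow> ('m, 'e) metric_tensor \<Rightarrow> bool" where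
  "riemannian_metric A g \<longleftrightarrow>
     (\<forall>p. \<forall>v\<in>tangent_space A p. \<forall>w\<in>tangent_space A p. g p v w = g p w v) \<and>
     (\<forall>p. \<forall>v\<in>tangent_space A p. v \<noteq> 0 \<longrightarrow> g p v v > 0) \<and>
     (\<forall>p. \<forall>u\<in>tangent_space A p. \<forall>v\<in>tangent_space A p. \<forall>w\<in>tangent_space A p. \<forall>a b.
        g p (a *\<^sub>R u + b *\<^sub>R v) w = a * g p u w + b * g p v w) \<and>
     (\<forall>U X Y. open U \<longrightarrow> smooth_vf A U X \<longrightarrow> smooth_vf A U Y \<longrightarrow>
        smooth_fun A U (\<lambda>p. g p (X p) (Y p)))"

definition almost_Hermitian ::
    "('m::topological_space, 'e::euclidean_space) chart set \<Rightarrow> ('m, 'e) endo \<Rightarrow>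
     ('m, 'e) metric_tensor \<Rightarrow> bool" where
  "almost_Hermitian A J g \<longleftrightarrow>
     smooth_atlas A \<and> almost_complex A J \<and> riemannian_metric A g \<and>
     (\<forall>p. \<forall>v\<in>tangent_space A p. \<forall>w\<in>tangent_space A p. g p (J p v) (J p w) = g p v w)"


subsection \<open>Connections\<close>

text \<open>A connection on the tangent bundle, as a differential operator on local vector fields.  The
  locality clause, applied with arbitrary open sets, says that it is compatible with restriction to
  smaller open sets.\<close>

type_synonym ('m, 'e) connection = "('m, 'e) vfield \<Rightarrow> ('m, 'e) vfield \<Rightarrow> ('m, 'e) vfield"

definition affine_connection ::
    "('m::topological_space, 'e::euclidean_space) chart set \<Rightarrow> ('m, 'e) connection \<Rightarrow> bool" where
  "affine_connection A N \<longleftrightarrow>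
     (\<forall>U X Y. open U \<longrightarrow> smooth_vf A U X \<longrightarrow> smooth_vf A U Y \<longrightarrow> smooth_vf A U (N X Y)) \<and>
     (\<forall>U X X' Y Y'. open U \<longrightarrow> smooth_vf A U X \<longrightarrow> smooth_vf A U X' \<longrightarrow>
        smooth_vf A U Y \<longrightarrow> smooth_vf A U Y' \<longrightarrow>
        (\<forall>p\<in>U. X p = X' p \<and> Y p = Y' p) \<longrightarrow> (\<forall>p\<in>U. N X Y p = N X' Y' p)) \<and>
     (\<forall>U X X' Y. open U \<longrightarrow> smooth_vf A U X \<longrightarrow> smooth_vf A U X' \<longrightarrow> smooth_vf A U Y \<longrightarrow>
        (\<forall>p\<in>U. N (\<lambda>q. X q + X' q) Y p = N X Y p + N X' Y p)) \<and>
     (\<forall>U X Y Y'. open U \<longrightarrow> smooth_vf A U X \<longrightarrow> smooth_vf A U Y \<longrightarrow> smooth_vf A U Y' \<longrightarrow>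
        (\<forall>p\<in>U. N X (\<lambda>q. Y q + Y' q) p = N X Y p + N X Y' p)) \<and>
     (\<forall>U f X Y. open U \<longrightarrow> smooth_fun A U f \<longrightarrow> smooth_vf A U X \<longrightarrow> smooth_vf A U Y \<longrightarrow>
        (\<forall>p\<in>U. N (\<lambda>q. f q *\<^sub>R X q) Y p = f p *\<^sub>R N X Y p)) \<and>
     (\<forall>U f X Y. open U \<longrightarrow> smooth_fun A U f \<longrightarrow> smooth_vf A U X \<longrightarrow> smooth_vf A U Y \<longrightarrow>
        (\<forall>p\<in>U. N X (\<lambda>q. f q *\<^sub>R Y q) p = vf_deriv A X f p *\<^sub>R Y p + f p *\<^sub>R N X Y p))"

definition torsion ::
    "('m::topological_space, 'e::euclidean_space) chart set \<Rightarrow> ('m, 'e) connection \<Rightarrow>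
     ('m, 'e) vfield \<Rightarrow> ('m, 'e) vfield \<Rightarrow> ('m, 'e) vfield" where
  "torsion A N X Y p = N X Y p - N Y X p - lie_bracket A X Y p"

definition curvature ::
    "('m::topological_space, 'e::euclidean_space) chart set \<Rightarrow> ('m, 'e) connection \<Rightarrow>
     ('m, 'e) vfield \<Rightarrow> ('m, 'e) vfield \<Rightarrow> ('m, 'e) vfield \<Rightarrow> ('m, 'e) vfield" where
  "curvature A N X Y Z p = N X (N Y Z) p - N Y (N X Z) p - N (lie_bracket A X Y) Z p"

text \<open>\<open>cov_endo N J X Y\<close> is \<open>(N\<^sub>X J) Y\<close>.\<close>

definition cov_endo ::
    "('m, 'e::euclidean_space) connection \<Rightarrow> ('m, 'e) endo \<Rightarrow>
     ('m, 'e) vfield \<Rightarrow> ('m, 'e) vfield \<Rightarrow> ('m, 'e) vfield" where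
  "cov_endo N J X Y p = N X (endo_vf J Y) p - J p (N X Y p)"

definition parallel_endo ::
    "('m::topological_space, 'e::euclidean_space) chart set \<Rightarrow> ('m, 'e) connection \<Rightarrow>
     ('m, 'e) endo \<Rightarrow> bool" where
  "parallel_endo A N J \<longleftrightarrow>
     (\<forall>U X Y. open U \<longrightarrow> smooth_vf A U X \<longrightarrow> smooth_vf A U Y \<longrightarrow> (\<forall>p\<in>U. cov_endo N J X Y p = 0))"

definition metric_connection ::
    "('m::topological_space, 'e::euclidean_space) chart set \<Rightarrow> ('m, 'e) metric_tensor \<Rightarrow>
     ('m, 'e) connection \<Rightarrow> bool" where
  "metric_connection A g N \<longleftrightarrow> affine_connection A N \<and>
     (\<forall>U X Y Z. open U \<longrightarrow> smooth_vf A U X \<longrightarrow> smooth_vf A U Y \<longrightarrow> smooth_vf A U Z \<longrightarrow>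
        (\<forall>p\<in>U. vf_deriv A X (\<lambda>q. g q (Y q) (Z q)) p = g p (N X Y p) (Z p) + g p (Y p) (N X Z p)))"

definition levi_civita ::
    "('m::topological_space, 'e::euclidean_space) chart set \<Rightarrow> ('m, 'e) metric_tensor \<Rightarrow>
     ('m, 'e) connection \<Rightarrow> bool" where
  "levi_civita A g D \<longleftrightarrow> metric_connection A g D \<and>
     (\<forall>U X Y. open U \<longrightarrow> smooth_vf A U X \<longrightarrow> smooth_vf A U Y \<longrightarrow> (\<forall>p\<in>U. torsion A D X Y p = 0))"

definition chern_connection ::
    "('m::topological_space, 'e::euclidean_space) chart set \<Rightarrow> ('m, 'e) endo \<Rightarrow>
     ('m, 'e) metric_tensor \<Rightarrow> ('m, 'e) connection \<Rightarrow> bool" where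
  "chern_connection A J g N \<longleftrightarrow> metric_connection A g N \<and> parallel_endo A N J \<and>
     (\<forall>U X Y. open U \<longrightarrow> smooth_vf A U X \<longrightarrow> smooth_vf A U Y \<longrightarrow>
        (\<forall>p\<in>U. torsion A N (endo_vf J X) (endo_vf J Y) p = - torsion A N X Y p))"


subsection \<open>Nearly Kaehler manifolds and the Hermitian scalar curvature\<close>

text \<open>In the next two definitions \<open>D\<close> is meant to be the Levi-Civita connection of \<open>g\<close>.\<close>

definition nearly_Kaehler ::
    "('m::topological_space, 'e::euclidean_space) chart set \<Rightarrow> ('m, 'e) endo \<Rightarrow>
     ('m, 'e) metric_tensor \<Rightarrow> ('m, 'e) connection \<Rightarrow> bool" where
  "nearly_Kaehler A J g D \<longleftrightarrow> almost_Hermitian A J g \<and>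
     (\<forall>U X Y. open U \<longrightarrow> smooth_vf A U X \<longrightarrow> smooth_vf A U Y \<longrightarrow>
        (\<forall>p\<in>U. cov_endo D J X Y p + cov_endo D J Y X p = 0))"

definition Kaehler ::
    "('m::topological_space, 'e::euclidean_space) chart set \<Rightarrow> ('m, 'e) endo \<Rightarrow>
     ('m, 'e) metric_tensor \<Rightarrow> ('m, 'e) connection \<Rightarrow> bool" where
  "Kaehler A J g D \<longleftrightarrow> almost_Hermitian A J g \<and> parallel_endo A D J"

definition adapted_frame ::
    "('m::topological_space, 'e::euclidean_space) chart set \<Rightarrow> ('m, 'e) endo \<Rightarrow>
     ('m, 'e) metric_tensor \<Rightarrow> 'm set \<Rightarrow> (nat \<Rightarrow> ('m, 'e) vfield) \<Rightarrow> bool" where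
  "adapted_frame A J g U e \<longleftrightarrow> open U \<and>
     (\<forall>i\<in>{1..DIM('e)}. smooth_vf A U (e i)) \<and>
     (\<forall>i\<in>{1..DIM('e)}. \<forall>j\<in>{1..DIM('e)}. \<forall>p\<in>U. g p (e i p) (e j p) = (if i = j then 1 else 0)) \<and>
     (\<forall>a\<in>{1..DIM('e) div 2}. \<forall>p\<in>U. e (2 * a) p = J p (e (2 * a - 1) p))"

definition frame_chern_scalar ::
    "('m::topological_space, 'e::euclidean_space) chart set \<Rightarrow> ('m, 'e) endo \<Rightarrow>
     ('m, 'e) metric_tensor \<Rightarrow> ('m, 'e) connection \<Rightarrow> (nat \<Rightarrow> ('m, 'e) vfield) \<Rightarrow> 'm \<Rightarrow> real" where
  "frame_chern_scalar A J g N e p =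
     - (1 / 4) * (\<Sum>i = 1..DIM('e). \<Sum>j = 1..DIM('e).
         g p (curvature A N (e i) (endo_vf J (e i)) (e j) p) (J p (e j p)))"

text \<open>\<open>N\<close> is meant to be the Chern connection.  The value at \<open>p\<close> is computed in some adapted frame
  near \<open>p\<close>; such frames exist and the value does not depend on the choice.\<close>

definition chern_scalar_curvature ::
    "('m::topological_space, 'e::euclidean_space) chart set \<Rightarrow> ('m, 'e) endo \<Rightarrow>
     ('m, 'e) metric_tensor \<Rightarrow> ('m, 'e) connection \<Rightarrow> 'm \<Rightarrow> real" where
  "chern_scalar_curvature A J g N p =
     frame_chern_scalar A J g N (SOME e. \<exists>U. p \<in> U \<and> adapted_frame A J g U e) p"

definition hermitian_scalar_curvature ::
    "('m::topological_space, 'e::euclidean_space) chart set \<Rightarrow> ('m, 'e) endo \<Rightarrow>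
     ('m, 'e) metric_tensor \<Rightarrow> ('m, 'e) connection \<Rightarrow> 'm \<Rightarrow> real" where
  "hermitian_scalar_curvature A J g N p = 2 * chern_scalar_curvature A J g N p"

end

theory Submission
  imports Defs
begin

text \<open>
  The idea is that the torsion of the Chern connection \<open>N\<close> of a strict nearly Kaehler manifold of
  real dimension 6 is a parallel complex volume form, which reduces the holonomy of \<open>N\<close> to
  \<open>SU(3)\<close>.  The Hermitian scalar curvature is a contraction of the complex trace of the curvature
  of \<open>N\<close>, and this trace is zero for a curvature with values in \<open>su(3)\<close>.

  The nearly Kaehler condition makes \<open>tau(X, Y, Z) = g(T(X, Y), Z)\<close> totally skew and of type
  \<open>(3,0) + (0,3)\<close>, where \<open>T\<close> is the torsion of \<open>N\<close> (\<open>difference_relations\<close>).  That \<open>tau\<close> is parallel is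
  a theorem of Kirichenko (\<open>nabla_tau_zero\<close>).  It is read off from the first Bianchi identity with
  torsion, in which the curvature, the derivative of \<open>tau\<close> and a term quadratic in \<open>T\<close> have different
  symmetries under \<open>J\<close> (\<open>kirichenko_algebra\<close>).

  In an adapted frame \<open>e\<^sub>1, J e\<^sub>1, e\<^sub>3, J e\<^sub>3, e\<^sub>5, J e\<^sub>5\<close> the form \<open>tau\<close> is determined by the two functions
  \<open>tau(e\<^sub>1, e\<^sub>3, e\<^sub>5)\<close> and \<open>tau(J e\<^sub>1, e\<^sub>3, e\<^sub>5)\<close>.  As \<open>tau\<close> is parallel, the derivative of this pair is an
  infinitesimal rotation, so the sum of their squares is locally constant (\<open>deriv_tau_sq\<close>).  Hence the zero set
  of the torsion is open and closed.  The torsion is \<open>- J (D J)\<close>, so that on a connected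
  manifold which is not Kaehler this set is empty (\<open>torsion_nowhere_zero\<close>).  Finally the curvature
  annihilates \<open>tau\<close>, on which it acts through its complex trace, and \<open>tau\<close> has no zero; so the trace
  vanishes (\<open>curvature_trace_zero\<close>).
\<close>

section \<open>Calculus of smooth functions on open subsets of a Euclidean space\<close>

lemma Ck_on_subset: "Ck_on k S f \<Longrightarrow> T \<subseteq> S \<Longrightarrow> Ck_on k T f"
  by (induction k arbitrary: f) (auto intro: continuous_on_subset)

lemma frechet_derivative_cong_open:
  assumes "open S" "x \<in> S" "\<And>y. y \<in> S \<Longrightarrow> f y = g y"
  shows "frechet_derivative f (at x) = frechet_derivative g (at x)"
proof -
  have "(f has_derivative F) (at x) \<longleftrightarrow> (g has_derivative F) (at x)" for F
    using assms has_derivative_transform_within_open[of f F x UNIV S g]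
      has_derivative_transform_within_open[of g F x UNIV S f] by auto
  then show ?thesis by (simp add: frechet_derivative_def)
qed

lemma differentiable_cong_open:
  assumes "open S" "x \<in> S" "\<And>y. y \<in> S \<Longrightarrow> f y = g y"
  shows "f differentiable (at x) \<longleftrightarrow> g differentiable (at x)"
proof -
  have "(f has_derivative F) (at x) \<longleftrightarrow> (g has_derivative F) (at x)" for F
    using assms has_derivative_transform_within_open[of f F x UNIV S g]
      has_derivative_transform_within_open[of g F x UNIV S f] by auto
  then show ?thesis by (simp add: differentiable_def)
qed

lemma Ck_on_cong:
  assumes "open S" "\<And>x. x \<in> S \<Longrightarrow> f x = g x"
  shows "Ck_on k S f \<longleftrightarrow> Ck_on k S g"
  using assms(2)
proof (induction k arbitrary: f g)
  case 0
  then show ?case by (simp cong: continuous_on_cong)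
next
  case (Suc k)
  have "frechet_derivative f (at x) = frechet_derivative g (at x)" if "x \<in> S" for x
    using frechet_derivative_cong_open[OF assms(1) that Suc.prems] .
  then have "Ck_on k S (\<lambda>x. frechet_derivative f (at x) v) \<longleftrightarrow>
             Ck_on k S (\<lambda>x. frechet_derivative g (at x) v)" for v
    by (intro Suc.IH) simp
  then show ?case
    using differentiable_cong_open[OF assms(1) _ Suc.prems] by simp
qed

lemma Ck_on_Suc_imp: "Ck_on (Suc k) S f \<Longrightarrow> Ck_on k S f"
proof (induction k arbitrary: f)
  case 0
  then show ?case
    by (auto intro!: continuous_at_imp_continuous_on differentiable_imp_continuous_within)
next
  case (Suc k)
  then show ?case by (metis Ck_on.simps(2))
qed

lemma smooth_on_subset: "smooth_on S f \<Longrightarrow> T \<subseteq> S \<Longrightarrow> smooth_on T f"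
  unfolding smooth_on_def using Ck_on_subset by blast

lemma smooth_on_cong:
  assumes "open S" "\<And>x. x \<in> S \<Longrightarrow> f x = g x"
  shows "smooth_on S f \<longleftrightarrow> smooth_on S g"
  unfolding smooth_on_def using Ck_on_cong[OF assms] by simp

lemma smooth_on_differentiable: "smooth_on S f \<Longrightarrow> x \<in> S \<Longrightarrow> f differentiable (at x)"
  unfolding smooth_on_def by (metis Ck_on.simps(2))

lemma smooth_on_has_derivative:
  "smooth_on S f \<Longrightarrow> x \<in> S \<Longrightarrow> (f has_derivative frechet_derivative f (at x)) (at x)"
  using smooth_on_differentiable frechet_derivative_works by blast

lemma smooth_on_continuous: "smooth_on S f \<Longrightarrow> continuous_on S f"
  unfolding smooth_on_def by (metis Ck_on.simps(1))

lemma smooth_on_frechet_derivative: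
  "smooth_on S f \<Longrightarrow> smooth_on S (\<lambda>x. frechet_derivative f (at x) v)"
  unfolding smooth_on_def by (metis Ck_on.simps(2))

lemma Ck_on_const: "Ck_on k S (\<lambda>x. c)"
  by (induction k arbitrary: c) simp_all

lemma smooth_on_const: "smooth_on S (\<lambda>x. c)"
  by (simp add: smooth_on_def Ck_on_const)

lemma Ck_on_add:
  assumes S: "open S"
  shows "Ck_on k S f \<Longrightarrow> Ck_on k S g \<Longrightarrow> Ck_on k S (\<lambda>x. f x + g x)"
proof (induction k arbitrary: f g)
  case 0
  then show ?case by (auto intro: continuous_intros)
next
  case (Suc k)
  have D: "frechet_derivative (\<lambda>x. f x + g x) (at x) v =
      frechet_derivative f (at x) v + frechet_derivative g (at x) v" if "x \<in> S" for x v
  proof -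
    have "((\<lambda>x. f x + g x) has_derivative
       (\<lambda>v. frechet_derivative f (at x) v + frechet_derivative g (at x) v)) (at x)"
      using Suc.prems that by (auto intro!: has_derivative_add simp: frechet_derivative_works[symmetric])
    from frechet_derivative_at[OF this] show ?thesis by metis
  qed
  have "Ck_on k S (\<lambda>x. frechet_derivative (\<lambda>x. f x + g x) (at x) v)" for v
    by (rule Ck_on_cong[OF S D, THEN iffD2], assumption, intro Suc.IH) (use Suc.prems in simp_all)
  then show ?case using Suc.prems by auto
qed

lemma Ck_on_bounded_linear:
  assumes S: "open S" and h: "bounded_linear h"
  shows "Ck_on k S f \<Longrightarrow> Ck_on k S (\<lambda>x. h (f x))"
proof (induction k arbitrary: f)
  case 0
  then show ?case using bounded_linear.continuous_on[OF h] by auto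
next
  case (Suc k)
  have D': "((\<lambda>x. h (f x)) has_derivative (\<lambda>v. h (frechet_derivative f (at x) v))) (at x)"
    if "x \<in> S" for x
    using Suc.prems that
    by (intro bounded_linear.has_derivative[OF h]) (auto simp: frechet_derivative_works[symmetric])
  have D: "frechet_derivative (\<lambda>x. h (f x)) (at x) v = h (frechet_derivative f (at x) v)"
    if "x \<in> S" for x v
    using frechet_derivative_at[OF D'[OF that]] by metis
  have "Ck_on k S (\<lambda>x. frechet_derivative (\<lambda>x. h (f x)) (at x) v)" for v
    by (rule Ck_on_cong[OF S D, THEN iffD2], assumption, intro Suc.IH) (use Suc.prems in simp_all)
  then show ?case using D' unfolding Ck_on.simps differentiable_def by blast
qed

lemma Ck_on_scaleR:
  assumes S: "open S"
  shows "Ck_on k S f \<Longrightarrow> Ck_on k S g \<Longrightarrow> Ck_on k S (\<lambda>x. f x *\<^sub>R g x)"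
proof (induction k arbitrary: f g)
  case 0
  then show ?case by (auto intro: continuous_intros)
next
  case (Suc k)
  have D': "((\<lambda>x. f x *\<^sub>R g x) has_derivative
       (\<lambda>v. f x *\<^sub>R frechet_derivative g (at x) v + frechet_derivative f (at x) v *\<^sub>R g x)) (at x)"
    if "x \<in> S" for x
    using Suc.prems that by (auto intro!: has_derivative_scaleR simp: frechet_derivative_works[symmetric])
  have D: "frechet_derivative (\<lambda>x. f x *\<^sub>R g x) (at x) v =
      f x *\<^sub>R frechet_derivative g (at x) v + frechet_derivative f (at x) v *\<^sub>R g x"
    if "x \<in> S" for x v
    using frechet_derivative_at[OF D'[OF that]] by metis
  have "Ck_on k S (\<lambda>x. frechet_derivative (\<lambda>x. f x *\<^sub>R g x) (at x) v)" for v
    by (rule Ck_on_cong[OF S D, THEN iffD2], assumption,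
        intro Ck_on_add[OF S] Suc.IH Ck_on_Suc_imp[OF Suc.prems(1)] Ck_on_Suc_imp[OF Suc.prems(2)])
      (use Suc.prems in simp_all)
  then show ?case using D' unfolding Ck_on.simps differentiable_def by blast
qed

lemma Ck_on_sum:
  assumes "open S" "finite I" "\<And>i. i \<in> I \<Longrightarrow> Ck_on k S (f i)"
  shows "Ck_on k S (\<lambda>x. \<Sum>i\<in>I. f i x)"
  using assms(2,3) by (induction I rule: finite_induct) (auto simp: Ck_on_const intro!: Ck_on_add assms(1))

text \<open>The chain rule \<open>D(f \<circ> h)(x) v = \<Sum>\<^sub>b \<langle>Dh(x) v, b\<rangle> Df(h x) b\<close> expresses the
  derivative of a composition by products of compositions of lower order.\<close>

lemma Ck_on_compose:
  fixes h :: "'a::euclidean_space \<Rightarrow> 'b::euclidean_space" and f :: "'b \<Rightarrow> 'c::real_normed_vector"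
  assumes S: "open S" and hST: "\<And>x. x \<in> S \<Longrightarrow> h x \<in> T"
  shows "Ck_on k T f \<Longrightarrow> Ck_on k S h \<Longrightarrow> Ck_on k S (\<lambda>x. f (h x))"
proof (induction k arbitrary: f)
  case 0
  then show ?case using hST by (auto intro: continuous_on_compose2)
next
  case (Suc k)
  have f': "(f has_derivative frechet_derivative f (at (h x))) (at (h x))" if "x \<in> S" for x
    using Suc.prems that hST by (auto simp: frechet_derivative_works[symmetric])
  have h': "(h has_derivative frechet_derivative h (at x)) (at x)" if "x \<in> S" for x
    using Suc.prems that by (auto simp: frechet_derivative_works[symmetric])
  have D': "((\<lambda>x. f (h x)) has_derivative
       (\<lambda>v. frechet_derivative f (at (h x)) (frechet_derivative h (at x) v))) (at x)"
    if "x \<in> S" for x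
    using has_derivative_compose[OF h'[OF that] f'[OF that]] .
  have D: "frechet_derivative (\<lambda>x. f (h x)) (at x) v =
      (\<Sum>b\<in>Basis. (frechet_derivative h (at x) v \<bullet> b) *\<^sub>R frechet_derivative f (at (h x)) b)"
    if "x \<in> S" for x v
  proof -
    have lin: "linear (frechet_derivative f (at (h x)))"
      using f'[OF that] has_derivative_linear by blast
    have "frechet_derivative (\<lambda>x. f (h x)) (at x) v =
      frechet_derivative f (at (h x)) (\<Sum>b\<in>Basis. (frechet_derivative h (at x) v \<bullet> b) *\<^sub>R b)"
      using frechet_derivative_at[OF D'[OF that]] by (metis euclidean_representation)
    then show ?thesis by (simp only: linear_sum[OF lin] linear_scale[OF lin])
  qed
  have hk: "Ck_on k S h" by (rule Ck_on_Suc_imp[OF Suc.prems(2)])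
  have "Ck_on k S (\<lambda>x. frechet_derivative (\<lambda>x. f (h x)) (at x) v)" for v
    using Suc.prems hk
    by (intro Ck_on_cong[OF S D, THEN iffD2] Ck_on_sum Ck_on_scaleR S Suc.IH Ck_on_bounded_linear[OF S bounded_linear_inner_left]) auto
  then show ?case using D' unfolding Ck_on.simps differentiable_def by blast
qed

lemma smooth_on_add:
  "open S \<Longrightarrow> smooth_on S f \<Longrightarrow> smooth_on S g \<Longrightarrow> smooth_on S (\<lambda>x. f x + g x)"
  unfolding smooth_on_def using Ck_on_add by blast

lemma smooth_on_scaleR:
  "open S \<Longrightarrow> smooth_on S f \<Longrightarrow> smooth_on S g \<Longrightarrow> smooth_on S (\<lambda>x. f x *\<^sub>R g x)"
  unfolding smooth_on_def using Ck_on_scaleR by blast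

lemma smooth_on_mult:
  fixes f g :: "'a::euclidean_space \<Rightarrow> real"
  shows "open S \<Longrightarrow> smooth_on S f \<Longrightarrow> smooth_on S g \<Longrightarrow> smooth_on S (\<lambda>x. f x * g x)"
  using smooth_on_scaleR[of S f g] by simp

lemma smooth_on_sum:
  "open S \<Longrightarrow> finite I \<Longrightarrow> (\<And>i. i \<in> I \<Longrightarrow> smooth_on S (f i)) \<Longrightarrow> smooth_on S (\<lambda>x. \<Sum>i\<in>I. f i x)"
  unfolding smooth_on_def using Ck_on_sum by blast

lemma smooth_on_inner_left: "open S \<Longrightarrow> smooth_on S f \<Longrightarrow> smooth_on S (\<lambda>x. f x \<bullet> b)"
  unfolding smooth_on_def using Ck_on_bounded_linear[OF _ bounded_linear_inner_left] by blast

lemma smooth_on_compose: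
  fixes h :: "'a::euclidean_space \<Rightarrow> 'b::euclidean_space"
  shows "open S \<Longrightarrow> (\<And>x. x \<in> S \<Longrightarrow> h x \<in> T) \<Longrightarrow> smooth_on T f \<Longrightarrow> smooth_on S h \<Longrightarrow>
    smooth_on S (\<lambda>x. f (h x))"
  unfolding smooth_on_def using Ck_on_compose by blast

text \<open>The family of all powers is closed under differentiation up to constant factors.  The exponent
  \<open>-1/2\<close> serves to normalise vector fields.\<close>

lemma Ck_on_powr: "Ck_on k {0<..} (\<lambda>x::real. x powr a)"
proof (induction k arbitrary: a)
  case 0
  then show ?case by (auto intro!: continuous_intros)
next
  case (Suc k)
  have D': "((\<lambda>x::real. x powr a) has_derivative (\<lambda>v. v *\<^sub>R (a *\<^sub>R x powr (a - 1)))) (at x)"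
    if "x \<in> {0<..}" for x
  proof -
    have "(\<lambda>v. v *\<^sub>R (a *\<^sub>R x powr (a - 1))) = (*) (a * x powr (a - 1))"
      by (simp add: fun_eq_iff)
    then show ?thesis
      using has_real_derivative_powr[of x a] that by (simp add: has_field_derivative_def)
  qed
  have D: "frechet_derivative (\<lambda>x::real. x powr a) (at x) v = v *\<^sub>R (a *\<^sub>R x powr (a - 1))"
    if "x \<in> {0<..}" for x v
    using frechet_derivative_at[OF D'[OF that]] by metis
  have "Ck_on k {0<..} (\<lambda>x. frechet_derivative (\<lambda>x::real. x powr a) (at x) v)" for v
    by (rule Ck_on_cong[OF open_greaterThan D, THEN iffD2], assumption,
        rule Ck_on_bounded_linear[OF open_greaterThan bounded_linear_scaleR_right],
        rule Ck_on_bounded_linear[OF open_greaterThan bounded_linear_scaleR_right], rule Suc.IH)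
  then show ?case using D' unfolding Ck_on.simps differentiable_def by blast
qed

lemma smooth_on_powr:
  fixes f :: "'a::euclidean_space \<Rightarrow> real"
  assumes "open S" "smooth_on S f" "\<And>x. x \<in> S \<Longrightarrow> f x > 0"
  shows "smooth_on S (\<lambda>x. f x powr a)"
proof (rule smooth_on_compose[of S f "{0<..}" "\<lambda>x. x powr a"])
  show "smooth_on {0<..} (\<lambda>x::real. x powr a)"
    unfolding smooth_on_def using Ck_on_powr by blast
qed (use assms in simp_all)

lemma smooth_on_derivative_along:
  fixes f :: "'a::euclidean_space \<Rightarrow> 'b::real_normed_vector"
  assumes S: "open S" and f: "smooth_on S f" and X: "smooth_on S X"
  shows "smooth_on S (\<lambda>x. frechet_derivative f (at x) (X x))"
proof -
  have "frechet_derivative f (at x) (X x) =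
      (\<Sum>b\<in>Basis. (X x \<bullet> b) *\<^sub>R frechet_derivative f (at x) b)" if "x \<in> S" for x
  proof -
    have lin: "linear (frechet_derivative f (at x))"
      using smooth_on_has_derivative[OF f that] has_derivative_linear by blast
    have "frechet_derivative f (at x) (X x) =
      frechet_derivative f (at x) (\<Sum>b\<in>Basis. (X x \<bullet> b) *\<^sub>R b)"
      by (simp add: euclidean_representation)
    then show ?thesis by (simp only: linear_sum[OF lin] linear_scale[OF lin])
  qed
  note eq = this
  show ?thesis
    by (rule smooth_on_cong[OF S eq, THEN iffD2], assumption,
        intro smooth_on_sum smooth_on_scaleR smooth_on_inner_left smooth_on_frechet_derivative S f X finite_Basis)
qed

subsection \<open>Symmetry of the second derivative\<close>

text \<open>The second difference of \<open>F\<close> along the parallelogram spanned by \<open>h v\<close> and \<open>h w\<close>,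
  divided by \<open>h\<^sup>2\<close>, is a value of \<open>D\<^sub>w D\<^sub>v F\<close> near \<open>x\<close> by two applications of
  the mean value theorem.\<close>

lemma second_difference_mean_value:
  fixes F :: "'a::euclidean_space \<Rightarrow> real"
  assumes F: "smooth_on S F" and h: "h > 0"
    and box: "\<And>s t. 0 \<le> s \<Longrightarrow> s \<le> h \<Longrightarrow> 0 \<le> t \<Longrightarrow> t \<le> h \<Longrightarrow> x + s *\<^sub>R v + t *\<^sub>R w \<in> S"
  obtains s t where "0 < s" "s < h" "0 < t" "t < h"
    "F (x + h *\<^sub>R v + h *\<^sub>R w) - F (x + h *\<^sub>R v) - F (x + h *\<^sub>R w) + F x =
     h * (h * frechet_derivative (\<lambda>y. frechet_derivative F (at y) v) (at (x + s *\<^sub>R v + t *\<^sub>R w)) w)"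
proof -
  let ?G = "\<lambda>s. F (x + s *\<^sub>R v + h *\<^sub>R w) - F (x + s *\<^sub>R v + 0 *\<^sub>R w)"
  let ?Fv = "\<lambda>y. frechet_derivative F (at y) v"
  let ?Fvw = "\<lambda>y. frechet_derivative ?Fv (at y) w"
  have dF: "((\<lambda>s. F (x + s *\<^sub>R v + t *\<^sub>R w)) has_real_derivative ?Fv (x + s *\<^sub>R v + t *\<^sub>R w)) (at s)"
    if "0 \<le> s" "s \<le> h" "0 \<le> t" "t \<le> h" for s t
  proof -
    have D: "(F has_derivative frechet_derivative F (at (x + s *\<^sub>R v + t *\<^sub>R w))) (at (x + s *\<^sub>R v + t *\<^sub>R w))"
      by (rule smooth_on_has_derivative[OF F box[OF that]])
    have "((\<lambda>s. x + s *\<^sub>R v + t *\<^sub>R w) has_derivative (\<lambda>r. r *\<^sub>R v)) (at s)"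
      by (auto intro!: derivative_eq_intros)
    from has_derivative_compose[OF this D]
    have "((\<lambda>s. F (x + s *\<^sub>R v + t *\<^sub>R w)) has_derivative
        (\<lambda>r. frechet_derivative F (at (x + s *\<^sub>R v + t *\<^sub>R w)) (r *\<^sub>R v))) (at s)" .
    then show ?thesis
      using linear_scale[OF has_derivative_linear[OF D]]
      by (simp add: has_field_derivative_def mult_commute_abs)
  qed
  have dFv: "((\<lambda>t. ?Fv (x + s *\<^sub>R v + t *\<^sub>R w)) has_real_derivative ?Fvw (x + s *\<^sub>R v + t *\<^sub>R w)) (at t)"
    if "0 \<le> s" "s \<le> h" "0 \<le> t" "t \<le> h" for s t
  proof -
    have D: "(?Fv has_derivative frechet_derivative ?Fv (at (x + s *\<^sub>R v + t *\<^sub>R w))) (at (x + s *\<^sub>R v + t *\<^sub>R w))"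
      by (rule smooth_on_has_derivative[OF smooth_on_frechet_derivative[OF F] box[OF that]])
    have "((\<lambda>t. x + s *\<^sub>R v + t *\<^sub>R w) has_derivative (\<lambda>r. r *\<^sub>R w)) (at t)"
      by (auto intro!: derivative_eq_intros)
    from has_derivative_compose[OF this D]
    have "((\<lambda>t. ?Fv (x + s *\<^sub>R v + t *\<^sub>R w)) has_derivative
        (\<lambda>r. frechet_derivative ?Fv (at (x + s *\<^sub>R v + t *\<^sub>R w)) (r *\<^sub>R w))) (at t)" .
    then show ?thesis
      using linear_scale[OF has_derivative_linear[OF D]]
      by (simp add: has_field_derivative_def mult_commute_abs)
  qed
  have "\<exists>s>0. s < h \<and> ?G h - ?G 0 =
      (h - 0) * (?Fv (x + s *\<^sub>R v + h *\<^sub>R w) - ?Fv (x + s *\<^sub>R v + 0 *\<^sub>R w))"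
    by (rule MVT2[OF h]) (intro DERIV_diff dF; use h in auto)
  then obtain s where s: "0 < s" "s < h"
      "?G h - ?G 0 = h * (?Fv (x + s *\<^sub>R v + h *\<^sub>R w) - ?Fv (x + s *\<^sub>R v + 0 *\<^sub>R w))" by auto
  have "\<exists>t>0. t < h \<and> ?Fv (x + s *\<^sub>R v + h *\<^sub>R w) - ?Fv (x + s *\<^sub>R v + 0 *\<^sub>R w) =
      (h - 0) * ?Fvw (x + s *\<^sub>R v + t *\<^sub>R w)"
    by (rule MVT2[OF h]) (use s in \<open>auto intro!: dFv\<close>)
  then obtain t where t: "0 < t" "t < h"
    "?Fv (x + s *\<^sub>R v + h *\<^sub>R w) - ?Fv (x + s *\<^sub>R v + 0 *\<^sub>R w) = h * ?Fvw (x + s *\<^sub>R v + t *\<^sub>R w)" by auto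
  show ?thesis
    by (rule that[OF s(1,2) t(1,2)]) (use s(3) t(3) in \<open>simp add: algebra_simps\<close>)
qed

lemma second_derivative_symmetric:
  fixes F :: "'a::euclidean_space \<Rightarrow> real"
  assumes S: "open S" "x \<in> S" and F: "smooth_on S F"
  shows "frechet_derivative (\<lambda>y. frechet_derivative F (at y) v) (at x) w =
         frechet_derivative (\<lambda>y. frechet_derivative F (at y) w) (at x) v"
proof -
  define P where "P = (\<lambda>v w y. frechet_derivative (\<lambda>y. frechet_derivative F (at y) v) (at y) w)"
  have cont: "isCont (P v w) x" for v w
    using smooth_on_continuous[OF smooth_on_frechet_derivative[OF smooth_on_frechet_derivative[OF F]]]
      S continuous_on_eq_continuous_at unfolding P_def by blast
  have "\<bar>P v w x - P w v x\<bar> < e" if e: "e > 0" for e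
  proof -
    from cont e obtain d1 where d1: "d1 > 0" "\<And>y. dist y x < d1 \<Longrightarrow> dist (P v w y) (P v w x) < e/2"
      unfolding continuous_at_eps_delta by (metis half_gt_zero)
    from cont e obtain d2 where d2: "d2 > 0" "\<And>y. dist y x < d2 \<Longrightarrow> dist (P w v y) (P w v x) < e/2"
      unfolding continuous_at_eps_delta by (metis half_gt_zero)
    from S obtain d3 where d3: "d3 > 0" "ball x d3 \<subseteq> S"
      using openE by blast
    define d where "d = min d1 (min d2 d3)"
    have d: "d > 0" using d1 d2 d3 by (simp add: d_def)
    define h where "h = d / (2 * (norm v + norm w + 1))"
    have nn: "norm v + norm w + 1 > 0" by (simp add: add_nonneg_pos)
    have h: "h > 0" using d nn by (simp add: h_def)
    have close: "dist (x + s *\<^sub>R a + t *\<^sub>R b) x < d"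
      if "0 \<le> s" "s \<le> h" "0 \<le> t" "t \<le> h" "norm a + norm b = norm v + norm w" for s t a b
    proof -
      have "dist (x + s *\<^sub>R a + t *\<^sub>R b) x \<le> norm (s *\<^sub>R a) + norm (t *\<^sub>R b)"
        by (simp add: dist_norm add.assoc) (metis norm_scaleR norm_triangle_ineq)
      also have "\<dots> \<le> h * norm a + h * norm b"
        using that by (auto intro!: add_mono mult_right_mono)
      also have "\<dots> < h * (2 * (norm v + norm w + 1))"
        using h that nn unfolding distrib_left[symmetric] by (intro mult_strict_left_mono) auto
      finally show ?thesis using nn by (simp add: h_def)
    qed
    have inS: "x + s *\<^sub>R a + t *\<^sub>R b \<in> S"
      if "0 \<le> s" "s \<le> h" "0 \<le> t" "t \<le> h" "norm a + norm b = norm v + norm w" for s t a b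
      using close[OF that] d3 unfolding d_def by (auto simp: subset_iff dist_commute)
    obtain s t where st: "0 < s" "s < h" "0 < t" "t < h"
      "F (x + h *\<^sub>R v + h *\<^sub>R w) - F (x + h *\<^sub>R v) - F (x + h *\<^sub>R w) + F x =
        h * (h * P v w (x + s *\<^sub>R v + t *\<^sub>R w))"
      using second_difference_mean_value[OF F h, of x v w] inS unfolding P_def by blast
    obtain s' t' where st': "0 < s'" "s' < h" "0 < t'" "t' < h"
      "F (x + h *\<^sub>R w + h *\<^sub>R v) - F (x + h *\<^sub>R w) - F (x + h *\<^sub>R v) + F x =
        h * (h * P w v (x + s' *\<^sub>R w + t' *\<^sub>R v))"
      using second_difference_mean_value[OF F h, of x w v] inS unfolding P_def
      by (metis add.commute)
    have "h * (h * P v w (x + s *\<^sub>R v + t *\<^sub>R w)) = h * (h * P w v (x + s' *\<^sub>R w + t' *\<^sub>R v))"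
      using st(5) st'(5) by (simp add: algebra_simps)
    then have eq: "P v w (x + s *\<^sub>R v + t *\<^sub>R w) = P w v (x + s' *\<^sub>R w + t' *\<^sub>R v)"
      using h by simp
    have "dist (P v w (x + s *\<^sub>R v + t *\<^sub>R w)) (P v w x) < e/2"
      using close[of s t v w] st by (intro d1) (auto simp: d_def)
    moreover have "dist (P w v (x + s' *\<^sub>R w + t' *\<^sub>R v)) (P w v x) < e/2"
      using close[of s' t' w v] st' by (intro d2) (auto simp: d_def)
    ultimately show ?thesis using eq by (auto simp: dist_real_def abs_if split: if_splits)
  qed
  then have "\<not> 0 < \<bar>P v w x - P w v x\<bar>" by blast
  then show ?thesis by (simp add: P_def)
qed

lemma frechet_derivative_along:
  fixes F :: "'a::euclidean_space \<Rightarrow> real"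
  assumes S: "open S" "x \<in> S" and F: "smooth_on S F" and Y: "smooth_on S Y"
  shows "frechet_derivative (\<lambda>y. frechet_derivative F (at y) (Y y)) (at x) w =
    frechet_derivative (\<lambda>y. frechet_derivative F (at y) (Y x)) (at x) w +
    frechet_derivative F (at x) (frechet_derivative Y (at x) w)"
proof -
  let ?Fb = "\<lambda>b y. frechet_derivative F (at y) b"
  have expand: "frechet_derivative F (at y) u = (\<Sum>b\<in>Basis. (u \<bullet> b) * ?Fb b y)" if "y \<in> S" for y u
  proof -
    have lin: "linear (frechet_derivative F (at y))"
      using smooth_on_has_derivative[OF F that] has_derivative_linear by blast
    have "frechet_derivative F (at y) u = frechet_derivative F (at y) (\<Sum>b\<in>Basis. (u \<bullet> b) *\<^sub>R b)"
      by (simp add: euclidean_representation)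
    then show ?thesis by (simp add: linear_sum[OF lin] linear_scale[OF lin])
  qed
  have DFb: "(?Fb b has_derivative frechet_derivative (?Fb b) (at x)) (at x)" for b
    by (rule smooth_on_has_derivative[OF smooth_on_frechet_derivative[OF F] S(2)])
  have DY: "(Y has_derivative frechet_derivative Y (at x)) (at x)"
    by (rule smooth_on_has_derivative[OF Y S(2)])
  have "((\<lambda>y. \<Sum>b\<in>Basis. (Y y \<bullet> b) * ?Fb b y) has_derivative
      (\<lambda>w. \<Sum>b\<in>Basis. (Y x \<bullet> b) * frechet_derivative (?Fb b) (at x) w +
        (frechet_derivative Y (at x) w \<bullet> b) * ?Fb b x)) (at x)"
    by (intro has_derivative_sum has_derivative_mult has_derivative_inner_left DY DFb)
  note fun_cong[OF frechet_derivative_at[OF this], of w]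
  moreover have "frechet_derivative (\<lambda>y. frechet_derivative F (at y) (Y y)) (at x) =
      frechet_derivative (\<lambda>y. \<Sum>b\<in>Basis. (Y y \<bullet> b) * ?Fb b y) (at x)"
    by (rule frechet_derivative_cong_open[OF S expand])
  ultimately have 1: "frechet_derivative (\<lambda>y. frechet_derivative F (at y) (Y y)) (at x) w =
      (\<Sum>b\<in>Basis. (Y x \<bullet> b) * frechet_derivative (?Fb b) (at x) w +
        (frechet_derivative Y (at x) w \<bullet> b) * ?Fb b x)"
    by simp
  have "((\<lambda>y. \<Sum>b\<in>Basis. (Y x \<bullet> b) * ?Fb b y) has_derivative
      (\<lambda>w. \<Sum>b\<in>Basis. (Y x \<bullet> b) * frechet_derivative (?Fb b) (at x) w)) (at x)"
    by (intro has_derivative_sum has_derivative_mult_right DFb)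
  note fun_cong[OF frechet_derivative_at[OF this], of w]
  moreover have "frechet_derivative (\<lambda>y. frechet_derivative F (at y) (Y x)) (at x) =
      frechet_derivative (\<lambda>y. \<Sum>b\<in>Basis. (Y x \<bullet> b) * ?Fb b y) (at x)"
    by (rule frechet_derivative_cong_open[OF S expand])
  ultimately have 2: "frechet_derivative (\<lambda>y. frechet_derivative F (at y) (Y x)) (at x) w =
      (\<Sum>b\<in>Basis. (Y x \<bullet> b) * frechet_derivative (?Fb b) (at x) w)"
    by simp
  show ?thesis
    using 1 2 expand[OF S(2), of "frechet_derivative Y (at x) w"] by (simp add: sum.distrib)
qed

text \<open>The terms with second derivatives of \<open>F\<close> cancel by symmetry.\<close>

lemma commutator_of_derivatives:
  fixes F :: "'a::euclidean_space \<Rightarrow> real"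
  assumes S: "open S" "x \<in> S" and F: "smooth_on S F" and X: "smooth_on S X" and Y: "smooth_on S Y"
  shows "frechet_derivative (\<lambda>y. frechet_derivative F (at y) (Y y)) (at x) (X x) -
         frechet_derivative (\<lambda>y. frechet_derivative F (at y) (X y)) (at x) (Y x) =
         frechet_derivative F (at x) (frechet_derivative Y (at x) (X x) - frechet_derivative X (at x) (Y x))"
proof -
  have lin: "linear (frechet_derivative F (at x))"
    using smooth_on_has_derivative[OF F S(2)] has_derivative_linear by blast
  show ?thesis
    unfolding frechet_derivative_along[OF S F Y] frechet_derivative_along[OF S F X] linear_diff[OF lin]
    using second_derivative_symmetric[OF S F, of "Y x" "X x"] by simp
qed

section \<open>Vector fields on a smooth manifold\<close>

lemma smooth_fun_subset: "smooth_fun A U f \<Longrightarrow> V \<subseteq> U \<Longrightarrow> smooth_fun A V f"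
  unfolding smooth_fun_def by (meson Int_mono image_mono order_refl smooth_on_subset)

lemma smooth_vf_subset: "smooth_vf A U X \<Longrightarrow> V \<subseteq> U \<Longrightarrow> smooth_vf A V X"
  unfolding smooth_vf_def by (meson Int_mono image_mono order_refl smooth_on_subset subsetD)

lemma smooth_vf_tangent: "smooth_vf A U X \<Longrightarrow> p \<in> U \<Longrightarrow> X p \<in> tangent_space A p"
  by (simp add: smooth_vf_def)

locale smooth_manifold =
  fixes A :: "('m::t2_space, 'e::euclidean_space) chart set"
  assumes atlas: "smooth_atlas A"
begin

lemma is_chart: "c \<in> A \<Longrightarrow> is_chart c"
  using atlas by (simp add: smooth_atlas_def)

lemma chart_exists: obtains c where "c \<in> A" "p \<in> cdom c"
proof -
  have "p \<in> (\<Union>c\<in>A. cdom c)" using atlas by (simp add: smooth_atlas_def)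
  then show ?thesis using that by blast
qed

lemma open_cdom: "c \<in> A \<Longrightarrow> open (cdom c)"
  using is_chart by (simp add: is_chart_def)

lemma param_coord [simp]: "c \<in> A \<Longrightarrow> p \<in> cdom c \<Longrightarrow> param c (coord c p) = p"
  using is_chart by (simp add: is_chart_def homeomorphism_def)

lemma param_in: "c \<in> A \<Longrightarrow> x \<in> coord c ` (U \<inter> cdom c) \<Longrightarrow>
    param c x \<in> U \<and> param c x \<in> cdom c \<and> coord c (param c x) = x"
  by auto

lemma open_chart_image:
  assumes c: "c \<in> A" and U: "open U"
  shows "open (coord c ` (U \<inter> cdom c))"
proof -
  have h: "homeomorphism (cdom c) (coord c ` cdom c) (coord c) (param c)" and o: "open (coord c ` cdom c)"
    using is_chart[OF c] by (auto simp: is_chart_def)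
  have "openin (top_of_set (cdom c)) (U \<inter> cdom c)"
    using U by (metis Int_commute openin_open_Int)
  from homeomorphism_imp_open_map[OF h this] o show ?thesis
    using openin_open_trans by blast
qed

lemma transition_smooth:
  "c \<in> A \<Longrightarrow> d \<in> A \<Longrightarrow> smooth_on (coord c ` (cdom c \<inter> cdom d)) (\<lambda>x. coord d (param c x))"
  using atlas by (simp add: smooth_atlas_def comp_def)

text \<open>The transition matrix for the components of tangent vectors, from the chart \<open>c\<close> to the chart \<open>d\<close>.\<close>

definition jacobian :: "('m, 'e) chart \<Rightarrow> ('m, 'e) chart \<Rightarrow> 'm \<Rightarrow> 'e \<Rightarrow> 'e"
  where "jacobian c d p = frechet_derivative (coord d \<circ> param c) (at (coord c p))"

lemma transition_has_derivative:
  assumes "c \<in> A" "d \<in> A" "p \<in> cdom c" "p \<in> cdom d"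
  shows "((\<lambda>x. coord d (param c x)) has_derivative jacobian c d p) (at (coord c p))"
  using smooth_on_has_derivative[OF transition_smooth[OF assms(1,2)], of "coord c p"] assms
  by (auto simp: jacobian_def comp_def)

lemma linear_jacobian: "c \<in> A \<Longrightarrow> d \<in> A \<Longrightarrow> p \<in> cdom c \<Longrightarrow> p \<in> cdom d \<Longrightarrow> linear (jacobian c d p)"
  using transition_has_derivative has_derivative_linear by blast

text \<open>This chain rule gives both the cocycle property of the Jacobians (for a coordinate function \<open>h\<close>)
  and the chart independence of \<open>X f\<close> (for \<open>h = f\<close>).\<close>

lemma has_derivative_change_chart:
  assumes cd: "c \<in> A" "d \<in> A" and p: "p \<in> cdom c" "p \<in> cdom d"
    and h: "((\<lambda>x. h (param d x)) has_derivative H) (at (coord d p))"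
  shows "((\<lambda>x. h (param c x)) has_derivative (\<lambda>v. H (jacobian c d p v))) (at (coord c p))"
proof -
  let ?S = "coord c ` (cdom d \<inter> cdom c)"
  have S: "open ?S" "coord c p \<in> ?S"
    using open_chart_image[OF cd(1) open_cdom[OF cd(2)]] p by auto
  have "((\<lambda>x. h (param d x)) has_derivative H) (at (coord d (param c (coord c p))))"
    using h p cd by simp
  from has_derivative_compose[OF transition_has_derivative[OF cd p] this]
  have "((\<lambda>x. h (param d (coord d (param c x)))) has_derivative (\<lambda>v. H (jacobian c d p v))) (at (coord c p))" .
  then show ?thesis
    by (rule has_derivative_transform_within_open[OF _ S]) (use cd in auto)
qed

lemma jacobian_jacobian:
  assumes "c \<in> A" "d \<in> A" "k \<in> A" "p \<in> cdom c" "p \<in> cdom d" "p \<in> cdom k"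
  shows "jacobian d k p (jacobian c d p v) = jacobian c k p v"
  using has_derivative_unique[OF transition_has_derivative[of c k p]
      has_derivative_change_chart[of c d p "coord k", OF _ _ _ _ transition_has_derivative]]
    assms by (metis (no_types, lifting))

lemma jacobian_same:
  assumes "c \<in> A" "p \<in> cdom c"
  shows "jacobian c c p v = v"
proof -
  let ?S = "coord c ` (UNIV \<inter> cdom c)"
  have "((\<lambda>x. coord c (param c x)) has_derivative (\<lambda>v. v)) (at (coord c p))"
    by (rule has_derivative_transform_within_open[of "\<lambda>x. x" _ _ _ ?S])
      (use assms open_chart_image[OF assms(1) open_UNIV] in auto)
  from has_derivative_unique[OF transition_has_derivative[OF assms(1,1,2,2)] this] show ?thesis by metis
qed

subsection \<open>Tangent vectors\<close>

lemma tangent_space_iff: "v \<in> tangent_space A p \<longleftrightarrow>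
    (\<forall>c\<in>A. \<forall>d\<in>A. p \<in> cdom c \<longrightarrow> p \<in> cdom d \<longrightarrow> v d = jacobian c d p (v c)) \<and>
    (\<forall>c. \<not> (c \<in> A \<and> p \<in> cdom c) \<longrightarrow> v c = 0)"
  by (simp add: tangent_space_def jacobian_def)

lemma tangent_spaceI:
  assumes "\<And>c d. c \<in> A \<Longrightarrow> d \<in> A \<Longrightarrow> p \<in> cdom c \<Longrightarrow> p \<in> cdom d \<Longrightarrow> v d = jacobian c d p (v c)"
    and "\<And>c. \<not> (c \<in> A \<and> p \<in> cdom c) \<Longrightarrow> v c = 0"
  shows "v \<in> tangent_space A p"
  unfolding tangent_space_iff using assms by blast

lemma tangent_space_jacobian:
  "v \<in> tangent_space A p \<Longrightarrow> c \<in> A \<Longrightarrow> d \<in> A \<Longrightarrow> p \<in> cdom c \<Longrightarrow> p \<in> cdom d \<Longrightarrow> v d = jacobian c d p (v c)"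
  unfolding tangent_space_iff by blast

lemma tangent_space_zero:
  "v \<in> tangent_space A p \<Longrightarrow> \<not> (c \<in> A \<and> p \<in> cdom c) \<Longrightarrow> v c = 0"
  unfolding tangent_space_iff by blast

lemma tangent_eqI:
  assumes "v \<in> tangent_space A p" "w \<in> tangent_space A p" "c \<in> A" "p \<in> cdom c" "v c = w c"
  shows "v = w"
proof
  fix d show "v d = w d"
  proof (cases "d \<in> A \<and> p \<in> cdom d")
    case True
    then show ?thesis
      using tangent_space_jacobian[OF assms(1,3)] tangent_space_jacobian[OF assms(2,3)] assms(4,5) by metis
  next
    case False
    then show ?thesis using tangent_space_zero assms(1,2) by metis
  qed
qed

lemma subspace_tangent: "subspace (tangent_space A p)"
proof (rule subspaceI)
  show "0 \<in> tangent_space A p"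
    by (rule tangent_spaceI) (simp_all add: linear_0[OF linear_jacobian])
  show "v + w \<in> tangent_space A p" if vw: "v \<in> tangent_space A p" "w \<in> tangent_space A p" for v w
  proof (rule tangent_spaceI)
    fix c d assume cd: "c \<in> A" "d \<in> A" "p \<in> cdom c" "p \<in> cdom d"
    show "(v + w) d = jacobian c d p ((v + w) c)"
      using tangent_space_jacobian[OF vw(1) cd] tangent_space_jacobian[OF vw(2) cd]
      by (simp add: linear_add[OF linear_jacobian[OF cd]])
  qed (simp add: tangent_space_zero[OF vw(1)] tangent_space_zero[OF vw(2)])
  show "r *\<^sub>R v \<in> tangent_space A p" if v: "v \<in> tangent_space A p" for r v
  proof (rule tangent_spaceI)
    fix c d assume cd: "c \<in> A" "d \<in> A" "p \<in> cdom c" "p \<in> cdom d"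
    show "(r *\<^sub>R v) d = jacobian c d p ((r *\<^sub>R v) c)"
      using tangent_space_jacobian[OF v cd] by (simp add: scaleR_fun_def linear_scale[OF linear_jacobian[OF cd]])
  qed (simp add: scaleR_fun_def tangent_space_zero[OF v])
qed

text \<open>The vector field on the domain of \<open>c\<close> which has the constant components \<open>v\<close> in the chart \<open>c\<close>.\<close>

definition coord_field :: "('m, 'e) chart \<Rightarrow> 'e \<Rightarrow> ('m, 'e) vfield" where
  "coord_field c v q d = (if d \<in> A \<and> q \<in> cdom c \<and> q \<in> cdom d then jacobian c d q v else 0)"

lemma coord_field_tangent: "c \<in> A \<Longrightarrow> p \<in> cdom c \<Longrightarrow> coord_field c v p \<in> tangent_space A p"
  by (rule tangent_spaceI) (auto simp: coord_field_def jacobian_jacobian)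

lemma coord_field_same: "c \<in> A \<Longrightarrow> p \<in> cdom c \<Longrightarrow> coord_field c v p c = v"
  by (simp add: coord_field_def jacobian_same)

lemma coord_field_smooth:
  assumes c: "c \<in> A"
  shows "smooth_vf A (cdom c) (coord_field c v)"
  unfolding smooth_vf_def
proof (intro conjI ballI)
  fix d assume d: "d \<in> A"
  let ?S = "coord d ` (cdom c \<inter> cdom d)"
  let ?F = "\<lambda>x. frechet_derivative (\<lambda>x. coord d (param c x)) (at x) v"
  have S: "open ?S" by (rule open_chart_image[OF d open_cdom[OF c]])
  have eq: "coord_field c v (param d x) d = ?F (coord c (param d x))" if "x \<in> ?S" for x
    using that d by (auto simp: coord_field_def jacobian_def comp_def)
  have "smooth_on ?S (\<lambda>x. ?F (coord c (param d x)))"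
  proof (rule smooth_on_compose[OF S, where h = "\<lambda>x. coord c (param d x)" and f = ?F
        and T = "coord c ` (cdom c \<inter> cdom d)"])
    show "coord c (param d x) \<in> coord c ` (cdom c \<inter> cdom d)" if "x \<in> ?S" for x
      using that d by auto
    show "smooth_on (coord c ` (cdom c \<inter> cdom d)) ?F"
      by (rule smooth_on_frechet_derivative[OF transition_smooth[OF c d]])
    show "smooth_on ?S (\<lambda>x. coord c (param d x))"
      using transition_smooth[OF d c] by (simp add: Int_commute)
  qed
  then show "smooth_on ?S (\<lambda>x. coord_field c v (param d x) d)"
    by (rule smooth_on_cong[OF S eq, THEN iffD2, rotated])
qed (use c coord_field_tangent in auto)

subsection \<open>Smooth functions and vector fields\<close>

lemma smooth_fun_const: "smooth_fun A U (\<lambda>q. a)"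
  by (simp add: smooth_fun_def comp_def smooth_on_const)

lemma smooth_fun_add:
  "open U \<Longrightarrow> smooth_fun A U f \<Longrightarrow> smooth_fun A U h \<Longrightarrow> smooth_fun A U (\<lambda>q. f q + h q)"
  by (simp add: smooth_fun_def comp_def smooth_on_add open_chart_image)

lemma smooth_fun_mult:
  "open U \<Longrightarrow> smooth_fun A U f \<Longrightarrow> smooth_fun A U h \<Longrightarrow> smooth_fun A U (\<lambda>q. f q * h q)"
  by (simp add: smooth_fun_def comp_def smooth_on_mult open_chart_image)

lemma smooth_fun_minus: "open U \<Longrightarrow> smooth_fun A U f \<Longrightarrow> smooth_fun A U (\<lambda>q. - f q)"
  using smooth_fun_mult[OF _ smooth_fun_const[of U "-1"]] by simp

lemma smooth_fun_powr:
  assumes "open U" "smooth_fun A U f" "\<And>q. q \<in> U \<Longrightarrow> f q > 0"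
  shows "smooth_fun A U (\<lambda>q. f q powr a)"
  unfolding smooth_fun_def comp_def
proof
  fix c assume c: "c \<in> A"
  show "smooth_on (coord c ` (U \<inter> cdom c)) (\<lambda>x. f (param c x) powr a)"
    using assms c by (intro smooth_on_powr open_chart_image) (auto simp: smooth_fun_def comp_def)
qed

lemma smooth_fun_continuous:
  assumes U: "open U" and f: "smooth_fun A U f"
  shows "continuous_on U f"
proof -
  have "continuous (at p) f" if p: "p \<in> U" for p
  proof -
    obtain c where c: "c \<in> A" "p \<in> cdom c" by (rule chart_exists)
    let ?V = "U \<inter> cdom c"
    have V: "open ?V" "p \<in> ?V" using U c p by (auto intro: open_Int open_cdom)
    have "continuous_on (cdom c) (coord c)"
      using is_chart[OF c(1)] by (simp add: is_chart_def homeomorphism_def)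
    then have "continuous_on ?V (coord c)" by (rule continuous_on_subset) simp
    moreover have "continuous_on (coord c ` ?V) (f \<circ> param c)"
      by (rule smooth_on_continuous) (use f c in \<open>simp add: smooth_fun_def\<close>)
    ultimately have "continuous_on ?V ((f \<circ> param c) \<circ> coord c)"
      by (rule continuous_on_compose)
    then have "continuous_on ?V f"
      by (rule continuous_on_cong[THEN iffD1, OF refl, rotated]) (use c in auto)
    then show ?thesis using V continuous_on_eq_continuous_at by blast
  qed
  then show ?thesis by (simp add: continuous_at_imp_continuous_on)
qed

lemma smooth_vf_cong:
  assumes "open U" "\<And>q. q \<in> U \<Longrightarrow> X q = Y q" "smooth_vf A U X"
  shows "smooth_vf A U Y"
  unfolding smooth_vf_def
proof (intro conjI ballI)
  fix c assume c: "c \<in> A"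
  have S: "open (coord c ` (U \<inter> cdom c))" by (rule open_chart_image[OF c assms(1)])
  show "smooth_on (coord c ` (U \<inter> cdom c)) (\<lambda>x. Y (param c x) c)"
    by (rule smooth_on_cong[OF S, THEN iffD1, of "\<lambda>x. X (param c x) c"])
      (use assms c in \<open>auto simp: smooth_vf_def\<close>)
qed (use assms in \<open>auto simp: smooth_vf_def\<close>)

lemma smooth_vf_add:
  assumes "open U" "smooth_vf A U X" "smooth_vf A U Y"
  shows "smooth_vf A U (\<lambda>q. X q + Y q)"
  using assms unfolding smooth_vf_def
  by (auto intro!: smooth_on_add open_chart_image subspace_add[OF subspace_tangent])

lemma smooth_vf_scaleR:
  assumes "open U" "smooth_fun A U f" "smooth_vf A U X"
  shows "smooth_vf A U (\<lambda>q. f q *\<^sub>R X q)"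
  using assms unfolding smooth_vf_def smooth_fun_def
  by (auto simp: scaleR_fun_def[of _ "X _"] comp_def intro!: smooth_on_scaleR open_chart_image)
    (use subspace_scale[OF subspace_tangent] in \<open>fastforce simp: scaleR_fun_def\<close>)

lemma smooth_vf_uminus:
  assumes "open U" "smooth_vf A U X"
  shows "smooth_vf A U (\<lambda>q. - X q)"
  using smooth_vf_scaleR[OF assms(1) smooth_fun_const[of U "-1"] assms(2)] by simp

lemma smooth_vf_diff:
  assumes "open U" "smooth_vf A U X" "smooth_vf A U Y"
  shows "smooth_vf A U (\<lambda>q. X q - Y q)"
  using smooth_vf_add[OF assms(1,2) smooth_vf_uminus[OF assms(1,3)]] by simp

lemma smooth_vf_sum:
  assumes "open U" "finite I" "\<And>i. i \<in> I \<Longrightarrow> smooth_vf A U (X i)"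
  shows "smooth_vf A U (\<lambda>q. \<Sum>i\<in>I. X i q)"
  using assms(2,3)
proof (induction I rule: finite_induct)
  case empty
  have "(\<lambda>a. 0) \<in> tangent_space A p" for p
    using subspace_0[OF subspace_tangent] by (simp add: zero_fun_def)
  then show ?case by (simp add: smooth_vf_def smooth_on_const zero_fun_def)
qed (auto intro!: smooth_vf_add assms(1))

lemma smooth_fun_coord:
  assumes c: "c \<in> A"
  shows "smooth_fun A (cdom c) (\<lambda>q. coord c q \<bullet> b)"
  unfolding smooth_fun_def comp_def
  using transition_smooth[OF _ c] open_chart_image[OF _ open_cdom[OF c]]
  by (auto intro!: smooth_on_inner_left simp: Int_commute)

subsection \<open>Derivatives of functions and the Lie bracket\<close>

text \<open>The components of \<open>X\<close> transform by the Jacobian, which cancels the one in the chain rule.  So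
  the arbitrary choice of a chart in the definition of \<open>X f\<close> does no harm.\<close>

lemma vf_deriv_chart:
  assumes U: "open U" "p \<in> U" and f: "smooth_fun A U f" and X: "smooth_vf A U X"
    and c: "c \<in> A" "p \<in> cdom c"
  shows "vf_deriv A X f p = frechet_derivative (f \<circ> param c) (at (coord c p)) (X p c)"
proof -
  define d where "d = (SOME c. c \<in> A \<and> p \<in> cdom c)"
  have d: "d \<in> A" "p \<in> cdom d"
    using someI[of "\<lambda>c. c \<in> A \<and> p \<in> cdom c" c] c unfolding d_def by auto
  have "((\<lambda>x. f (param d x)) has_derivative frechet_derivative (f \<circ> param d) (at (coord d p))) (at (coord d p))"
    using smooth_on_has_derivative[of "coord d ` (U \<inter> cdom d)" "f \<circ> param d" "coord d p"] f d U
    by (auto simp: smooth_fun_def comp_def)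
  from fun_cong[OF frechet_derivative_at[OF has_derivative_change_chart[OF c(1) d(1) c(2) d(2) this]], of "X p c"]
  have "frechet_derivative (f \<circ> param c) (at (coord c p)) (X p c) =
      frechet_derivative (f \<circ> param d) (at (coord d p)) (jacobian c d p (X p c))"
    by (simp add: comp_def)
  then show ?thesis
    using tangent_space_jacobian[OF smooth_vf_tangent[OF X U(2)] c(1) d(1) c(2) d(2)]
    by (simp add: vf_deriv_def Let_def d_def[symmetric])
qed

lemma vf_deriv_cong:
  assumes U: "open U" "p \<in> U" and eq: "\<And>q. q \<in> U \<Longrightarrow> f q = h q" and X: "X p = Y p"
  shows "vf_deriv A X f p = vf_deriv A Y h p"
proof -
  define d where "d = (SOME c. c \<in> A \<and> p \<in> cdom c)"
  obtain c where "c \<in> A" "p \<in> cdom c" by (rule chart_exists)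
  then have d: "d \<in> A" "p \<in> cdom d"
    using someI[of "\<lambda>c. c \<in> A \<and> p \<in> cdom c" c] unfolding d_def by auto
  have "frechet_derivative (f \<circ> param d) (at (coord d p)) =
      frechet_derivative (h \<circ> param d) (at (coord d p))"
    by (rule frechet_derivative_cong_open[OF open_chart_image[OF d(1) U(1)]]) (use U d eq in auto)
  then show ?thesis using X by (simp add: vf_deriv_def Let_def d_def[symmetric])
qed

lemma smooth_fun_vf_deriv:
  assumes U: "open U" and f: "smooth_fun A U f" and X: "smooth_vf A U X"
  shows "smooth_fun A U (vf_deriv A X f)"
  unfolding smooth_fun_def
proof
  fix c assume c: "c \<in> A"
  let ?S = "coord c ` (U \<inter> cdom c)"
  have S: "open ?S" by (rule open_chart_image[OF c U])
  have eq: "(vf_deriv A X f \<circ> param c) x = frechet_derivative (f \<circ> param c) (at x) (X (param c x) c)"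
    if "x \<in> ?S" for x
    using vf_deriv_chart[OF U _ f X c] param_in[OF c that] by simp
  show "smooth_on ?S (vf_deriv A X f \<circ> param c)"
    by (rule smooth_on_cong[OF S eq, THEN iffD2], assumption, rule smooth_on_derivative_along[OF S])
      (use f X c in \<open>auto simp: smooth_fun_def smooth_vf_def\<close>)
qed

lemma vf_deriv_add:
  assumes U: "open U" "p \<in> U" and f: "smooth_fun A U f" and h: "smooth_fun A U h"
    and X: "smooth_vf A U X"
  shows "vf_deriv A X (\<lambda>q. f q + h q) p = vf_deriv A X f p + vf_deriv A X h p"
proof -
  obtain c where c: "c \<in> A" "p \<in> cdom c" by (rule chart_exists)
  have D: "((k \<circ> param c) has_derivative frechet_derivative (k \<circ> param c) (at (coord c p))) (at (coord c p))"
    if "smooth_fun A U k" for k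
    using smooth_on_has_derivative[of "coord c ` (U \<inter> cdom c)"] that c U by (auto simp: smooth_fun_def)
  have "((\<lambda>x. (f \<circ> param c) x + (h \<circ> param c) x) has_derivative
      (\<lambda>v. frechet_derivative (f \<circ> param c) (at (coord c p)) v +
           frechet_derivative (h \<circ> param c) (at (coord c p)) v)) (at (coord c p))"
    by (intro has_derivative_add D f h)
  from fun_cong[OF frechet_derivative_at[OF this], of "X p c"] show ?thesis
    unfolding vf_deriv_chart[OF U f X c] vf_deriv_chart[OF U h X c]
      vf_deriv_chart[OF U smooth_fun_add[OF U(1) f h] X c] by (simp add: comp_def)
qed

lemma vf_deriv_mult:
  assumes U: "open U" "p \<in> U" and f: "smooth_fun A U f" and h: "smooth_fun A U h"
    and X: "smooth_vf A U X"
  shows "vf_deriv A X (\<lambda>q. f q * h q) p = f p * vf_deriv A X h p + vf_deriv A X f p * h p"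
proof -
  obtain c where c: "c \<in> A" "p \<in> cdom c" by (rule chart_exists)
  have D: "((k \<circ> param c) has_derivative frechet_derivative (k \<circ> param c) (at (coord c p))) (at (coord c p))"
    if "smooth_fun A U k" for k
    using smooth_on_has_derivative[of "coord c ` (U \<inter> cdom c)"] that c U by (auto simp: smooth_fun_def)
  have "((\<lambda>x. (f \<circ> param c) x * (h \<circ> param c) x) has_derivative
      (\<lambda>v. (f \<circ> param c) (coord c p) * frechet_derivative (h \<circ> param c) (at (coord c p)) v +
           frechet_derivative (f \<circ> param c) (at (coord c p)) v * (h \<circ> param c) (coord c p))) (at (coord c p))"
    by (intro has_derivative_mult D f h)
  from fun_cong[OF frechet_derivative_at[OF this], of "X p c"] show ?thesis
    unfolding vf_deriv_chart[OF U f X c] vf_deriv_chart[OF U h X c]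
      vf_deriv_chart[OF U smooth_fun_mult[OF U(1) f h] X c] using c by (simp add: comp_def)
qed

lemma vf_deriv_const: "vf_deriv A X (\<lambda>q. a) p = 0"
  by (simp add: vf_deriv_def comp_def)

lemma vf_deriv_minus:
  assumes U: "open U" "p \<in> U" and f: "smooth_fun A U f" and X: "smooth_vf A U X"
  shows "vf_deriv A X (\<lambda>q. - f q) p = - vf_deriv A X f p"
  using vf_deriv_mult[OF U smooth_fun_const[of U "-1"] f X] by (simp add: vf_deriv_const)

lemma vf_deriv_diff:
  assumes U: "open U" "p \<in> U" and f: "smooth_fun A U f" and h: "smooth_fun A U h"
    and X: "smooth_vf A U X"
  shows "vf_deriv A X (\<lambda>q. f q - h q) p = vf_deriv A X f p - vf_deriv A X h p"
  using vf_deriv_add[OF U f smooth_fun_minus[OF U(1) h] X] vf_deriv_minus[OF U h X] by simp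

lemma vf_deriv_coord:
  assumes U: "open U" "p \<in> U" and c: "c \<in> A" "U \<subseteq> cdom c" and X: "smooth_vf A U X"
  shows "vf_deriv A X (\<lambda>q. coord c q \<bullet> b) p = X p c \<bullet> b"
proof -
  have p: "p \<in> cdom c" using U c by auto
  have "((\<lambda>x. coord c (param c x) \<bullet> b) has_derivative (\<lambda>v. jacobian c c p v \<bullet> b)) (at (coord c p))"
    by (intro has_derivative_inner_left transition_has_derivative c p)
  from fun_cong[OF frechet_derivative_at[OF this], of "X p c"] show ?thesis
    unfolding vf_deriv_chart[OF U smooth_fun_subset[OF smooth_fun_coord[OF c(1)] c(2)] X c(1) p]
    using c p by (simp add: jacobian_same comp_def)
qed

lemma bracket_deriv_chart:
  assumes U: "open U" "p \<in> U" and f: "smooth_fun A U f" and X: "smooth_vf A U X" and Y: "smooth_vf A U Y"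
    and c: "c \<in> A" "p \<in> cdom c"
  shows "frechet_derivative (f \<circ> param c) (at (coord c p)) (lie_bracket A X Y p c) =
    vf_deriv A X (vf_deriv A Y f) p - vf_deriv A Y (vf_deriv A X f) p"
proof -
  let ?S = "coord c ` (U \<inter> cdom c)"
  let ?F = "f \<circ> param c"
  let ?c = "\<lambda>Z x. Z (param c x) c"
  have S: "open ?S" "coord c p \<in> ?S" using open_chart_image[OF c(1) U(1)] U c by auto
  have sm: "smooth_on ?S ?F" "smooth_on ?S (?c X)" "smooth_on ?S (?c Y)"
    using f X Y c by (auto simp: smooth_fun_def smooth_vf_def)
  have VW: "vf_deriv A V (vf_deriv A W f) p =
      frechet_derivative (\<lambda>y. frechet_derivative ?F (at y) (?c W y)) (at (coord c p)) (?c V (coord c p))"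
    if V: "smooth_vf A U V" and W: "smooth_vf A U W" for V W
  proof -
    have eq: "(vf_deriv A W f \<circ> param c) x = frechet_derivative ?F (at x) (?c W x)"
      if "x \<in> ?S" for x
      using vf_deriv_chart[OF U(1) _ f W c(1)] param_in[OF c(1) that] by simp
    have "frechet_derivative (vf_deriv A W f \<circ> param c) (at (coord c p)) =
        frechet_derivative (\<lambda>y. frechet_derivative ?F (at y) (?c W y)) (at (coord c p))"
      by (rule frechet_derivative_cong_open[OF S eq])
    then show ?thesis
      unfolding vf_deriv_chart[OF U smooth_fun_vf_deriv[OF U(1) f W] V c] using c by simp
  qed
  show ?thesis
    unfolding VW[OF X Y] VW[OF Y X] commutator_of_derivatives[OF S sm]
    using c by (simp add: lie_bracket_def)
qed

text \<open>Tangency of the bracket needs no computation with Jacobians: in every chart \<open>c\<close> the vector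
  \<open>[X, Y]\<close> acts as the operator \<open>X Y - Y X\<close>, and the action on the coordinate functions of
  another chart determines the components there.\<close>

lemma lie_bracket_tangent:
  assumes U: "open U" "p \<in> U" and X: "smooth_vf A U X" and Y: "smooth_vf A U Y"
  shows "lie_bracket A X Y p \<in> tangent_space A p"
  unfolding tangent_space_iff
proof (intro conjI ballI impI allI)
  fix c d assume cd: "c \<in> A" "d \<in> A" and p: "p \<in> cdom c" "p \<in> cdom d"
  let ?B = "lie_bracket A X Y p"
  let ?U = "U \<inter> cdom d"
  have U': "open ?U" "p \<in> ?U" using U p open_cdom[OF cd(2)] by auto
  have X': "smooth_vf A ?U X" and Y': "smooth_vf A ?U Y"
    using smooth_vf_subset[OF X] smooth_vf_subset[OF Y] by auto
  have "?B d \<bullet> b = jacobian c d p (?B c) \<bullet> b" for b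
  proof -
    let ?f = "\<lambda>q. coord d q \<bullet> b"
    have f: "smooth_fun A ?U ?f" using smooth_fun_subset[OF smooth_fun_coord[OF cd(2)]] by auto
    have D: "frechet_derivative (?f \<circ> param k) (at (coord k p)) v = jacobian k d p v \<bullet> b"
      if "k \<in> A" "p \<in> cdom k" for k v
    proof -
      have "((\<lambda>x. coord d (param k x) \<bullet> b) has_derivative (\<lambda>v. jacobian k d p v \<bullet> b)) (at (coord k p))"
        by (intro has_derivative_inner_left transition_has_derivative that cd p)
      from fun_cong[OF frechet_derivative_at[OF this], of v] show ?thesis by (simp add: comp_def)
    qed
    have "jacobian c d p (?B c) \<bullet> b = jacobian d d p (?B d) \<bullet> b"
      using bracket_deriv_chart[OF U' f X' Y' cd(1) p(1)] bracket_deriv_chart[OF U' f X' Y' cd(2) p(2)]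
      by (simp add: D cd p)
    then show ?thesis using cd p by (simp add: jacobian_same)
  qed
  then show "?B d = jacobian c d p (?B c)" by (simp add: euclidean_eq_iff[of "?B d"])
qed (auto simp: lie_bracket_def)

lemma smooth_vf_lie_bracket:
  assumes U: "open U" and X: "smooth_vf A U X" and Y: "smooth_vf A U Y"
  shows "smooth_vf A U (lie_bracket A X Y)"
  unfolding smooth_vf_def
proof (intro conjI ballI)
  fix c assume c: "c \<in> A"
  let ?S = "coord c ` (U \<inter> cdom c)"
  let ?X = "\<lambda>x. X (param c x) c" and ?Y = "\<lambda>x. Y (param c x) c"
  have S: "open ?S" by (rule open_chart_image[OF c U])
  have sm: "smooth_on ?S ?X" "smooth_on ?S ?Y" using X Y c by (auto simp: smooth_vf_def)
  have eq: "lie_bracket A X Y (param c x) c =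
      frechet_derivative ?Y (at x) (?X x) + (-1) *\<^sub>R frechet_derivative ?X (at x) (?Y x)" if "x \<in> ?S" for x
    using param_in[OF c that] c by (simp add: lie_bracket_def)
  show "smooth_on ?S (\<lambda>x. lie_bracket A X Y (param c x) c)"
    by (rule smooth_on_cong[OF S eq, THEN iffD2], assumption)
      (intro smooth_on_add smooth_on_scaleR smooth_on_const smooth_on_derivative_along S sm)
qed (use lie_bracket_tangent[OF U _ X Y] in blast)

lemma vf_deriv_lie_bracket:
  assumes U: "open U" "p \<in> U" and f: "smooth_fun A U f" and X: "smooth_vf A U X" and Y: "smooth_vf A U Y"
  shows "vf_deriv A (lie_bracket A X Y) f p =
    vf_deriv A X (vf_deriv A Y f) p - vf_deriv A Y (vf_deriv A X f) p"
proof -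
  obtain c where c: "c \<in> A" "p \<in> cdom c" by (rule chart_exists)
  show ?thesis
    using bracket_deriv_chart[OF U f X Y c] vf_deriv_chart[OF U f smooth_vf_lie_bracket[OF U(1) X Y] c] by simp
qed

text \<open>As an operator on functions \<open>[X, [Y, Z]]\<close> is a sum of four products of \<open>X\<close>, \<open>Y\<close>, \<open>Z\<close>,
  and these cancel in the cyclic sum.\<close>

lemma jacobi_identity:
  assumes U: "open U" "p \<in> U" and X: "smooth_vf A U X" and Y: "smooth_vf A U Y" and Z: "smooth_vf A U Z"
  shows "lie_bracket A X (lie_bracket A Y Z) p + lie_bracket A Y (lie_bracket A Z X) p +
    lie_bracket A Z (lie_bracket A X Y) p = 0"
proof
  fix c
  let ?B = "lie_bracket A"
  show "(?B X (?B Y Z) p + ?B Y (?B Z X) p + ?B Z (?B X Y) p) c = 0 c"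
  proof (cases "c \<in> A \<and> p \<in> cdom c")
    case False
    then show ?thesis by (auto simp: lie_bracket_def)
  next
    case c: True
    let ?U = "U \<inter> cdom c"
    have U': "open ?U" "p \<in> ?U" using U c by (auto intro: open_Int open_cdom)
    have sm: "smooth_vf A ?U X" "smooth_vf A ?U Y" "smooth_vf A ?U Z"
      using X Y Z smooth_vf_subset by (metis Int_lower1)+
    have "(?B X (?B Y Z) p c + ?B Y (?B Z X) p c + ?B Z (?B X Y) p c) \<bullet> b = 0" for b
    proof -
      let ?f = "\<lambda>q. coord c q \<bullet> b"
      let ?d = "vf_deriv A"
      have f: "smooth_fun A ?U ?f" using smooth_fun_subset[OF smooth_fun_coord] c by auto
      have "?B P (?B Q R) p c \<bullet> b = ?d P (?d Q (?d R ?f)) p - ?d P (?d R (?d Q ?f)) p -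
         (?d Q (?d R (?d P ?f)) p - ?d R (?d Q (?d P ?f)) p)"
        if P: "smooth_vf A ?U P" and Q: "smooth_vf A ?U Q" and R: "smooth_vf A ?U R" for P Q R
      proof -
        have QR: "smooth_vf A ?U (?B Q R)" by (rule smooth_vf_lie_bracket[OF U'(1) Q R])
        have "?B P (?B Q R) p c \<bullet> b = ?d (?B P (?B Q R)) ?f p"
          using vf_deriv_coord[OF U' _ _ smooth_vf_lie_bracket[OF U'(1) P QR]] c by auto
        also have "\<dots> = ?d P (?d (?B Q R) ?f) p - ?d (?B Q R) (?d P ?f) p"
          by (rule vf_deriv_lie_bracket[OF U' f P QR])
        also have "?d P (?d (?B Q R) ?f) p = ?d P (\<lambda>q. ?d Q (?d R ?f) q - ?d R (?d Q ?f) q) p"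
          by (rule vf_deriv_cong[OF U']) (use vf_deriv_lie_bracket[OF U'(1) _ f Q R] in auto)
        also have "\<dots> = ?d P (?d Q (?d R ?f)) p - ?d P (?d R (?d Q ?f)) p"
          by (intro vf_deriv_diff[OF U'] smooth_fun_vf_deriv U' f P Q R)
        also have "?d (?B Q R) (?d P ?f) p = ?d Q (?d R (?d P ?f)) p - ?d R (?d Q (?d P ?f)) p"
          by (intro vf_deriv_lie_bracket[OF U'] smooth_fun_vf_deriv U' f P Q R)
        finally show ?thesis .
      qed
      then show ?thesis using sm by (simp add: inner_add_left)
    qed
    then have "?B X (?B Y Z) p c + ?B Y (?B Z X) p c + ?B Z (?B X Y) p c = 0"
      by (metis inner_eq_zero_iff)
    then show ?thesis by simp
  qed
qed

end

section \<open>Two facts of multilinear algebra\<close>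

text \<open>For \<open>a(X, Y, Z) = g(N\<^sub>X Y - D\<^sub>X Y, Z)\<close> the hypotheses say that both connections are metric, that
  \<open>J\<close> is parallel for \<open>N\<close>, that \<open>D\<close> satisfies the nearly Kaehler condition, and that the torsion of \<open>N\<close> satisfies
  \<open>T(J X, J Y) = - T(X, Y)\<close>.  Twice the part of \<open>a\<close> that commutes with \<open>J\<close> is \<open>b\<close> in the proof.  It
  vanishes, since the symmetry of \<open>e(X, Y, Z) = b(X, Y, Z) + b(J X, J Y, Z)\<close> in \<open>X\<close> and \<open>Y\<close>
  contradicts its behaviour under \<open>J\<close> unless \<open>e = 0\<close>, and \<open>e = 0\<close> contradicts the skew symmetry of \<open>b\<close> in
  \<open>Y\<close> and \<open>Z\<close> unless \<open>b = 0\<close>.\<close>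

lemma difference_tensor_algebra:
  fixes a :: "'v \<Rightarrow> 'v \<Rightarrow> 'v \<Rightarrow> real"
  assumes J: "\<And>X. V X \<Longrightarrow> V (J X)"
    and skew: "\<And>X Y Z. V X \<Longrightarrow> V Y \<Longrightarrow> V Z \<Longrightarrow> a X Y Z = - a X Z Y"
    and JJ1: "\<And>X Y Z. V X \<Longrightarrow> V Y \<Longrightarrow> V Z \<Longrightarrow> a (J (J X)) Y Z = - a X Y Z"
    and JJ2: "\<And>X Y Z. V X \<Longrightarrow> V Y \<Longrightarrow> V Z \<Longrightarrow> a X (J (J Y)) Z = - a X Y Z"
    and nk: "\<And>X Y Z. V X \<Longrightarrow> V Y \<Longrightarrow> V Z \<Longrightarrow>
      a X (J Y) Z + a X Y (J Z) + a Y (J X) Z + a Y X (J Z) = 0"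
    and ch: "\<And>X Y Z. V X \<Longrightarrow> V Y \<Longrightarrow> V Z \<Longrightarrow>
      a (J X) (J Y) Z - a (J Y) (J X) Z = - (a X Y Z - a Y X Z)"
    and V: "V X" "V Y" "V Z"
  shows "a X (J Y) Z = a X Y (J Z)" and "a Y X Z = - a X Y Z"
proof -
  have JJ3: "a X Y (J (J Z)) = - a X Y Z" if "V X" "V Y" "V Z" for X Y Z
    using JJ2[of X Z Y] skew[of X Y "J (J Z)"] skew[of X Y Z] that J by simp
  define b where "b X Y Z = a X Y Z + a X (J Y) (J Z)" for X Y Z
  define e where "e X Y Z = b X Y Z + b (J X) (J Y) Z" for X Y Z
  have b_skew: "b X Y Z = - b X Z Y" if "V X" "V Y" "V Z" for X Y Z
    using skew[of X Y Z] skew[of X "J Y" "J Z"] that J by (simp add: b_def)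
  have b_J: "b X (J Y) Z = - b X Y (J Z)" if "V X" "V Y" "V Z" for X Y Z
    using that J by (simp add: b_def JJ2 JJ3)
  have b_JJ1: "b (J (J X)) Y Z = - b X Y Z" if "V X" "V Y" "V Z" for X Y Z
    using that J by (simp add: b_def JJ1)
  have b_JJ3: "b X Y (J (J Z)) = - b X Y Z" if "V X" "V Y" "V Z" for X Y Z
    using that J by (simp add: b_def JJ3)
  \<comment> \<open>The part of \<open>a\<close> that anticommutes with \<open>J\<close> is totally skew.  So it satisfies the
    condition on the torsion by itself, and this condition concerns \<open>b\<close> alone.\<close>
  have c_skew: "a X Y Z - a X (J Y) (J Z) = - (a Y X Z - a Y (J X) (J Z))"
    if "V X" "V Y" "V Z" for X Y Z
    using nk[of X Y "J Z"] that J by (simp add: JJ3)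
  have e_sym: "e X Y Z = e Y X Z" if v: "V X" "V Y" "V Z" for X Y Z
  proof -
    have c: "a (J X) (J Y) Z - a (J X) (J (J Y)) (J Z) =
        - (a X Y Z - a X (J Y) (J Z))" if v: "V X" "V Y" "V Z" for X Y Z
    proof -
      have "a (J X) (J Y) Z - a (J X) (J (J Y)) (J Z) = a (J X) Y (J Z) - a (J X) (J Y) (J (J Z))"
        using v J by (simp add: JJ2 JJ3)
      also have "\<dots> = - (a Y (J X) (J Z) - a Y (J (J X)) (J (J Z)))"
        using c_skew[of "J X" Y "J Z"] v J by simp
      also have "\<dots> = a Y X Z - a Y (J X) (J Z)"
        using v J by (simp add: JJ2 JJ3)
      also have "\<dots> = - (a X Y Z - a X (J Y) (J Z))"
        using c_skew[of X Y Z] v by simp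
      finally show ?thesis .
    qed
    show ?thesis
      using c[of X Y Z] c[of Y X Z] c_skew[of X Y Z] c_skew[of "J X" "J Y" Z] ch[of X Y Z] v J
      by (simp add: e_def b_def)
  qed
  have e_J2: "e X (J Y) Z = - e X Y (J Z)" if "V X" "V Y" "V Z" for X Y Z
    using that J by (simp add: e_def b_J)
  have e_J1: "e (J X) Y Z = e X Y (J Z)" if "V X" "V Y" "V Z" for X Y Z
    using that J by (simp add: e_def b_JJ1 b_J b_JJ3)
  have e_zero: "e X Y (J Z) = 0" if v: "V X" "V Y" "V Z" for X Y Z
    using e_J2[of X Y Z] e_J1[of Y X Z] e_sym[of X "J Y" Z] e_sym[of X Y "J Z"] v J by simp
  have b_zero: "b X Y Z = 0" if v: "V X" "V Y" "V Z" for X Y Z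
  proof -
    have *: "b (J X) (J Y) Z = - b X Y Z" if "V X" "V Y" "V Z" for X Y Z
    proof -
      have "b X Y (J (J Z)) + b (J X) (J Y) (J (J Z)) = 0"
        using e_zero[of X Y "J Z"] that J by (simp add: e_def)
      then show ?thesis using that J by (simp add: b_def JJ3)
    qed
    show ?thesis
      using *[of X Y Z] *[of X Z Y] b_skew[of "J X" "J Y" Z] b_J[of "J X" Z Y] b_skew[of X Y Z] v J
      by simp
  qed
  show 1: "a X (J Y) Z = a X Y (J Z)"
    using b_zero[of X Y "J Z"] V J by (simp add: b_def JJ3)
  show "a Y X Z = - a X Y Z"
    using c_skew[OF V] b_zero[OF V] b_zero[OF V(2,1,3)] by (simp add: b_def)
qed

text \<open>Here \<open>R\<close> is a curvature tensor of type \<open>(1,1)\<close> in the last two arguments, \<open>f(X, Y, Z, W)\<close> is the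
  derivative along \<open>X\<close> of a 3-form of type \<open>(3,0) + (0,3)\<close>, and \<open>h\<close> is of type \<open>(2,0)\<close> in one pair of
  arguments and of type \<open>(0,2)\<close> in the other.  The Bianchi identity \<open>E\<close> is decomposed into types.  A
  component of given type is obtained by replacing each argument \<open>Y\<close> by \<open>Y - i J Y\<close> for type
  \<open>(1,0)\<close> or by \<open>Y + i J Y\<close> for type \<open>(0,1)\<close>; the real part of the result is a combination of the
  eight instances of \<open>E\<close> in which an even number of arguments carries a \<open>J\<close>.

  If exactly one argument is of type \<open>(0,1)\<close>, then \<open>h\<close> does not contribute.  Depending on the place
  of this argument, \<open>E\<close> identifies a component \<open>Q\<close> of \<open>R\<close> with one of \<open>f\<close>, which makes \<open>Q\<close> skew
  in three arguments, or it says that the cyclic sum of \<open>Q\<close> in these arguments is zero; hence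
  \<open>Q = 0\<close>.  If all arguments are of type \<open>(1,0)\<close>, neither \<open>R\<close> nor \<open>h\<close> contributes and the cyclic sum
  of \<open>f\<close> vanishes, which together with the skew symmetry in the last three arguments gives \<open>f = 0\<close>.\<close>

lemma kirichenko_algebra:
  fixes R f h :: "'v \<Rightarrow> 'v \<Rightarrow> 'v \<Rightarrow> 'v \<Rightarrow> real"
  assumes J: "\<And>X. V X \<Longrightarrow> V (J X)"
    and E: "\<And>X Y Z W. V X \<Longrightarrow> V Y \<Longrightarrow> V Z \<Longrightarrow> V W \<Longrightarrow>
      R X Y Z W + R Y Z X W + R Z X Y W =
      f X Y Z W + f Y Z X W + f Z X Y W + h X Y Z W + h Y Z X W + h Z X Y W"
    and R1: "\<And>X Y Z W. V X \<Longrightarrow> V Y \<Longrightarrow> V Z \<Longrightarrow> V W \<Longrightarrow> R X Y Z W = - R Y X Z W"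
    and R2: "\<And>X Y Z W. V X \<Longrightarrow> V Y \<Longrightarrow> V Z \<Longrightarrow> V W \<Longrightarrow> R X Y Z W = - R X Y W Z"
    and RJJ: "\<And>X Y Z W. V X \<Longrightarrow> V Y \<Longrightarrow> V Z \<Longrightarrow> V W \<Longrightarrow> R X Y (J Z) (J W) = R X Y Z W"
    and RJ: "\<And>X Y Z W. V X \<Longrightarrow> V Y \<Longrightarrow> V Z \<Longrightarrow> V W \<Longrightarrow> R X Y (J Z) W = - R X Y Z (J W)"
    and f1: "\<And>X Y Z W. V X \<Longrightarrow> V Y \<Longrightarrow> V Z \<Longrightarrow> V W \<Longrightarrow> f X Y Z W = - f X Z Y W"
    and f2: "\<And>X Y Z W. V X \<Longrightarrow> V Y \<Longrightarrow> V Z \<Longrightarrow> V W \<Longrightarrow> f X Y Z W = - f X Y W Z"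
    and fJJ: "\<And>X Y Z W. V X \<Longrightarrow> V Y \<Longrightarrow> V Z \<Longrightarrow> V W \<Longrightarrow> f X (J Y) (J Z) W = - f X Y Z W"
    and fJ: "\<And>X Y Z W. V X \<Longrightarrow> V Y \<Longrightarrow> V Z \<Longrightarrow> V W \<Longrightarrow> f X Y (J Z) W = f X (J Y) Z W"
    and hJ12: "\<And>X Y Z W. V X \<Longrightarrow> V Y \<Longrightarrow> V Z \<Longrightarrow> V W \<Longrightarrow> h (J X) (J Y) Z W = - h X Y Z W"
    and hJ2: "\<And>X Y Z W. V X \<Longrightarrow> V Y \<Longrightarrow> V Z \<Longrightarrow> V W \<Longrightarrow> h X (J Y) Z W = h (J X) Y Z W"
    and hJ3: "\<And>X Y Z W. V X \<Longrightarrow> V Y \<Longrightarrow> V Z \<Longrightarrow> V W \<Longrightarrow> h X Y (J Z) W = - h (J X) Y Z W"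
    and hJ4: "\<And>X Y Z W. V X \<Longrightarrow> V Y \<Longrightarrow> V Z \<Longrightarrow> V W \<Longrightarrow> h X Y Z (J W) = - h (J X) Y Z W"
    and V: "V X" "V Y" "V Z" "V W"
  shows "f X Y Z W = 0"
proof -
  have fJ4: "f X Y Z (J W) = f X (J Y) Z W" if v: "V X" "V Y" "V Z" "V W" for X Y Z W
    using f2[of X Y Z "J W"] fJ[of X Y W Z] f2[of X "J Y" W Z] v J by simp
  have R_sq: "R X Y Z (J (J W)) = - R X Y Z W" if v: "V X" "V Y" "V Z" "V W" for X Y Z W
    using RJ[of X Y Z "J W"] RJJ[of X Y Z W] v J by simp
  have f_sq: "f X (J (J Y)) Z W = - f X Y Z W" if v: "V X" "V Y" "V Z" "V W" for X Y Z W
    using fJ[of X "J Y" Z W] fJJ[of X Y Z W] v J by simp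
  have h_sq: "h (J (J X)) Y Z W = - h X Y Z W" if v: "V X" "V Y" "V Z" "V W" for X Y Z W
    using hJ2[of "J X" Y Z W] hJ12[of X Y Z W] v J by simp
  note rules = RJ fJ fJ4 hJ2 hJ3 hJ4 R_sq f_sq h_sq
  define Q where "Q Y Z X W = R Y Z X W - R (J Y) (J Z) X W - R (J Y) Z X (J W) - R Y (J Z) X (J W)"
    for Y Z X W
  \<comment> \<open>The component of \<open>E\<close> of type \<open>(0,1)\<close> in \<open>X\<close> and \<open>(1,0)\<close> in the other arguments; \<open>Q\<close> is what remains of \<open>R\<close>.\<close>
  have bar1: "2 * (f X Y Z W + f (J X) (J Y) Z W) = Q Y Z X W"
    if v: "V X" "V Y" "V Z" "V W" for X Y Z W
    using E[of X Y Z W] E[of "J X" "J Y" Z W] E[of "J X" Y "J Z" W] E[of "J X" Y Z "J W"]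
      E[of X "J Y" "J Z" W] E[of X "J Y" Z "J W"] E[of X Y "J Z" "J W"] E[of "J X" "J Y" "J Z" "J W"] v J
    by (simp add: rules Q_def)
  have Q4: "Q X Y W Z = R (J X) (J Y) Z W - R X Y Z W - R (J X) Y Z (J W) - R X (J Y) Z (J W)"
    if v: "V X" "V Y" "V Z" "V W" for X Y Z W
    using R2[of X Y W Z] R2[of "J X" "J Y" W Z] R2[of "J X" Y W "J Z"] R2[of X "J Y" W "J Z"] v J
    by (simp add: Q_def RJ)
  \<comment> \<open>The component of type \<open>(0,1)\<close> in \<open>W\<close> and \<open>(1,0)\<close> in the other arguments.\<close>
  have bar4: "Q X Y W Z + Q Y Z W X + Q Z X W Y = 0"
    if v: "V X" "V Y" "V Z" "V W" for X Y Z W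
    using E[of X Y Z W] E[of "J X" Y Z "J W"] E[of X "J Y" Z "J W"] E[of X Y "J Z" "J W"]
      E[of "J X" "J Y" Z W] E[of "J X" Y "J Z" W] E[of X "J Y" "J Z" W] E[of "J X" "J Y" "J Z" "J W"]
      v J
    unfolding Q4[OF v] Q4[OF v(2,3,1,4)] Q4[OF v(3,1,2,4)]
    by (simp add: rules)
  have f_type: "f (J X) (J Y) Z W = - f X Y Z W" if v: "V X" "V Y" "V Z" "V W" for X Y Z W
  proof -
    have Q1: "Q X Y W Z = - Q Y X W Z" if "V X" "V Y" "V Z" "V W" for X Y Z W
      using R1[of X Y W Z] R1[of "J X" "J Y" W Z] R1[of "J X" Y W "J Z"] R1[of X "J Y" W "J Z"] that J
      by (simp add: Q_def)
    have Q2: "Q Y Z X W = - Q Y W X Z" if "V X" "V Y" "V Z" "V W" for X Y Z W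
      using bar1[of X Y Z W] bar1[of X Y W Z] f2[of X Y Z W] f2[of "J X" "J Y" Z W] that J by simp
    have "Q Y Z X W = 0"
      using bar4[of Y Z W X] Q1[of Y Z W X] Q1[of W Y Z X] Q1[of Z W Y X] Q2[of X Y Z W] Q2[of X W Y Z]
        Q2[of X Z W Y] v by simp
    then show ?thesis using bar1[OF v] by simp
  qed
  \<comment> \<open>The component of type \<open>(1,0)\<close> in all arguments.\<close>
  have bianchi: "f X Y Z W + f Y Z X W + f Z X Y W = 0" if v: "V X" "V Y" "V Z" "V W" for X Y Z W
    using E[of X Y Z W] E[of "J X" "J Y" Z W] E[of "J X" Y "J Z" W] E[of "J X" Y Z "J W"]
      E[of X "J Y" "J Z" W] E[of X "J Y" Z "J W"] E[of X Y "J Z" "J W"] E[of "J X" "J Y" "J Z" "J W"] v J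
    by (simp add: rules f_type)
  have f_cyc: "f X Y Z W = f X Z W Y" if v: "V X" "V Y" "V Z" "V W" for X Y Z W
    using f1[of X Y Z W] f2[of X Z Y W] v by simp
  have f13: "f X Y Z W = - f X W Z Y" if v: "V X" "V Y" "V Z" "V W" for X Y Z W
    using f_cyc[of X Y Z W] f1[of X Z W Y] v by simp
  show ?thesis
    using bianchi[OF V] bianchi[OF V(1,2,4,3)] bianchi[OF V(1,3,4,2)] bianchi[OF V(2,3,4,1)]
      f2[OF V] f13[OF V(2,3,1,4)] f_cyc[OF V] f_cyc[OF V(3,4,1,2)] f2[OF V(4,1,2,3)]
      f2[OF V(2,3,1,4)] f13[OF V(3,1,2,4)] f_cyc[OF V(4,1,2,3)]
    by linarith
qed

section \<open>The Chern connection of a nearly Kaehler manifold\<close>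

locale nearly_kaehler_chern =
  fixes A :: "('m::t2_space, 'e::euclidean_space) chart set"
    and J :: "('m, 'e) endo" and g :: "('m, 'e) metric_tensor" and D N :: "('m, 'e) connection"
  assumes levi_civita: "levi_civita A g D"
    and nearly_Kaehler: "nearly_Kaehler A J g D"
    and chern: "chern_connection A J g N"
begin

lemma almost_Hermitian: "almost_Hermitian A J g"
  using nearly_Kaehler by (simp add: nearly_Kaehler_def)

end

sublocale nearly_kaehler_chern \<subseteq> smooth_manifold A
  using almost_Hermitian by unfold_locales (simp add: almost_Hermitian_def)

context nearly_kaehler_chern
begin

subsection \<open>Linear algebra in a tangent space\<close>

abbreviation TS :: "'m \<Rightarrow> ('m, 'e) tvec set" where "TS p \<equiv> tangent_space A p"

lemma TS_closed [simp]:
  "0 \<in> TS p" "v \<in> TS p \<Longrightarrow> w \<in> TS p \<Longrightarrow> v + w \<in> TS p" "v \<in> TS p \<Longrightarrow> w \<in> TS p \<Longrightarrow> v - w \<in> TS p"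
  "v \<in> TS p \<Longrightarrow> - v \<in> TS p" "v \<in> TS p \<Longrightarrow> r *\<^sub>R v \<in> TS p"
  using subspace_tangent[of p] by (auto simp: subspace_0 subspace_add subspace_diff subspace_neg subspace_scale)

lemma almost_complex: "almost_complex A J" and riemannian: "riemannian_metric A g"
  using almost_Hermitian by (simp_all add: almost_Hermitian_def)

lemma J_TS [simp]: "v \<in> TS p \<Longrightarrow> J p v \<in> TS p"
  and J_J [simp]: "v \<in> TS p \<Longrightarrow> J p (J p v) = - v"
  using almost_complex[unfolded almost_complex_def, THEN conjunct1] by simp_all

lemma J_lincomb: "v \<in> TS p \<Longrightarrow> w \<in> TS p \<Longrightarrow> J p (a *\<^sub>R v + b *\<^sub>R w) = a *\<^sub>R J p v + b *\<^sub>R J p w"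
  using almost_complex[unfolded almost_complex_def, THEN conjunct2, THEN conjunct1] by simp

lemma g_sym: "v \<in> TS p \<Longrightarrow> w \<in> TS p \<Longrightarrow> g p v w = g p w v"
  using riemannian[unfolded riemannian_metric_def, THEN conjunct1] by blast

lemma g_pos: "v \<in> TS p \<Longrightarrow> v \<noteq> 0 \<Longrightarrow> g p v v > 0"
  using riemannian[unfolded riemannian_metric_def, THEN conjunct2, THEN conjunct1] by blast

lemma g_lincomb: "u \<in> TS p \<Longrightarrow> v \<in> TS p \<Longrightarrow> w \<in> TS p \<Longrightarrow> g p (a *\<^sub>R u + b *\<^sub>R v) w = a * g p u w + b * g p v w"
  using riemannian[unfolded riemannian_metric_def, THEN conjunct2, THEN conjunct2, THEN conjunct1] by simp

lemma g_JJ: "v \<in> TS p \<Longrightarrow> w \<in> TS p \<Longrightarrow> g p (J p v) (J p w) = g p v w"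
  using almost_Hermitian by (simp add: almost_Hermitian_def)

lemma J_add: "v \<in> TS p \<Longrightarrow> w \<in> TS p \<Longrightarrow> J p (v + w) = J p v + J p w"
  using J_lincomb[of v p w 1 1] by simp

lemma J_scale: "v \<in> TS p \<Longrightarrow> J p (r *\<^sub>R v) = r *\<^sub>R J p v"
  using J_lincomb[of v p 0 r 0] by simp

lemma J_minus: "v \<in> TS p \<Longrightarrow> J p (- v) = - J p v"
  using J_scale[of v p "-1"] by simp

lemma J_diff: "v \<in> TS p \<Longrightarrow> w \<in> TS p \<Longrightarrow> J p (v - w) = J p v - J p w"
  using J_add[of v p "- w"] J_minus[of w p] by simp

lemma g_add_left: "u \<in> TS p \<Longrightarrow> v \<in> TS p \<Longrightarrow> w \<in> TS p \<Longrightarrow> g p (u + v) w = g p u w + g p v w"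
  using g_lincomb[of u p v w 1 1] by simp

lemma g_scale_left: "v \<in> TS p \<Longrightarrow> w \<in> TS p \<Longrightarrow> g p (r *\<^sub>R v) w = r * g p v w"
  using g_lincomb[of v p 0 w r 0] by simp

lemma g_zero_left: "w \<in> TS p \<Longrightarrow> g p 0 w = 0"
  using g_scale_left[of 0 p w 0] by simp

lemma g_minus_left: "v \<in> TS p \<Longrightarrow> w \<in> TS p \<Longrightarrow> g p (- v) w = - g p v w"
  using g_scale_left[of v p w "-1"] by simp

lemma g_diff_left: "u \<in> TS p \<Longrightarrow> v \<in> TS p \<Longrightarrow> w \<in> TS p \<Longrightarrow> g p (u - v) w = g p u w - g p v w"
  using g_add_left[of u p "- v" w] g_minus_left[of v p w] by simp

lemma g_add_right: "u \<in> TS p \<Longrightarrow> v \<in> TS p \<Longrightarrow> w \<in> TS p \<Longrightarrow> g p w (u + v) = g p w u + g p w v"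
  using g_add_left[of u p v w] by (simp add: g_sym[of w])

lemma g_scale_right: "v \<in> TS p \<Longrightarrow> w \<in> TS p \<Longrightarrow> g p w (r *\<^sub>R v) = r * g p w v"
  using g_scale_left[of v p w r] by (simp add: g_sym[of w])

lemma g_zero_right: "w \<in> TS p \<Longrightarrow> g p w 0 = 0"
  using g_zero_left[of w p] by (simp add: g_sym[of w])

lemma g_minus_right: "v \<in> TS p \<Longrightarrow> w \<in> TS p \<Longrightarrow> g p w (- v) = - g p w v"
  using g_minus_left[of v p w] by (simp add: g_sym[of w])

lemma g_diff_right: "u \<in> TS p \<Longrightarrow> v \<in> TS p \<Longrightarrow> w \<in> TS p \<Longrightarrow> g p w (u - v) = g p w u - g p w v"
  using g_diff_left[of u p v w] by (simp add: g_sym[of w])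

lemmas g_simps = g_add_left g_scale_left g_zero_left g_minus_left g_diff_left
  g_add_right g_scale_right g_zero_right g_minus_right g_diff_right

lemma g_J_left: "v \<in> TS p \<Longrightarrow> w \<in> TS p \<Longrightarrow> g p (J p v) w = - g p v (J p w)"
  using g_JJ[of v p "J p w"] by (simp add: g_simps)

lemma g_J_self: "v \<in> TS p \<Longrightarrow> g p v (J p v) = 0"
  using g_J_left[of v p v] g_sym[of v p "J p v"] by simp

lemma sum_TS: "(\<And>i. i \<in> I \<Longrightarrow> v i \<in> TS p) \<Longrightarrow> (\<Sum>i\<in>I. v i) \<in> TS p"
  by (rule subspace_sum[OF subspace_tangent])

lemma g_sum_left: "finite I \<Longrightarrow> (\<And>i. i \<in> I \<Longrightarrow> v i \<in> TS p) \<Longrightarrow> w \<in> TS p \<Longrightarrow>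
    g p (\<Sum>i\<in>I. v i) w = (\<Sum>i\<in>I. g p (v i) w)"
  by (induction I rule: finite_induct) (auto simp: g_zero_left g_add_left sum_TS)

end

locale nearly_kaehler_domain = nearly_kaehler_chern A J g D N
  for A :: "('m::t2_space, 'e::euclidean_space) chart set"
    and J :: "('m, 'e) endo" and g :: "('m, 'e) metric_tensor" and D N :: "('m, 'e) connection" +
  fixes U :: "'m set"
  assumes U: "open U"
begin

abbreviation VF :: "('m, 'e) vfield \<Rightarrow> bool" where "VF X \<equiv> smooth_vf A U X"

abbreviation JJ :: "('m, 'e) vfield \<Rightarrow> ('m, 'e) vfield" where "JJ X \<equiv> endo_vf J X"

lemma VF_TS [simp]: "VF X \<Longrightarrow> p \<in> U \<Longrightarrow> X p \<in> TS p"
  by (rule smooth_vf_tangent)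

lemma JJ_at: "JJ X p = J p (X p)"
  by (simp add: endo_vf_def)

lemma VF_JJ [simp]: "VF X \<Longrightarrow> VF (JJ X)"
  using almost_complex[unfolded almost_complex_def, THEN conjunct2, THEN conjunct2] U by blast

lemma smooth_g: "VF X \<Longrightarrow> VF Y \<Longrightarrow> smooth_fun A U (\<lambda>p. g p (X p) (Y p))"
  using riemannian[unfolded riemannian_metric_def, THEN conjunct2, THEN conjunct2, THEN conjunct2] U by blast

lemma metric_N: "metric_connection A g N" and metric_D: "metric_connection A g D"
  using chern levi_civita by (simp_all add: chern_connection_def levi_civita_def)

lemma affine_N: "affine_connection A N" and affine_D: "affine_connection A D"
  using metric_N metric_D by (simp_all add: metric_connection_def)

lemma VF_N [simp]: "VF X \<Longrightarrow> VF Y \<Longrightarrow> VF (N X Y)"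
  using affine_N[unfolded affine_connection_def, THEN conjunct1] U by blast

lemma VF_D [simp]: "VF X \<Longrightarrow> VF Y \<Longrightarrow> VF (D X Y)"
  using affine_D[unfolded affine_connection_def, THEN conjunct1] U by blast

lemma connection_cong:
  assumes B: "affine_connection A B" and v: "VF X" "VF X'" "VF Y" "VF Y'"
    and eq: "\<And>q. q \<in> U \<Longrightarrow> X q = X' q" "\<And>q. q \<in> U \<Longrightarrow> Y q = Y' q" and p: "p \<in> U"
  shows "B X Y p = B X' Y' p"
proof -
  have "\<forall>p\<in>U. X p = X' p \<and> Y p = Y' p" using eq by simp
  then have "\<forall>p\<in>U. B X Y p = B X' Y' p"
    using B[unfolded affine_connection_def, THEN conjunct2, THEN conjunct1, rule_format, OF U v] by blast
  with p show ?thesis by blast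
qed

lemma connection_add_right:
  assumes "affine_connection A B" "VF X" "VF Y" "VF Y'" "p \<in> U"
  shows "B X (\<lambda>q. Y q + Y' q) p = B X Y p + B X Y' p"
  using assms(1)[unfolded affine_connection_def, THEN conjunct2, THEN conjunct2, THEN conjunct2, THEN conjunct1, rule_format, OF U assms(2-5)] .

lemma connection_minus_left:
  assumes B: "affine_connection A B" and X: "VF X" and Y: "VF Y" and p: "p \<in> U"
  shows "B (\<lambda>q. - X q) Y p = - B X Y p"
  using B[unfolded affine_connection_def, THEN conjunct2, THEN conjunct2, THEN conjunct2, THEN conjunct2, THEN conjunct1, rule_format, OF U smooth_fun_const[of U "-1"] X Y p]
  by simp

lemma connection_minus_right:
  assumes B: "affine_connection A B" and X: "VF X" and Y: "VF Y" and p: "p \<in> U"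
  shows "B X (\<lambda>q. - Y q) p = - B X Y p"
  using B[unfolded affine_connection_def, THEN conjunct2, THEN conjunct2, THEN conjunct2, THEN conjunct2, THEN conjunct2, rule_format, OF U smooth_fun_const[of U "-1"] X Y p]
  by (simp add: vf_deriv_const)

lemma deriv_g_N: "VF X \<Longrightarrow> VF Y \<Longrightarrow> VF Z \<Longrightarrow> p \<in> U \<Longrightarrow>
    vf_deriv A X (\<lambda>q. g q (Y q) (Z q)) p = g p (N X Y p) (Z p) + g p (Y p) (N X Z p)"
  using metric_N[unfolded metric_connection_def, THEN conjunct2, rule_format, OF U] .

lemma deriv_g_D: "VF X \<Longrightarrow> VF Y \<Longrightarrow> VF Z \<Longrightarrow> p \<in> U \<Longrightarrow>
    vf_deriv A X (\<lambda>q. g q (Y q) (Z q)) p = g p (D X Y p) (Z p) + g p (Y p) (D X Z p)"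
  using metric_D[unfolded metric_connection_def, THEN conjunct2, rule_format, OF U] .

lemma N_JJ: "VF X \<Longrightarrow> VF Y \<Longrightarrow> p \<in> U \<Longrightarrow> N X (JJ Y) p = J p (N X Y p)"
  using chern[unfolded chern_connection_def parallel_endo_def cov_endo_def,
      THEN conjunct2, THEN conjunct1, rule_format, OF U] by simp

lemma VF_bracket [simp]: "VF X \<Longrightarrow> VF Y \<Longrightarrow> VF (lie_bracket A X Y)"
  by (rule smooth_vf_lie_bracket[OF U])

subsection \<open>The torsion of the Chern connection\<close>

abbreviation T :: "('m, 'e) vfield \<Rightarrow> ('m, 'e) vfield \<Rightarrow> ('m, 'e) vfield"
  where "T X Y \<equiv> torsion A N X Y"

definition tau :: "('m, 'e) vfield \<Rightarrow> ('m, 'e) vfield \<Rightarrow> ('m, 'e) vfield \<Rightarrow> 'm \<Rightarrow> real"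
  where "tau X Y Z p = g p (T X Y p) (Z p)"

lemma VF_T [simp]: "VF X \<Longrightarrow> VF Y \<Longrightarrow> VF (T X Y)"
  by (rule smooth_vf_cong[OF U, of "\<lambda>q. N X Y q - N Y X q - lie_bracket A X Y q"])
    (auto simp: torsion_def intro!: smooth_vf_diff U)

lemma VF_curvature [simp]: "VF X \<Longrightarrow> VF Y \<Longrightarrow> VF Z \<Longrightarrow> VF (curvature A N X Y Z)"
  by (rule smooth_vf_cong[OF U, of "\<lambda>q. N X (N Y Z) q - N Y (N X Z) q - N (lie_bracket A X Y) Z q"])
    (auto simp: curvature_def intro!: smooth_vf_diff U)

lemma smooth_tau: "VF X \<Longrightarrow> VF Y \<Longrightarrow> VF Z \<Longrightarrow> smooth_fun A U (tau X Y Z)"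
  unfolding tau_def by (intro smooth_g) auto

text \<open>The brackets cancel in the difference of the two torsions, and that of \<open>D\<close> is zero.  This is why
  the torsion of \<open>N\<close> is a tensor.\<close>

lemma T_eq_difference:
  assumes "VF X" "VF Y" "p \<in> U"
  shows "T X Y p = (N X Y p - D X Y p) - (N Y X p - D Y X p)"
proof -
  have "torsion A D X Y p = 0"
    using levi_civita[unfolded levi_civita_def, THEN conjunct2, rule_format, OF U assms] .
  then show ?thesis by (simp add: torsion_def algebra_simps)
qed

lemma T_JJ: "VF X \<Longrightarrow> VF Y \<Longrightarrow> p \<in> U \<Longrightarrow> T (JJ X) (JJ Y) p = - T X Y p"
  using chern[unfolded chern_connection_def, THEN conjunct2, THEN conjunct2, rule_format, OF U] .

lemma cov_endo_D: "VF X \<Longrightarrow> VF Y \<Longrightarrow> p \<in> U \<Longrightarrow>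
    cov_endo D J X Y p = J p (N X Y p - D X Y p) - (N X (JJ Y) p - D X (JJ Y) p)"
  by (simp add: cov_endo_def N_JJ J_diff)

text \<open>The tensor \<open>N - D\<close> is totally skew and anticommutes with \<open>J\<close>: it is \<open>- J (D J) / 2\<close>.\<close>

lemma difference_relations:
  assumes p: "p \<in> U" and X: "VF X" and Y: "VF Y" and Z: "VF Z"
  defines "a \<equiv> \<lambda>X Y Z. g p (N X Y p - D X Y p) (Z p)"
  shows "a X (JJ Y) Z = a X Y (JJ Z)" and "a Y X Z = - a X Y Z"
proof -
  note aff = affine_N affine_D
  note p' [simp] = p
  have sq: "JJ (JJ X) q = - X q" if "VF X" "q \<in> U" for X q
    using that by (simp add: JJ_at)
  note neg = smooth_vf_uminus[OF U]
  have *: "VF X \<Longrightarrow> VF (JJ X)" for X by simp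
  have skew: "a X Y Z = - a X Z Y" if v: "VF X" "VF Y" "VF Z" for X Y Z
    using deriv_g_N[OF v p] deriv_g_D[OF v p] v
    by (simp add: a_def g_diff_left g_sym[of "Y p"])
  have JJ1: "a (JJ (JJ X)) Y Z = - a X Y Z" if v: "VF X" "VF Y" "VF Z" for X Y Z
  proof -
    have "B (JJ (JJ X)) Y p = - B X Y p" if B: "affine_connection A B" for B
    proof -
      have "B (JJ (JJ X)) Y p = B (\<lambda>q. - X q) Y p"
        by (rule connection_cong[OF B]) (use v sq neg in auto)
      then show ?thesis using connection_minus_left[OF B v(1,2) p] by simp
    qed
    from this[OF affine_N] this[OF affine_D] show ?thesis
      using v by (simp add: a_def g_simps)
  qed
  have JJ2: "a X (JJ (JJ Y)) Z = - a X Y Z" if v: "VF X" "VF Y" "VF Z" for X Y Z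
  proof -
    have "B X (JJ (JJ Y)) p = - B X Y p" if B: "affine_connection A B" for B
    proof -
      have "B X (JJ (JJ Y)) p = B X (\<lambda>q. - Y q) p"
        by (rule connection_cong[OF B]) (use v sq neg in auto)
      then show ?thesis using connection_minus_right[OF B v(1,2) p] by simp
    qed
    from this[OF affine_N] this[OF affine_D] show ?thesis
      using v by (simp add: a_def g_simps)
  qed
  have nk: "a X (JJ Y) Z + a X Y (JJ Z) + a Y (JJ X) Z + a Y X (JJ Z) = 0"
    if v: "VF X" "VF Y" "VF Z" for X Y Z
  proof -
    have "cov_endo D J X Y p + cov_endo D J Y X p = 0"
      using nearly_Kaehler[unfolded nearly_Kaehler_def, THEN conjunct2, rule_format, OF U v(1,2) p] .
    then have "g p (cov_endo D J X Y p + cov_endo D J Y X p) (Z p) = 0"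
      using v by (simp add: g_zero_left)
    then show ?thesis
      using v by (simp add: cov_endo_D a_def g_simps g_J_left JJ_at)
  qed
  have ch: "a (JJ X) (JJ Y) Z - a (JJ Y) (JJ X) Z = - (a X Y Z - a Y X Z)"
    if v: "VF X" "VF Y" "VF Z" for X Y Z
  proof -
    have "g p (T (JJ X) (JJ Y) p) (Z p) = - g p (T X Y p) (Z p)"
      using v by (simp add: T_JJ g_minus_left)
    then show ?thesis using v by (simp add: T_eq_difference g_diff_left a_def)
  qed
  show "a X (JJ Y) Z = a X Y (JJ Z)" and "a Y X Z = - a X Y Z"
    using difference_tensor_algebra[of VF JJ a, OF * skew JJ1 JJ2 nk ch X Y Z] by blast+
qed

lemma tau_skew12: "VF X \<Longrightarrow> VF Y \<Longrightarrow> VF Z \<Longrightarrow> p \<in> U \<Longrightarrow> tau X Y Z p = - tau Y X Z p"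
  unfolding tau_def by (simp add: T_eq_difference g_diff_left)

lemma tau_double:
  assumes "VF X" "VF Y" "VF Z" "p \<in> U"
  shows "tau X Y Z p = 2 * g p (N X Y p - D X Y p) (Z p)"
  using difference_relations(2)[OF assms(4,1,2,3)] assms
  by (simp add: tau_def T_eq_difference g_diff_left)

lemma tau_skew23:
  assumes "VF X" "VF Y" "VF Z" "p \<in> U"
  shows "tau X Y Z p = - tau X Z Y p"
  using deriv_g_N[OF assms] deriv_g_D[OF assms] assms
  by (simp add: tau_double g_diff_left g_sym[of "Y p"])

lemma tau_cyclic:
  assumes "VF X" "VF Y" "VF Z" "p \<in> U"
  shows "tau X Y Z p = tau Y Z X p"
  using tau_skew12[OF assms] tau_skew23[OF assms(2,1,3,4)] by simp

lemma tau_J23: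
  assumes "VF X" "VF Y" "VF Z" "p \<in> U"
  shows "tau X (JJ Y) Z p = tau X Y (JJ Z) p"
  using difference_relations(1)[OF assms(4,1,2,3)] assms by (simp add: tau_double)

text \<open>The difference \<open>V - W\<close> itself serves as test field.  So no vector at \<open>p\<close> has to be extended to a
  field on all of \<open>U\<close>.\<close>

lemma field_eqI:
  assumes V: "VF V" and W: "VF W" and p: "p \<in> U"
    and eq: "\<And>Z. VF Z \<Longrightarrow> g p (V p) (Z p) = g p (W p) (Z p)"
  shows "V p = W p"
proof (rule ccontr)
  assume "V p \<noteq> W p"
  then have "g p (V p - W p) (V p - W p) > 0" using V W p by (intro g_pos) auto
  then show False
    using eq[OF smooth_vf_diff[OF U V W]] V W p by (simp add: g_diff_left)
qed

lemma T_skew: "VF X \<Longrightarrow> VF Y \<Longrightarrow> p \<in> U \<Longrightarrow> T X Y p = - T Y X p"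
  by (simp add: T_eq_difference)

lemma T_J_right:
  assumes "VF X" "VF Y" "p \<in> U"
  shows "T X (JJ Y) p = - J p (T X Y p)"
proof -
  have VF: "VF (T X (JJ Y))" "VF (\<lambda>q. - JJ (T X Y) q)"
    using assms by (auto intro!: smooth_vf_uminus[OF U])
  show ?thesis
    unfolding JJ_at[symmetric]
  proof (rule field_eqI[OF VF assms(3)])
    fix Z assume Z: "VF Z"
    show "g p (T X (JJ Y) p) (Z p) = g p (- JJ (T X Y) p) (Z p)"
      using tau_J23[OF assms(1,2) Z assms(3)] assms Z by (simp add: tau_def JJ_at g_minus_left g_J_left)
  qed
qed

lemma T_J_left:
  assumes "VF X" "VF Y" "p \<in> U"
  shows "T (JJ X) Y p = - J p (T X Y p)"
  using T_J_right[OF assms(2,1,3)] T_skew[of "JJ X" Y p] T_skew[of X Y p] assms by (simp add: J_minus)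

text \<open>As \<open>J\<close> is parallel for \<open>N\<close>, its derivative \<open>D J\<close> is the commutator of \<open>J\<close> with \<open>N - D\<close>, which
  is half the torsion of \<open>N\<close>.\<close>

lemma cov_endo_zero_if_T_zero:
  assumes X: "VF X" and Y: "VF Y" and p: "p \<in> U"
    and T0: "T X Y p = 0" "T X (JJ Y) p = 0"
  shows "cov_endo D J X Y p = 0"
proof -
  have half: "N X W p - D X W p = 0" if W: "VF W" and "T X W p = 0" for W
  proof -
    have VF: "VF (\<lambda>q. N X W q - D X W q)" "VF (\<lambda>q. 0)"
      using smooth_vf_sum[OF U, of "{}"] X W by (auto intro!: smooth_vf_diff[OF U])
    show ?thesis
    proof (rule field_eqI[OF VF p])
      fix Z assume Z: "VF Z"
      show "g p (N X W p - D X W p) (Z p) = g p 0 (Z p)"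
        using tau_double[OF X W Z p] that Z p by (simp add: tau_def g_zero_left)
    qed
  qed
  show ?thesis
    using half[of Y] half[of "JJ Y"] X Y p T0 J_scale[of 0 p 0] by (simp add: cov_endo_D)
qed

subsection \<open>The curvature of the Chern connection\<close>

definition Rm :: "('m, 'e) vfield \<Rightarrow> ('m, 'e) vfield \<Rightarrow> ('m, 'e) vfield \<Rightarrow> ('m, 'e) vfield \<Rightarrow> 'm \<Rightarrow> real"
  where "Rm X Y Z W p = g p (curvature A N X Y Z p) (W p)"

lemma curvature_JJ:
  assumes X: "VF X" and Y: "VF Y" and Z: "VF Z" and p: "p \<in> U"
  shows "curvature A N X Y (JJ Z) p = J p (curvature A N X Y Z p)"
proof -
  have NN: "N V (N W (JJ Z)) p = J p (N V (N W Z) p)" if V: "VF V" and W: "VF W" for V W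
  proof -
    have "N V (N W (JJ Z)) p = N V (JJ (N W Z)) p"
      by (rule connection_cong[OF affine_N]) (use V W Z p in \<open>auto simp: N_JJ JJ_at\<close>)
    then show ?thesis using V W Z p by (simp add: N_JJ)
  qed
  show ?thesis
    using X Y Z p by (simp add: curvature_def NN N_JJ J_diff)
qed

lemma deriv_deriv_g:
  assumes X: "VF X" and Y: "VF Y" and Z: "VF Z" and W: "VF W" and p: "p \<in> U"
  shows "vf_deriv A X (vf_deriv A Y (\<lambda>q. g q (Z q) (W q))) p =
    g p (N X (N Y Z) p) (W p) + g p (N Y Z p) (N X W p) + g p (N X Z p) (N Y W p) + g p (Z p) (N X (N Y W) p)"
proof -
  have "vf_deriv A X (vf_deriv A Y (\<lambda>q. g q (Z q) (W q))) p =
      vf_deriv A X (\<lambda>q. g q (N Y Z q) (W q) + g q (Z q) (N Y W q)) p"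
    by (rule vf_deriv_cong[OF U p]) (use Y Z W in \<open>auto simp: deriv_g_N\<close>)
  also have "\<dots> = vf_deriv A X (\<lambda>q. g q (N Y Z q) (W q)) p + vf_deriv A X (\<lambda>q. g q (Z q) (N Y W q)) p"
    using X Y Z W by (intro vf_deriv_add[OF U p] smooth_g) auto
  finally show ?thesis using X Y Z W p by (simp add: deriv_g_N)
qed

text \<open>Expand \<open>[X, Y] g(Z, W) = X Y g(Z, W) - Y X g(Z, W)\<close> with \<open>N g = 0\<close>; the terms with one
  derivative on each of \<open>Z\<close> and \<open>W\<close> cancel.\<close>

lemma Rm_skew34:
  assumes X: "VF X" and Y: "VF Y" and Z: "VF Z" and W: "VF W" and p: "p \<in> U"
  shows "Rm X Y Z W p = - Rm X Y W Z p"
proof -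
  have "vf_deriv A (lie_bracket A X Y) (\<lambda>q. g q (Z q) (W q)) p =
     vf_deriv A X (vf_deriv A Y (\<lambda>q. g q (Z q) (W q))) p - vf_deriv A Y (vf_deriv A X (\<lambda>q. g q (Z q) (W q))) p"
    by (rule vf_deriv_lie_bracket[OF U p smooth_g[OF Z W] X Y])
  then show ?thesis
    using X Y Z W p
    by (simp add: deriv_deriv_g deriv_g_N Rm_def curvature_def g_simps g_sym[of "Z p"])
qed

lemma lie_bracket_skew: "lie_bracket A X Y p = - lie_bracket A Y X p"
  by (auto simp: lie_bracket_def fun_eq_iff)

lemma Rm_skew12:
  assumes X: "VF X" and Y: "VF Y" and Z: "VF Z" and W: "VF W" and p: "p \<in> U"
  shows "Rm X Y Z W p = - Rm Y X Z W p"
proof -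
  have "N (lie_bracket A X Y) Z p = N (\<lambda>q. - lie_bracket A Y X q) Z p"
    using X Y Z p smooth_vf_uminus[OF U, of "lie_bracket A Y X"]
    by (intro connection_cong[OF affine_N]) (auto intro: lie_bracket_skew)
  also have "\<dots> = - N (lie_bracket A Y X) Z p"
    using X Y Z p by (intro connection_minus_left[OF affine_N]) auto
  finally show ?thesis
    using X Y Z W p by (simp add: Rm_def curvature_def g_simps)
qed

subsection \<open>The covariant derivative of the torsion\<close>

definition nabla_tau ::
    "('m, 'e) vfield \<Rightarrow> ('m, 'e) vfield \<Rightarrow> ('m, 'e) vfield \<Rightarrow> ('m, 'e) vfield \<Rightarrow> 'm \<Rightarrow> real" where
  "nabla_tau X Y Z W p = vf_deriv A X (tau Y Z W) p -
     tau (N X Y) Z W p - tau Y (N X Z) W p - tau Y Z (N X W) p"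

lemma nabla_tau_skew12:
  assumes X: "VF X" and Y: "VF Y" and Z: "VF Z" and W: "VF W" and p: "p \<in> U"
  shows "nabla_tau X Y Z W p = - nabla_tau X Z Y W p"
proof -
  have "vf_deriv A X (tau Y Z W) p = vf_deriv A X (\<lambda>q. - tau Z Y W q) p"
    by (rule vf_deriv_cong[OF U p]) (use Y Z W in \<open>auto intro: tau_skew12\<close>)
  also have "\<dots> = - vf_deriv A X (tau Z Y W) p"
    by (rule vf_deriv_minus[OF U p smooth_tau[OF Z Y W] X])
  finally show ?thesis
    using tau_skew12[of "N X Y" Z W p] tau_skew12[of Y "N X Z" W p] tau_skew12[of Y Z "N X W" p] X Y Z W p
    by (simp add: nabla_tau_def)
qed

lemma nabla_tau_skew23:
  assumes X: "VF X" and Y: "VF Y" and Z: "VF Z" and W: "VF W" and p: "p \<in> U"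
  shows "nabla_tau X Y Z W p = - nabla_tau X Y W Z p"
proof -
  have "vf_deriv A X (tau Y Z W) p = vf_deriv A X (\<lambda>q. - tau Y W Z q) p"
    by (rule vf_deriv_cong[OF U p]) (use Y Z W in \<open>auto intro: tau_skew23\<close>)
  also have "\<dots> = - vf_deriv A X (tau Y W Z) p"
    by (rule vf_deriv_minus[OF U p smooth_tau[OF Y W Z] X])
  finally show ?thesis
    using tau_skew23[of "N X Y" Z W p] tau_skew23[of Y "N X Z" W p] tau_skew23[of Y Z "N X W" p] X Y Z W p
    by (simp add: nabla_tau_def)
qed

text \<open>By the cyclic symmetry \<open>tau X Y Z p = g p (T Y Z p) (X p)\<close>, so that every argument of \<open>tau\<close> enters
  linearly and only through its value at the point.\<close>

lemma tau_first: "VF X \<Longrightarrow> VF Y \<Longrightarrow> VF Z \<Longrightarrow> p \<in> U \<Longrightarrow> tau X Y Z p = g p (T Y Z p) (X p)"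
  by (simp add: tau_cyclic[of X Y Z]) (simp add: tau_def)

lemma tau_second: "VF X \<Longrightarrow> VF Y \<Longrightarrow> VF Z \<Longrightarrow> p \<in> U \<Longrightarrow> tau X Y Z p = g p (T Z X p) (Y p)"
  using tau_cyclic[of Z X Y p] by (simp add: tau_def)

lemma tau_J12:
  assumes "VF X" "VF Y" "VF Z" "p \<in> U"
  shows "tau (JJ X) Y Z p = tau X (JJ Y) Z p"
  using assms by (simp add: tau_def T_J_left T_J_right)

lemma tau_JJ12:
  assumes "VF X" "VF Y" "VF Z" "p \<in> U"
  shows "tau (JJ X) (JJ Y) Z p = - tau X Y Z p"
  using assms by (simp add: tau_def T_JJ g_minus_left)

lemma nabla_tau_JJ12:
  assumes X: "VF X" and Y: "VF Y" and Z: "VF Z" and W: "VF W" and p: "p \<in> U"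
  shows "nabla_tau X (JJ Y) (JJ Z) W p = - nabla_tau X Y Z W p"
proof -
  have "vf_deriv A X (tau (JJ Y) (JJ Z) W) p = vf_deriv A X (\<lambda>q. - tau Y Z W q) p"
    by (rule vf_deriv_cong[OF U p]) (use Y Z W in \<open>auto intro: tau_JJ12\<close>)
  also have "\<dots> = - vf_deriv A X (tau Y Z W) p"
    by (rule vf_deriv_minus[OF U p smooth_tau[OF Y Z W] X])
  finally have 1: "vf_deriv A X (tau (JJ Y) (JJ Z) W) p = - vf_deriv A X (tau Y Z W) p" .
  have 2: "tau (N X (JJ Y)) (JJ Z) W p = - tau (N X Y) Z W p"
    using tau_JJ12[of "N X Y" Z W p] X Y Z W p by (simp add: tau_first N_JJ JJ_at)
  have 3: "tau (JJ Y) (N X (JJ Z)) W p = - tau Y (N X Z) W p"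
    using tau_JJ12[of Y "N X Z" W p] X Y Z W p by (simp add: tau_second N_JJ JJ_at)
  show ?thesis
    using X Y Z W p by (simp add: nabla_tau_def 1 2 3 tau_JJ12)
qed

lemma nabla_tau_J12:
  assumes X: "VF X" and Y: "VF Y" and Z: "VF Z" and W: "VF W" and p: "p \<in> U"
  shows "nabla_tau X Y (JJ Z) W p = nabla_tau X (JJ Y) Z W p"
proof -
  have 1: "vf_deriv A X (tau Y (JJ Z) W) p = vf_deriv A X (tau (JJ Y) Z W) p"
    by (rule vf_deriv_cong[OF U p]) (use Y Z W in \<open>auto simp: tau_J12\<close>)
  have 2: "tau (N X (JJ Y)) Z W p = tau (N X Y) (JJ Z) W p"
    using tau_J12[of "N X Y" Z W p] X Y Z W p by (simp add: tau_first N_JJ JJ_at)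
  have 3: "tau Y (N X (JJ Z)) W p = tau (JJ Y) (N X Z) W p"
    using tau_J12[of Y "N X Z" W p] X Y Z W p by (simp add: tau_second N_JJ JJ_at)
  show ?thesis
    using X Y Z W p by (simp add: nabla_tau_def 1 2 3 tau_J12)
qed

text \<open>In the cyclic sum the terms \<open>N\<^sub>X (N\<^sub>Y Z - N\<^sub>Z Y) = N\<^sub>X (T(Y, Z) + [Y, Z])\<close> can be collected.
  Then \<open>N\<^sub>X [Y, Z] - N\<^bsub>[Y,Z]\<^esub> X\<close> contributes a further torsion term and \<open>[X, [Y, Z]]\<close>, which
  is removed by the Jacobi identity.\<close>

lemma first_Bianchi:
  assumes X: "VF X" and Y: "VF Y" and Z: "VF Z" and p: "p \<in> U"
  shows "curvature A N X Y Z p + curvature A N Y Z X p + curvature A N Z X Y p =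
    (N X (T Y Z) p + T X (lie_bracket A Y Z) p) + (N Y (T Z X) p + T Y (lie_bracket A Z X) p) +
    (N Z (T X Y) p + T Z (lie_bracket A X Y) p)"
proof -
  have swap: "N P (N Q S) p = N P (N S Q) p + N P (T Q S) p + N P (lie_bracket A Q S) p"
    if v: "VF P" "VF Q" "VF S" for P Q S
  proof -
    have "N P (N Q S) p = N P (\<lambda>q. (\<lambda>q. N S Q q + T Q S q) q + lie_bracket A Q S q) p"
      by (rule connection_cong[OF affine_N])
        (use v p in \<open>auto simp: torsion_def intro!: smooth_vf_add U\<close>)
    also have "\<dots> = N P (\<lambda>q. N S Q q + T Q S q) p + N P (lie_bracket A Q S) p"
      by (rule connection_add_right[OF affine_N]) (use v p in \<open>auto intro!: smooth_vf_add U\<close>)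
    also have "N P (\<lambda>q. N S Q q + T Q S q) p = N P (N S Q) p + N P (T Q S) p"
      by (rule connection_add_right[OF affine_N]) (use v p in auto)
    finally show ?thesis .
  qed
  have "N P (lie_bracket A Q S) p = N (lie_bracket A Q S) P p + T P (lie_bracket A Q S) p +
      lie_bracket A P (lie_bracket A Q S) p" for P Q S
    by (simp add: torsion_def)
  then show ?thesis
    using swap[OF X Y Z] swap[OF Y Z X] swap[OF Z X Y] jacobi_identity[OF U p X Y Z]
    unfolding curvature_def by (simp add: algebra_simps)
qed

text \<open>The tensorial form of the preceding identity, after writing \<open>[Y, Z] = N\<^sub>Y Z - N\<^sub>Z Y - T(Y, Z)\<close>; the
  quadratic terms in \<open>T\<close> come from the last summand.\<close>

lemma Bianchi_identity:
  assumes X: "VF X" and Y: "VF Y" and Z: "VF Z" and W: "VF W" and p: "p \<in> U"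
  defines "h \<equiv> \<lambda>X Y Z W. g p (T X Y p) (T Z W p)"
  shows "Rm X Y Z W p + Rm Y Z X W p + Rm Z X Y W p =
    nabla_tau X Y Z W p + nabla_tau Y Z X W p + nabla_tau Z X Y W p + h X Y Z W + h Y Z X W + h Z X Y W"
proof -
  have summand: "g p (N P (T Q S) p + T P (lie_bracket A Q S) p) (W p) =
      vf_deriv A P (tau Q S W) p - tau Q S (N P W) p + tau P (N Q S) W p - tau P (N S Q) W p + h Q S P W"
    if v: "VF P" "VF Q" "VF S" for P Q S
  proof -
    have 1: "g p (N P (T Q S) p) (W p) = vf_deriv A P (tau Q S W) p - tau Q S (N P W) p"
      using deriv_g_N[of P "T Q S" W p] v W p by (simp add: tau_def[abs_def])
    have "g p (T P (lie_bracket A Q S) p) (W p) = tau P (lie_bracket A Q S) W p"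
      by (simp add: tau_def)
    also have "\<dots> = g p (T W P p) (N Q S p - N S Q p - T Q S p)"
      using tau_second[of P "lie_bracket A Q S" W p] v W p by (simp add: torsion_def[of A N Q S])
    also have "\<dots> = tau P (N Q S) W p - tau P (N S Q) W p - g p (T W P p) (T Q S p)"
      using v W p by (simp add: g_diff_right tau_second)
    also have "g p (T W P p) (T Q S p) = - h Q S P W"
      using v W p T_skew[of W P p] by (simp add: h_def g_simps g_sym[of "T P W p"])
    finally show ?thesis
      using 1 v W p by (simp add: g_add_left)
  qed
  have "Rm X Y Z W p + Rm Y Z X W p + Rm Z X Y W p =
      g p (curvature A N X Y Z p + curvature A N Y Z X p + curvature A N Z X Y p) (W p)"
    using X Y Z W p by (simp add: Rm_def g_add_left)
  also have "\<dots> = g p (N X (T Y Z) p + T X (lie_bracket A Y Z) p) (W p) +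
      g p (N Y (T Z X) p + T Y (lie_bracket A Z X) p) (W p) +
      g p (N Z (T X Y) p + T Z (lie_bracket A X Y) p) (W p)"
    unfolding first_Bianchi[OF X Y Z p] using X Y Z W p by (simp add: g_add_left)
  finally show ?thesis
    unfolding summand[OF X Y Z] summand[OF Y Z X] summand[OF Z X Y] nabla_tau_def
    using tau_skew12[of Z "N X Y" W p] tau_skew12[of X "N Y Z" W p] tau_skew12[of Y "N Z X" W p] X Y Z W p
    by simp
qed

text \<open>Kirichenko's theorem.  The type conditions of \<open>kirichenko_algebra\<close> hold because \<open>J\<close> is parallel for
  \<open>N\<close> and \<open>T\<close> is complex antilinear in each argument.\<close>

lemma nabla_tau_zero:
  assumes X: "VF X" and Y: "VF Y" and Z: "VF Z" and W: "VF W" and p: "p \<in> U"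
  shows "nabla_tau X Y Z W p = 0"
proof -
  define h where "h X Y Z W = g p (T X Y p) (T Z W p)" for X Y Z W
  note p' [simp] = p
  note hs = h_def T_J_left T_J_right g_simps g_J_left J_minus
  show ?thesis
  proof (rule kirichenko_algebra[where V = VF and J = JJ and h = h and R = "\<lambda>X Y Z W. Rm X Y Z W p"
        and f = "\<lambda>X Y Z W. nabla_tau X Y Z W p"])
    fix X Y Z W assume v: "VF X" "VF Y" "VF Z" "VF W"
    show "Rm X Y Z W p + Rm Y Z X W p + Rm Z X Y W p =
      nabla_tau X Y Z W p + nabla_tau Y Z X W p + nabla_tau Z X Y W p + h X Y Z W + h Y Z X W + h Z X Y W"
      using Bianchi_identity[OF v p] by (simp add: h_def)
    show "Rm X Y Z W p = - Rm Y X Z W p" by (rule Rm_skew12[OF v p])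
    show "Rm X Y Z W p = - Rm X Y W Z p" by (rule Rm_skew34[OF v p])
    show "Rm X Y (JJ Z) (JJ W) p = Rm X Y Z W p"
      using v by (simp add: Rm_def curvature_JJ JJ_at g_JJ)
    show "Rm X Y (JJ Z) W p = - Rm X Y Z (JJ W) p"
      using v by (simp add: Rm_def curvature_JJ JJ_at g_J_left)
    show "nabla_tau X Y Z W p = - nabla_tau X Z Y W p" by (rule nabla_tau_skew12[OF v p])
    show "nabla_tau X Y Z W p = - nabla_tau X Y W Z p" by (rule nabla_tau_skew23[OF v p])
    show "nabla_tau X (JJ Y) (JJ Z) W p = - nabla_tau X Y Z W p" by (rule nabla_tau_JJ12[OF v p])
    show "nabla_tau X Y (JJ Z) W p = nabla_tau X (JJ Y) Z W p" by (rule nabla_tau_J12[OF v p])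
    show "h (JJ X) (JJ Y) Z W = - h X Y Z W" "h X (JJ Y) Z W = h (JJ X) Y Z W"
      "h X Y (JJ Z) W = - h (JJ X) Y Z W" "h X Y Z (JJ W) = - h (JJ X) Y Z W"
      using v by (simp_all add: hs)
  qed (use assms in simp_all)
qed

lemma deriv_tau:
  assumes X: "VF X" and Y: "VF Y" and Z: "VF Z" and W: "VF W" and p: "p \<in> U"
  shows "vf_deriv A X (tau Y Z W) p = tau (N X Y) Z W p + tau Y (N X Z) W p + tau Y Z (N X W) p"
  using nabla_tau_zero[OF assms] by (simp add: nabla_tau_def)

text \<open>Since \<open>tau\<close> is parallel, the curvature annihilates it.\<close>

lemma curvature_annihilates_tau:
  assumes X: "VF X" and Y: "VF Y" and a: "VF a" and b: "VF b" and c: "VF c" and p: "p \<in> U"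
  shows "tau (curvature A N X Y a) b c p + tau a (curvature A N X Y b) c p +
    tau a b (curvature A N X Y c) p = 0"
proof -
  have second: "vf_deriv A P (vf_deriv A Q (tau a b c)) p =
      tau (N P (N Q a)) b c p + tau (N Q a) (N P b) c p + tau (N Q a) b (N P c) p +
      (tau (N P a) (N Q b) c p + tau a (N P (N Q b)) c p + tau a (N Q b) (N P c) p) +
      (tau (N P a) b (N Q c) p + tau a (N P b) (N Q c) p + tau a b (N P (N Q c)) p)"
    if P: "VF P" and Q: "VF Q" for P Q
  proof -
    let ?u = "\<lambda>q. tau (N Q a) b c q + tau a (N Q b) c q"
    have "vf_deriv A P (vf_deriv A Q (tau a b c)) p = vf_deriv A P (\<lambda>q. ?u q + tau a b (N Q c) q) p"
      by (rule vf_deriv_cong[OF U p]) (use P Q a b c in \<open>auto simp: deriv_tau\<close>)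
    also have "\<dots> = vf_deriv A P ?u p + vf_deriv A P (tau a b (N Q c)) p"
      by (rule vf_deriv_add[OF U p]) (use P Q a b c in \<open>auto intro!: smooth_fun_add U smooth_tau\<close>)
    also have "vf_deriv A P ?u p = vf_deriv A P (tau (N Q a) b c) p + vf_deriv A P (tau a (N Q b) c) p"
      by (rule vf_deriv_add[OF U p]) (use P Q a b c in \<open>auto intro!: smooth_tau\<close>)
    finally show ?thesis using P Q a b c p by (simp add: deriv_tau)
  qed
  have "vf_deriv A (lie_bracket A X Y) (tau a b c) p =
     vf_deriv A X (vf_deriv A Y (tau a b c)) p - vf_deriv A Y (vf_deriv A X (tau a b c)) p"
    by (rule vf_deriv_lie_bracket[OF U p smooth_tau[OF a b c] X Y])
  moreover have "tau (curvature A N X Y a) b c p =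
      tau (N X (N Y a)) b c p - tau (N Y (N X a)) b c p - tau (N (lie_bracket A X Y) a) b c p"
    using X Y a b c p by (simp add: tau_first) (simp add: curvature_def g_diff_right)
  moreover have "tau a (curvature A N X Y b) c p =
      tau a (N X (N Y b)) c p - tau a (N Y (N X b)) c p - tau a (N (lie_bracket A X Y) b) c p"
    using X Y a b c p by (simp add: tau_second) (simp add: curvature_def g_diff_right)
  moreover have "tau a b (curvature A N X Y c) p =
      tau a b (N X (N Y c)) p - tau a b (N Y (N X c)) p - tau a b (N (lie_bracket A X Y) c) p"
    using X Y a b c p by (simp add: tau_def) (simp add: curvature_def g_diff_right)
  ultimately show ?thesis
    using X Y a b c p by (simp add: second deriv_tau)
qed

end

section \<open>Adapted frames\<close>

lemma adapted_frame_subset: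
  "adapted_frame A J g U e \<Longrightarrow> open V \<Longrightarrow> V \<subseteq> U \<Longrightarrow> adapted_frame A J g V e"
  unfolding adapted_frame_def using smooth_vf_subset by blast

context nearly_kaehler_chern
begin

lemma nearly_kaehler_domain: "open U \<Longrightarrow> nearly_kaehler_domain A J g D N U"
  using nearly_kaehler_chern_axioms by (simp add: nearly_kaehler_domain_def nearly_kaehler_domain_axioms_def)

text \<open>The components in the chart \<open>c\<close> of the coordinate fields exhaust the \<open>DIM('e)\<close>-dimensional space.\<close>

lemma coord_field_not_in_span:
  assumes c: "c \<in> A" "p \<in> cdom c" and E: "finite E" "card E < DIM('e)"
  obtains b where "coord_field c b p \<notin> span E"
proof -
  have lin: "linear (\<lambda>v :: ('m, 'e) tvec. v c)"
    by (rule linearI) (simp_all add: scaleR_fun_def)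
  have "\<exists>b. coord_field c b p \<notin> span E"
  proof (rule ccontr)
    assume "\<not> ?thesis"
    then have "b \<in> (\<lambda>v. v c) ` span E" for b :: 'e
      using coord_field_same[OF c, of b] by (metis image_eqI)
    then have "UNIV \<subseteq> span ((\<lambda>v. v c) ` E)"
      using linear_span_image[OF lin, of E] by auto
    then have "dim (UNIV :: 'e set) \<le> card ((\<lambda>v. v c) ` E)"
      by (rule dim_le_card) (use E in simp)
    also have "\<dots> \<le> card E" by (rule card_image_le[OF E(1)])
    finally show False using E(2) by simp
  qed
  then show ?thesis using that by blast
qed

text \<open>The first \<open>k\<close> pairs \<open>e, J e\<close> of an adapted frame, the object of the inductive construction.\<close>

definition unitary_fields :: "nat \<Rightarrow> 'm set \<Rightarrow> (nat \<Rightarrow> ('m, 'e) vfield) \<Rightarrow> bool" where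
  "unitary_fields k U e \<longleftrightarrow>
     (\<forall>i\<in>{1..2 * k}. smooth_vf A U (e i)) \<and>
     (\<forall>i\<in>{1..2 * k}. \<forall>j\<in>{1..2 * k}. \<forall>p\<in>U. g p (e i p) (e j p) = (if i = j then 1 else 0)) \<and>
     (\<forall>a\<in>{1..k}. \<forall>p\<in>U. e (2 * a) p = J p (e (2 * a - 1) p))"

text \<open>A Gram-Schmidt step yields a unit field \<open>F\<close> orthogonal to the given ones, on the open set where the
  projected field \<open>Y\<close> has no zero.  The given fields span a \<open>J\<close>-invariant space, so \<open>J F\<close> is orthogonal
  to them too.\<close>

lemma unitary_fields_step:
  assumes U: "open U" "p \<in> U" and e: "unitary_fields k U e" and k: "2 * k < DIM('e)"
  shows "\<exists>W e'. open W \<and> p \<in> W \<and> W \<subseteq> U \<and> unitary_fields (Suc k) W e'"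
proof -
  obtain c where c: "c \<in> A" "p \<in> cdom c" by (rule chart_exists)
  let ?E = "(\<lambda>i. e i p) ` {1..2 * k}"
  have "card ?E < DIM('e)"
    using card_image_le[of "{1..2 * k}" "\<lambda>i. e i p"] k by simp
  then obtain b where b: "coord_field c b p \<notin> span ?E"
    using coord_field_not_in_span[OF c, of ?E] by auto
  define V where "V = U \<inter> cdom c"
  have V: "open V" "p \<in> V" using U c by (auto simp: V_def intro: open_Int open_cdom)
  interpret V: nearly_kaehler_domain A J g D N V by (rule nearly_kaehler_domain[OF V(1)])
  define X where "X = coord_field c b"
  have X: "V.VF X"
    using smooth_vf_subset[OF coord_field_smooth[OF c(1)]] by (simp add: X_def V_def)
  have eV: "V.VF (e i)" if "i \<in> {1..2 * k}" for i
    using e that smooth_vf_subset[of A U "e i" V] by (auto simp: unitary_fields_def V_def)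
  have orth: "g q (e i q) (e j q) = (if i = j then 1 else 0)"
    if "i \<in> {1..2 * k}" "j \<in> {1..2 * k}" "q \<in> V" for i j q
    using e that by (auto simp: unitary_fields_def V_def)
  have eJ: "e (2 * a) q = J q (e (2 * a - 1) q)" if "a \<in> {1..k}" "q \<in> V" for a q
    using e that by (auto simp: unitary_fields_def V_def)
  define Y where "Y = (\<lambda>q. X q - (\<Sum>i\<in>{1..2 * k}. g q (X q) (e i q) *\<^sub>R e i q))"
  have Y: "V.VF Y"
    unfolding Y_def
    by (intro smooth_vf_diff smooth_vf_sum smooth_vf_scaleR V.smooth_g X eV V(1)) auto
  have Y_orth: "g q (Y q) (e j q) = 0" if j: "j \<in> {1..2 * k}" and q: "q \<in> V" for j q
  proof -
    let ?S = "\<Sum>i\<in>{1..2 * k}. g q (X q) (e i q) *\<^sub>R e i q"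
    have T: "X q \<in> TS q" "e i q \<in> TS q" if "i \<in> {1..2 * k}" for i
      using V.VF_TS[OF X q] V.VF_TS[OF eV[OF that] q] .
    have "g q ?S (e j q) = (\<Sum>i\<in>{1..2 * k}. g q (g q (X q) (e i q) *\<^sub>R e i q) (e j q))"
      using T(2) j by (intro g_sum_left) auto
    moreover have "?S \<in> TS q"
      by (rule sum_TS) (use T(2) in auto)
    ultimately have "g q (Y q) (e j q) = g q (X q) (e j q) -
        (\<Sum>i\<in>{1..2 * k}. g q (g q (X q) (e i q) *\<^sub>R e i q) (e j q))"
      using T[OF j] by (simp add: Y_def g_diff_left)
    also have "(\<Sum>i\<in>{1..2 * k}. g q (g q (X q) (e i q) *\<^sub>R e i q) (e j q)) =
        (\<Sum>i\<in>{1..2 * k}. g q (X q) (e i q) * g q (e i q) (e j q))"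
      by (rule sum.cong[OF refl], rule g_scale_left) (use T(2) j in auto)
    finally have "g q (Y q) (e j q) = g q (X q) (e j q) -
        (\<Sum>i\<in>{1..2 * k}. g q (X q) (e i q) * g q (e i q) (e j q))" .
    moreover have "(\<Sum>i\<in>{1..2 * k}. g q (X q) (e i q) * g q (e i q) (e j q)) =
        (\<Sum>i\<in>{1..2 * k}. if i = j then g q (X q) (e i q) else 0)"
      by (rule sum.cong) (use orth j q in auto)
    moreover have "\<dots> = g q (X q) (e j q)" using j by simp
    ultimately show ?thesis by simp
  qed
  have "Y p \<noteq> 0"
  proof
    assume "Y p = 0"
    then have "X p = (\<Sum>i\<in>{1..2 * k}. g p (X p) (e i p) *\<^sub>R e i p)" by (simp add: Y_def)
    moreover have "(\<Sum>i\<in>{1..2 * k}. g p (X p) (e i p) *\<^sub>R e i p) \<in> span ?E"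
      by (intro span_sum span_scale span_base) auto
    ultimately have "X p \<in> span ?E" by metis
    then show False using b by (simp add: X_def)
  qed
  then have Yp: "g p (Y p) (Y p) > 0" using Y V by (intro g_pos) auto
  define W where "W = {q \<in> V. g q (Y q) (Y q) > 0}"
  have W: "open W" "p \<in> W" "W \<subseteq> V"
    using continuous_open_preimage[OF smooth_fun_continuous[OF V(1) V.smooth_g[OF Y Y]] V(1), of "{0<..}"]
      V Yp by (auto simp: W_def vimage_def Int_def)
  interpret W: nearly_kaehler_domain A J g D N W by (rule nearly_kaehler_domain[OF W(1)])
  have Y': "W.VF Y" using smooth_vf_subset[OF Y W(3)] .
  define r where "r = (\<lambda>q. g q (Y q) (Y q) powr (-1/2))"
  define F where "F = (\<lambda>q. r q *\<^sub>R Y q)"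
  have F: "W.VF F"
    unfolding F_def r_def
    by (intro smooth_vf_scaleR smooth_fun_powr W.smooth_g Y' W(1)) (auto simp: W_def)
  have F_unit: "g q (F q) (F q) = 1" if q: "q \<in> W" for q
  proof -
    have pos: "g q (Y q) (Y q) > 0" using q by (simp add: W_def)
    have "g q (F q) (F q) = (r q * r q) * g q (Y q) (Y q)"
      using Y' q by (simp add: F_def g_scale_left g_scale_right)
    also have "r q * r q = g q (Y q) (Y q) powr (-1/2 + -1/2)"
      unfolding r_def by (rule powr_add[symmetric])
    also have "\<dots> = inverse (g q (Y q) (Y q))"
      using pos by (simp add: powr_minus)
    finally show ?thesis using pos by simp
  qed
  have F_orth: "g q (F q) (e j q) = 0" if "j \<in> {1..2 * k}" "q \<in> W" for j q
    using that W(3) Y_orth[of j q] Y eV[of j] by (auto simp: F_def g_scale_left)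
  have JF_orth: "g q (J q (F q)) (e j q) = 0" if j: "j \<in> {1..2 * k}" and q: "q \<in> W" for j q
  proof -
    have qV: "q \<in> V" using q W(3) by auto
    have "\<exists>i\<in>{1..2 * k}. J q (e j q) = e i q \<or> J q (e j q) = - e i q"
    proof (cases "even j")
      case True
      then obtain a where a: "j = 2 * a" by (auto elim: evenE)
      then have "a \<in> {1..k}" "2 * a - 1 \<in> {1..2 * k}" using j by auto
      then have "J q (e j q) = - e (2 * a - 1) q"
        using eJ[of a q] eV[of "2 * a - 1"] qV a by simp
      then show ?thesis using \<open>2 * a - 1 \<in> {1..2 * k}\<close> by blast
    next
      case False
      then obtain a where a: "j = 2 * a + 1" by (auto elim: oddE)
      then have "Suc a \<in> {1..k}" using j by auto
      then have "J q (e j q) = e (2 * Suc a) q"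
        using eJ[of "Suc a" q] qV a by simp
      moreover have "2 * Suc a \<in> {1..2 * k}" using \<open>Suc a \<in> {1..k}\<close> by auto
      ultimately show ?thesis by blast
    qed
    then have "g q (F q) (J q (e j q)) = 0"
      using F_orth[of _ q] F eV q qV by (auto simp: g_minus_right)
    then show ?thesis using F eV[OF j] q qV by (simp add: g_J_left)
  qed
  define e' where "e' = e(Suc (2 * k) := F, Suc (Suc (2 * k)) := endo_vf J F)"
  have index: "i \<in> {1..2 * k} \<or> i = Suc (2 * k) \<or> i = Suc (Suc (2 * k))" if "i \<in> {1..2 * Suc k}" for i
    using that by auto
  have e'_old: "e' i = e i" if "i \<in> {1..2 * k}" for i
    using that by (simp add: e'_def)
  have e'_new: "e' (Suc (2 * k)) = F" "e' (Suc (Suc (2 * k))) = endo_vf J F"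
    by (simp_all add: e'_def)
  have eW: "W.VF (e i)" if "i \<in> {1..2 * k}" for i
    using smooth_vf_subset[OF eV[OF that] W(3)] .
  have sm: "W.VF (e' i)" if "i \<in> {1..2 * Suc k}" for i
    using index[OF that] eW F by (auto simp: e'_old e'_new)
  have upper: "g q (e' i q) (e' j q) = (if i = j then 1 else 0)"
    if "i \<in> {1..2 * Suc k}" "j \<in> {1..2 * Suc k}" "j \<le> i" "q \<in> W" for i j q
  proof -
    have qV: "q \<in> V" using that W(3) by auto
    have "g q (F q) (e j q) = 0" "g q (J q (F q)) (e j q) = 0" if "j \<in> {1..2 * k}"
      using F_orth[OF that \<open>q \<in> W\<close>] JF_orth[OF that \<open>q \<in> W\<close>] by auto
    moreover have "g q (J q (F q)) (F q) = 0" "g q (J q (F q)) (J q (F q)) = 1" "g q (F q) (F q) = 1"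
      using F that by (auto simp: g_J_left g_J_self g_minus_right F_unit)
    ultimately show ?thesis
      using index[OF that(1)] index[OF that(2)] that(3) orth[OF _ _ qV]
      by (auto simp: e'_old e'_new endo_vf_def)
  qed
  have "g q (e' i q) (e' j q) = (if i = j then 1 else 0)"
    if "i \<in> {1..2 * Suc k}" "j \<in> {1..2 * Suc k}" "q \<in> W" for i j q
    using upper[of i j q] upper[of j i q] g_sym[of "e' i q" q "e' j q"] sm that
    by (cases "j \<le> i") auto
  moreover have "e' (2 * a) q = J q (e' (2 * a - 1) q)" if a: "a \<in> {1..Suc k}" and q: "q \<in> W" for a q
  proof (cases "a = Suc k")
    case True
    then show ?thesis by (simp add: e'_def endo_vf_def)
  next
    case False
    then have "a \<in> {1..k}" using a by auto
    moreover from this have "2 * a \<in> {1..2 * k}" "2 * a - 1 \<in> {1..2 * k}" by auto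
    ultimately show ?thesis using eJ[of a q] q W(3) by (auto simp: e'_old)
  qed
  ultimately have "unitary_fields (Suc k) W e'"
    using sm unfolding unitary_fields_def by blast
  moreover have "W \<subseteq> U" using W(3) by (auto simp: V_def)
  ultimately show ?thesis using W by blast
qed

lemma unitary_fields_exist:
  "2 * k \<le> DIM('e) \<Longrightarrow> \<exists>U e. open U \<and> p \<in> U \<and> unitary_fields k U e"
proof (induction k)
  case 0
  show ?case by (rule exI[of _ UNIV]) (simp add: unitary_fields_def)
next
  case (Suc k)
  then obtain U e where "open U" "p \<in> U" "unitary_fields k U e" by auto
  from unitary_fields_step[OF this] Suc.prems show ?case by auto
qed

lemma adapted_frame_exists:
  assumes "even (DIM('e))"
  obtains c U e where "c \<in> A" "U \<subseteq> cdom c" "p \<in> U" "adapted_frame A J g U e"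
proof -
  obtain c where c: "c \<in> A" "p \<in> cdom c" by (rule chart_exists)
  obtain U e where U: "open U" "p \<in> U" and e: "unitary_fields (DIM('e) div 2) U e"
    using unitary_fields_exist[of "DIM('e) div 2" p] assms by auto
  have "adapted_frame A J g U e"
    using U e assms by (simp add: adapted_frame_def unitary_fields_def)
  then have "adapted_frame A J g (U \<inter> cdom c) e"
    by (rule adapted_frame_subset) (use U c in \<open>auto intro: open_Int open_cdom\<close>)
  then show ?thesis using that[of c "U \<inter> cdom c" e] c U by auto
qed

end

section \<open>Parallel torsion in six dimensions\<close>

declare One_nat_def [simp del] \<comment> \<open>keeps the index of the first frame field in the form \<open>1\<close>\<close>

locale nearly_kaehler_frame = nearly_kaehler_domain A J g D N U
  for A :: "('m::t2_space, 'e::euclidean_space) chart set"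
    and J :: "('m, 'e) endo" and g :: "('m, 'e) metric_tensor" and D N :: "('m, 'e) connection"
    and U :: "'m set" +
  fixes e :: "nat \<Rightarrow> ('m, 'e) vfield"
  assumes dim6: "DIM('e) = 6"
    and frame: "adapted_frame A J g U e"
begin

lemma VF_e [simp]: "i \<in> {1..6} \<Longrightarrow> VF (e i)"
  and e_orth: "i \<in> {1..6} \<Longrightarrow> j \<in> {1..6} \<Longrightarrow> p \<in> U \<Longrightarrow> g p (e i p) (e j p) = (if i = j then 1 else 0)"
  using frame by (simp_all add: adapted_frame_def dim6)

lemma e_even: "p \<in> U \<Longrightarrow> e 2 p = JJ (e 1) p" "p \<in> U \<Longrightarrow> e 4 p = JJ (e 3) p" "p \<in> U \<Longrightarrow> e 6 p = JJ (e 5) p"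
proof -
  have "e (2 * a) p = J p (e (2 * a - 1) p)" if "p \<in> U" "a \<in> {1..3}" for a
    using frame that by (simp add: adapted_frame_def dim6)
  from this[of 1] this[of 2] this[of 3]
  show "p \<in> U \<Longrightarrow> e 2 p = JJ (e 1) p" "p \<in> U \<Longrightarrow> e 4 p = JJ (e 3) p" "p \<in> U \<Longrightarrow> e 6 p = JJ (e 5) p"
    by (simp_all add: JJ_at One_nat_def)
qed

lemma indices: "{1..6::nat} = {1, 2, 3, 4, 5, 6}"
  by auto

lemma sum6: "(\<Sum>i\<in>{1..6::nat}. F i) = (F 1 + F 2 + F 3 + F 4 + F 5 + F 6 :: real)"
  unfolding indices by simp

text \<open>The map which sends the \<open>i\<close>-th basis vector to \<open>e\<^sub>i(p)\<close> is injective, and therefore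
  surjective for dimensional reasons.\<close>

lemma frame_expansion:
  assumes p: "p \<in> U" and v: "v \<in> TS p"
  shows "v = (\<Sum>i\<in>{1..6}. g p v (e i p) *\<^sub>R e i p)"
proof -
  obtain c where c: "c \<in> A" "p \<in> cdom c" by (rule chart_exists)
  have "card (Basis :: 'e set) = card {1..6::nat}" using dim6 by simp
  then obtain \<beta> where \<beta>: "bij_betw \<beta> (Basis :: 'e set) {1..6::nat}"
    using finite_same_card_bij[of "Basis :: 'e set" "{1..6::nat}"] by auto
  then have \<beta>_in: "\<beta> b \<in> {1..6}" if "b \<in> Basis" for b
    using that bij_betwE by blast
  define \<Psi> where "\<Psi> x = (\<Sum>b\<in>Basis. (x \<bullet> b) *\<^sub>R e (\<beta> b) p)" for x :: 'e
  have eT: "e (\<beta> b) p \<in> TS p" if "b \<in> Basis" for b using \<beta>_in[OF that] p by simp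
  have \<Psi>T: "\<Psi> x \<in> TS p" for x unfolding \<Psi>_def by (rule sum_TS) (use eT in simp)
  have coeff: "g p (\<Psi> x) (e (\<beta> b) p) = x \<bullet> b" if b: "b \<in> Basis" for x b
  proof -
    have "g p (\<Psi> x) (e (\<beta> b) p) = (\<Sum>b'\<in>Basis. (x \<bullet> b') * g p (e (\<beta> b') p) (e (\<beta> b) p))"
      using eT b by (simp add: \<Psi>_def g_sum_left g_scale_left)
    also have "\<dots> = (\<Sum>b'\<in>Basis. if b' = b then x \<bullet> b' else 0)"
    proof (rule sum.cong[OF refl])
      fix b' assume b': "b' \<in> (Basis :: 'e set)"
      have "\<beta> b' = \<beta> b \<longleftrightarrow> b' = b" using \<beta> b b' by (auto simp: bij_betw_def inj_on_eq_iff)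
      then show "(x \<bullet> b') * g p (e (\<beta> b') p) (e (\<beta> b) p) = (if b' = b then x \<bullet> b' else 0)"
        by (simp add: e_orth[OF \<beta>_in[OF b'] \<beta>_in[OF b] p])
    qed
    also have "\<dots> = x \<bullet> b" using b by simp
    finally show ?thesis .
  qed
  have linT: "linear \<Psi>"
    unfolding \<Psi>_def by (rule linearI) (simp_all add: inner_add_left scaleR_add_left sum.distrib scaleR_sum_right)
  have lin: "linear (\<lambda>x. \<Psi> x c)"
    by (rule linearI) (simp_all add: linear_add[OF linT] linear_scale[OF linT] scaleR_fun_def)
  have "x = 0" if "\<Psi> x c = 0" for x
  proof -
    have "\<Psi> x = 0" by (rule tangent_eqI[OF \<Psi>T _ c]) (use that in simp_all)
    then have "x \<bullet> b = 0" if "b \<in> Basis" for b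
      using coeff[OF that, of x] eT[OF that] by (simp add: g_zero_left)
    then show ?thesis by (simp add: euclidean_eq_iff[of x])
  qed
  then have "inj (\<lambda>x. \<Psi> x c)" using linear_injective_0[OF lin] by blast
  then have "surj (\<lambda>x. \<Psi> x c)" by (rule linear_injective_imp_surjective[OF lin]) (rule refl)
  then obtain x where x: "v c = \<Psi> x c" by (metis surjD)
  have vx: "v = \<Psi> x" by (rule tangent_eqI[OF v \<Psi>T c x])
  have "(\<Sum>i\<in>{1..6}. g p v (e i p) *\<^sub>R e i p) = (\<Sum>b\<in>Basis. g p v (e (\<beta> b) p) *\<^sub>R e (\<beta> b) p)"
    by (rule sum.reindex_bij_betw[OF \<beta>, symmetric])
  also have "\<dots> = \<Psi> x" unfolding \<Psi>_def vx[unfolded \<Psi>_def] by (rule sum.cong) (simp_all add: coeff[unfolded \<Psi>_def])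
  finally show ?thesis using vx by simp
qed

lemma g_expansion:
  assumes p: "p \<in> U" and v: "v \<in> TS p" and w: "w \<in> TS p"
  shows "g p w v = (\<Sum>i\<in>{1..6}. g p v (e i p) * g p w (e i p))"
proof -
  have T: "e i p \<in> TS p" if "i \<in> {1..6}" for i using that p by simp
  have "g p w v = g p v w" by (rule g_sym[OF w v])
  also have "\<dots> = g p (\<Sum>i\<in>{1..6}. g p v (e i p) *\<^sub>R e i p) w"
    using frame_expansion[OF p v] by (rule arg_cong)
  also have "\<dots> = (\<Sum>i\<in>{1..6}. g p (g p v (e i p) *\<^sub>R e i p) w)"
    by (rule g_sum_left) (use T w in auto)
  also have "\<dots> = (\<Sum>i\<in>{1..6}. g p v (e i p) * g p w (e i p))"
  proof (rule sum.cong[OF refl])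
    fix i :: nat assume "i \<in> {1..6}"
    from T[OF this] show "g p (g p v (e i p) *\<^sub>R e i p) w = g p v (e i p) * g p w (e i p)"
      using w by (simp add: g_scale_left g_sym[of w])
  qed
  finally show ?thesis .
qed

text \<open>The \<open>J\<close>-type of \<open>tau\<close> leaves only the components of \<open>V\<close> along the complex line that is
  complementary to those of the two other arguments.\<close>

lemma tau_complementary:
  assumes V: "VF V" and p: "p \<in> U"
  defines "x i \<equiv> g p (V p) (e i p)"
  shows "tau V (e 3) (e 5) p = x 1 * tau (e 1) (e 3) (e 5) p + x 2 * tau (e 2) (e 3) (e 5) p"
    and "tau V (e 5) (e 1) p = x 3 * tau (e 1) (e 3) (e 5) p + x 4 * tau (e 2) (e 3) (e 5) p"
    and "tau V (e 1) (e 3) p = x 5 * tau (e 1) (e 3) (e 5) p + x 6 * tau (e 2) (e 3) (e 5) p"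
proof -
  have zero1: "tau Q Q S p = 0" if v: "VF Q" "VF S" for Q S
    using tau_skew12[OF v(1,1,2) p] by linarith
  have zero2: "tau S Q S p = 0" if v: "VF Q" "VF S" for Q S
    using tau_cyclic[OF v(2,1,2) p] tau_skew23[OF v(1,2,2) p] by linarith
  have zero3: "tau (JJ Q) Q S p = 0" if v: "VF Q" "VF S" for Q S
    using tau_skew12[OF VF_JJ[OF v(1)] v p] tau_J12[OF v(1,1,2) p] by linarith
  have zero4: "tau (JJ S) Q S p = 0" if v: "VF Q" "VF S" for Q S
    using tau_cyclic[OF VF_JJ[OF v(2)] v p] tau_J23[OF v(1,2,2) p] tau_skew23[OF v VF_JJ[OF v(2)] p]
    by linarith
  have even: "tau (e 2) Q S p = tau (JJ (e 1)) Q S p" "tau (e 4) Q S p = tau (JJ (e 3)) Q S p"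
    "tau (e 6) Q S p = tau (JJ (e 5)) Q S p" if v: "VF Q" "VF S" for Q S
    using v p by (simp_all add: tau_first e_even)
  have move: "tau (JJ (e 3)) (e 5) (e 1) p = tau (JJ (e 1)) (e 3) (e 5) p"
    "tau (JJ (e 5)) (e 1) (e 3) p = tau (JJ (e 1)) (e 3) (e 5) p"
    using tau_cyclic[of "JJ (e 1)" "e 3" "e 5" p] tau_J12[of "e 3" "e 5" "e 1" p] tau_J23[of "e 3" "e 5" "e 1" p]
      tau_cyclic[of "e 3" "JJ (e 5)" "e 1" p] tau_J12[of "e 5" "e 1" "e 3" p] p by auto
  have rot: "tau (e 3) (e 5) (e 1) p = tau (e 1) (e 3) (e 5) p" "tau (e 5) (e 1) (e 3) p = tau (e 1) (e 3) (e 5) p"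
    using tau_cyclic[of "e 1" "e 3" "e 5" p] tau_cyclic[of "e 3" "e 5" "e 1" p] p by auto
  have expand: "tau V (e j) (e k) p = (\<Sum>l\<in>{1..6}. x l * tau (e l) (e j) (e k) p)"
    if "j \<in> {1..6}" "k \<in> {1..6}" for j k
    using V p that g_expansion[OF p, of "V p" "T (e j) (e k) p"] by (simp add: tau_first x_def)
  note rules = even zero1 zero2 zero3 zero4 move rot
  show "tau V (e 3) (e 5) p = x 1 * tau (e 1) (e 3) (e 5) p + x 2 * tau (e 2) (e 3) (e 5) p"
    using expand[of 3 5] unfolding sum6 by (simp add: rules)
  show "tau V (e 5) (e 1) p = x 3 * tau (e 1) (e 3) (e 5) p + x 4 * tau (e 2) (e 3) (e 5) p"
    using expand[of 5 1] unfolding sum6 by (simp add: rules)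
  show "tau V (e 1) (e 3) p = x 5 * tau (e 1) (e 3) (e 5) p + x 6 * tau (e 2) (e 3) (e 5) p"
    using expand[of 1 3] unfolding sum6 by (simp add: rules)
qed

lemma tau_e2:
  "VF Q \<Longrightarrow> VF S \<Longrightarrow> p \<in> U \<Longrightarrow> tau (e 2) Q S p = tau (JJ (e 1)) Q S p"
  by (simp add: tau_first e_even)

text \<open>The pair \<open>tau(e\<^sub>1, e\<^sub>3, e\<^sub>5)\<close>, \<open>tau(e\<^sub>2, e\<^sub>3, e\<^sub>5)\<close> stands for one complex number, the value of a complex
  volume form on the frame.  If \<open>e\<^sub>1, e\<^sub>3, e\<^sub>5\<close> are varied complex linearly by \<open>L\<close>, this number is
  multiplied by the complex trace of \<open>L\<close>.  Under the condition on the diagonal the trace is purely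
  imaginary, given by \<open>s\<close>.  The lemma is applied to the covariant derivative and to the curvature.\<close>

lemma tau_trace:
  assumes L: "VF L1" "VF L3" "VF L5" and p: "p \<in> U"
    and diag: "g p (L1 p) (e 1 p) = 0" "g p (L3 p) (e 3 p) = 0" "g p (L5 p) (e 5 p) = 0"
  defines "s \<equiv> g p (L1 p) (e 2 p) + g p (L3 p) (e 4 p) + g p (L5 p) (e 6 p)"
  shows "tau L1 (e 3) (e 5) p + tau (e 1) L3 (e 5) p + tau (e 1) (e 3) L5 p = s * tau (e 2) (e 3) (e 5) p"
    and "tau (JJ L1) (e 3) (e 5) p + tau (e 2) L3 (e 5) p + tau (e 2) (e 3) L5 p = - s * tau (e 1) (e 3) (e 5) p"
proof -
  have rot: "tau (e 1) V (e 5) p = tau V (e 5) (e 1) p" "tau (e 1) (e 3) V p = tau V (e 1) (e 3) p"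
    if "VF V" for V
    using tau_cyclic[of "e 1" V "e 5" p] tau_cyclic[of V "e 1" "e 3" p] that p by auto
  let ?a = "tau (e 1) (e 3) (e 5) p" and ?b = "tau (e 2) (e 3) (e 5) p"
  have comp: "tau V (e 3) (e 5) p = g p (V p) (e 1 p) * ?a + g p (V p) (e 2 p) * ?b"
    "tau (e 1) V (e 5) p = g p (V p) (e 3 p) * ?a + g p (V p) (e 4 p) * ?b"
    "tau (e 1) (e 3) V p = g p (V p) (e 5 p) * ?a + g p (V p) (e 6 p) * ?b" if V: "VF V" for V
    using tau_complementary[OF V p] rot[OF V] by simp_all
  show "tau L1 (e 3) (e 5) p + tau (e 1) L3 (e 5) p + tau (e 1) (e 3) L5 p = s * ?b"
    unfolding comp[OF L(1)] comp[OF L(2)] comp[OF L(3)] diag s_def by (simp add: algebra_simps)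
  have even: "tau (e 2) L3 (e 5) p = tau (e 1) (JJ L3) (e 5) p" "tau (e 2) (e 3) L5 p = tau (e 1) (e 3) (JJ L5) p"
    using tau_e2[of L3 "e 5" p] tau_e2[of "e 3" L5 p]
      tau_J12[of "e 1" L3 "e 5" p] tau_J12[of "e 1" "e 3" L5 p] tau_J23[of "e 1" "e 3" L5 p] L p
    by simp_all
  have J1: "g p (J p (L1 p)) (e 1 p) = - g p (L1 p) (e 2 p)" "g p (J p (L1 p)) (e 2 p) = 0"
    using L p diag by (simp_all add: e_even JJ_at g_J_left g_minus_right)
  have J3: "g p (J p (L3 p)) (e 3 p) = - g p (L3 p) (e 4 p)" "g p (J p (L3 p)) (e 4 p) = 0"
    using L p diag by (simp_all add: e_even JJ_at g_J_left g_minus_right)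
  have J5: "g p (J p (L5 p)) (e 5 p) = - g p (L5 p) (e 6 p)" "g p (J p (L5 p)) (e 6 p) = 0"
    using L p diag by (simp_all add: e_even JJ_at g_J_left g_minus_right)
  show "tau (JJ L1) (e 3) (e 5) p + tau (e 2) L3 (e 5) p + tau (e 2) (e 3) L5 p = - s * tau (e 1) (e 3) (e 5) p"
    unfolding even comp[OF VF_JJ[OF L(1)]] comp[OF VF_JJ[OF L(2)]] comp[OF VF_JJ[OF L(3)]] JJ_at J1 J3 J5 s_def
    by (simp add: algebra_simps)
qed

text \<open>Up to a constant factor, the squared norm of \<open>tau\<close>.\<close>

definition tau_sq :: "'m \<Rightarrow> real" where
  "tau_sq p = tau (e 1) (e 3) (e 5) p * tau (e 1) (e 3) (e 5) p + tau (e 2) (e 3) (e 5) p * tau (e 2) (e 3) (e 5) p"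

lemma smooth_tau_sq: "smooth_fun A U tau_sq"
  unfolding tau_sq_def by (intro smooth_fun_add smooth_fun_mult smooth_tau U) auto

text \<open>A parallel form has constant norm: by \<open>tau_trace\<close> the derivative of the pair \<open>(a, b)\<close> is \<open>(s b, - s a)\<close>.\<close>

lemma deriv_tau_sq:
  assumes X: "VF X" and p: "p \<in> U"
  shows "vf_deriv A X tau_sq p = 0"
proof -
  have diag: "g p (N X (e i) p) (e i p) = 0" if i: "i \<in> {1..6}" for i
  proof -
    have "vf_deriv A X (\<lambda>q. g q (e i q) (e i q)) p = vf_deriv A X (\<lambda>q. 1) p"
      by (rule vf_deriv_cong[OF U p]) (use i in \<open>auto simp: e_orth\<close>)
    then show ?thesis
      using deriv_g_N[of X "e i" "e i" p] g_sym[of "e i p" p "N X (e i) p"] X i p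
      by (simp add: vf_deriv_const)
  qed
  have even: "tau (N X (e 2)) (e 3) (e 5) p = tau (JJ (N X (e 1))) (e 3) (e 5) p"
  proof -
    have "N X (e 2) p = N X (JJ (e 1)) p"
      by (rule connection_cong[OF affine_N]) (use X p e_even in auto)
    then show ?thesis using X p by (simp add: tau_first N_JJ JJ_at)
  qed
  let ?s = "g p (N X (e 1) p) (e 2 p) + g p (N X (e 3) p) (e 4 p) + g p (N X (e 5) p) (e 6 p)"
  have 1: "vf_deriv A X (tau (e 1) (e 3) (e 5)) p = ?s * tau (e 2) (e 3) (e 5) p"
    using tau_trace(1)[of "N X (e 1)" "N X (e 3)" "N X (e 5)" p] X p diag by (simp add: deriv_tau)
  have 2: "vf_deriv A X (tau (e 2) (e 3) (e 5)) p = - ?s * tau (e 1) (e 3) (e 5) p"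
    using tau_trace(2)[of "N X (e 1)" "N X (e 3)" "N X (e 5)" p] X p diag even by (simp add: deriv_tau)
  have sm: "smooth_fun A U (tau (e 1) (e 3) (e 5))" "smooth_fun A U (tau (e 2) (e 3) (e 5))"
    by (auto intro!: smooth_tau)
  show ?thesis
    unfolding tau_sq_def
      vf_deriv_add[OF U p smooth_fun_mult[OF U sm(1) sm(1)] smooth_fun_mult[OF U sm(2) sm(2)] X]
      vf_deriv_mult[OF U p sm(1) sm(1) X] vf_deriv_mult[OF U p sm(2) sm(2) X] 1 2
    by (simp add: algebra_simps)
qed

lemma tau_sq_locally_constant:
  assumes c: "c \<in> A" "U \<subseteq> cdom c" and p: "p \<in> U"
  obtains W where "open W" "p \<in> W" "W \<subseteq> U" "\<And>q. q \<in> W \<Longrightarrow> tau_sq q = tau_sq p"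
proof -
  let ?S = "coord c ` (U \<inter> cdom c)"
  let ?F = "tau_sq \<circ> param c"
  have S: "open ?S" "coord c p \<in> ?S" using open_chart_image[OF c(1) U] p c by auto
  then obtain r where r: "r > 0" "ball (coord c p) r \<subseteq> ?S" using openE by blast
  have "(?F has_derivative (\<lambda>v. 0)) (at x)" if x: "x \<in> ?S" for x
  proof -
    let ?q = "param c x"
    have q: "?q \<in> U" "?q \<in> cdom c" "coord c ?q = x" using param_in[OF c(1) x] by auto
    have "frechet_derivative ?F (at x) v = 0" for v
    proof -
      have X: "VF (coord_field c v)" using smooth_vf_subset[OF coord_field_smooth[OF c(1)] c(2)] .
      have "frechet_derivative ?F (at (coord c ?q)) (coord_field c v ?q c) = 0"
        using vf_deriv_chart[OF U q(1) smooth_tau_sq X c(1) q(2)] deriv_tau_sq[OF X q(1)] by simp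
      then show ?thesis using q c by (simp add: coord_field_same)
    qed
    then have "frechet_derivative ?F (at x) = (\<lambda>v. 0)" by auto
    moreover have "smooth_on ?S ?F" using smooth_tau_sq c by (simp add: smooth_fun_def)
    ultimately show ?thesis using smooth_on_has_derivative[of ?S ?F x] x by simp
  qed
  note D = this
  have "\<exists>k. \<forall>x\<in>ball (coord c p) r. ?F x = k"
  proof (rule has_derivative_zero_constant[OF convex_ball])
    fix x assume "x \<in> ball (coord c p) r"
    from has_derivative_at_withinI[OF D[OF subsetD[OF r(2) this]]]
    show "(?F has_derivative (\<lambda>v. 0)) (at x within ball (coord c p) r)" .
  qed
  then obtain k where k: "\<And>x. x \<in> ball (coord c p) r \<Longrightarrow> ?F x = k" by blast
  let ?W = "U \<inter> coord c -` ball (coord c p) r"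
  have "continuous_on (cdom c) (coord c)"
    using is_chart[OF c(1)] by (simp add: is_chart_def homeomorphism_def)
  then have "continuous_on U (coord c)" using c(2) continuous_on_subset by blast
  then have "open ?W" by (rule continuous_open_preimage[OF _ U open_ball])
  moreover have "p \<in> ?W" using p r by simp
  moreover have "tau_sq q = k" if "q \<in> ?W" for q
    using k[of "coord c q"] that c by auto
  ultimately show ?thesis using that[of ?W] by auto
qed

lemma T_zero_if_on_frame:
  assumes X: "VF X" and Y: "VF Y" and p: "p \<in> U" and zero: "\<And>i. i \<in> {1..6} \<Longrightarrow> T (e i) Y p = 0"
  shows "T X Y p = 0"
proof -
  let ?V = "T X Y"
  have V: "VF ?V" using X Y by simp
  have "g p (?V p) (?V p) = g p (T Y ?V p) (X p)"
    using tau_first[OF X Y V p] by (simp add: tau_def)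
  also have "\<dots> = (\<Sum>i\<in>{1..6}. g p (X p) (e i p) * g p (T Y ?V p) (e i p))"
    by (rule g_expansion[OF p]) (use X Y p in simp_all)
  also have "\<dots> = (\<Sum>i\<in>{1..6}. g p (X p) (e i p) * tau (e i) Y ?V p)"
    using tau_first[OF _ Y V p] by simp
  also have "\<dots> = 0"
    using zero V p by (simp add: tau_def g_zero_left)
  finally show ?thesis using g_pos[of "?V p" p] V p by force
qed

text \<open>By \<open>tau_complementary\<close> the torsion vanishes on pairs of fields from \<open>e\<^sub>1, e\<^sub>3, e\<^sub>5\<close>, by antilinearity
  on all pairs of frame fields, and by expansion on all fields.\<close>

lemma T_zero_if_tau_sq_zero:
  assumes p: "p \<in> U" and zero: "tau_sq p = 0" and X: "VF X" and Y: "VF Y"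
  shows "T X Y p = 0"
proof -
  have ab: "tau (e 1) (e 3) (e 5) p = 0" "tau (e 2) (e 3) (e 5) p = 0"
    using zero by (simp_all add: tau_sq_def)
  have pair: "T (e j) (e k) p = 0"
    if "j \<in> {1..6}" "k \<in> {1..6}" "\<And>V. VF V \<Longrightarrow> tau V (e j) (e k) p = 0" for j k
  proof -
    let ?V = "T (e j) (e k)"
    have V: "VF ?V" using that by simp
    have "g p (?V p) (?V p) = 0"
      using that(3)[OF V] tau_first[OF V _ _ p, of "e j" "e k"] that(1,2) by simp
    then show ?thesis using g_pos[of "?V p" p] V p by force
  qed
  have J0: "J p 0 = 0" using J_scale[of 0 p 0] by simp
  have odd: "T (e j) (e k) p = 0" if "j \<in> {1, 3, 5}" "k \<in> {1, 3, 5}" for j k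
  proof -
    have "T (e i) (e i) p = 0" if "i \<in> {1..6}" for i
    proof -
      have "T (e i) (e i) p = - T (e i) (e i) p" by (rule T_skew) (use that p in simp_all)
      then have "2 *\<^sub>R T (e i) (e i) p = 0" by (metis add.right_inverse scaleR_2)
      then show ?thesis by simp
    qed
    moreover have "T (e 3) (e 5) p = 0" "T (e 5) (e 1) p = 0" "T (e 1) (e 3) p = 0"
      by (rule pair; simp add: tau_complementary p ab)+
    moreover have "T (e 5) (e 3) p = 0" "T (e 1) (e 5) p = 0" "T (e 3) (e 1) p = 0"
      using T_skew[of "e 5" "e 3" p] T_skew[of "e 1" "e 5" p] T_skew[of "e 3" "e 1" p] p calculation by simp_all
    ultimately show ?thesis using that by auto
  qed
  have even: "\<exists>j\<in>{1, 3, 5}. e i p = JJ (e j) p" if "i \<in> {2, 4, 6}" for i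
    using that e_even[OF p] by auto
  have transfer: "T V W p = 0" if "VF V" "VF V'" "VF W" "V p = JJ V' p" "T V' W p = 0" for V V' W
  proof -
    have "T V W p = T (JJ V') W p"
    proof (rule field_eqI[OF _ _ p])
      fix Z assume Z: "VF Z"
      show "g p (T V W p) (Z p) = g p (T (JJ V') W p) (Z p)"
        using tau_first[of V W Z p] tau_first[of "JJ V'" W Z p] that Z p by (simp add: tau_def)
    qed (use that in auto)
    then show ?thesis using that p J0 by (simp add: T_J_left)
  qed
  have left: "T (e i) (e k) p = 0" if i: "i \<in> {1..6}" and k: "k \<in> {1, 3, 5}" for i k
  proof (cases "i \<in> {1, 3, 5}")
    case True
    then show ?thesis using odd k by blast
  next
    case False
    then have "i \<in> {2, 4, 6}" using i by (auto simp: indices)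
    from even[OF this] obtain j where j: "j \<in> {1, 3, 5}" "e i p = JJ (e j) p" by blast
    have "VF (e j)" "VF (e k)" using j k by auto
    then show ?thesis using transfer[of "e i" "e j" "e k"] j(2) odd[OF j(1) k] i by simp
  qed
  have full: "T (e k) (e i) p = 0" if i: "i \<in> {1..6}" and k: "k \<in> {1..6}" for i k
  proof (cases "k \<in> {1, 3, 5}")
    case True
    then show ?thesis using left[OF i True] T_skew[of "e k" "e i" p] i k p by simp
  next
    case False
    then have "k \<in> {2, 4, 6}" using k by (auto simp: indices)
    from even[OF this] obtain j where j: "j \<in> {1, 3, 5}" "e k p = JJ (e j) p" by blast
    have ej: "VF (e j)" using j by auto
    have "T (e j) (e i) p = 0" using left[OF i j(1)] T_skew[of "e j" "e i" p] i p ej by simp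
    then show ?thesis using transfer[of "e k" "e j" "e i"] ej j(2) i k by simp
  qed
  have "T (e i) Y p = 0" if i: "i \<in> {1..6}" for i
  proof -
    have "T Y (e i) p = 0" by (rule T_zero_if_on_frame[OF Y _ p]) (use full i in auto)
    then show ?thesis using T_skew[of "e i" Y p] Y i p by simp
  qed
  then show ?thesis by (rule T_zero_if_on_frame[OF X Y p])
qed

lemma curvature_cong:
  assumes X: "VF X" and Y: "VF Y" and Z: "VF Z" "VF Z'" and eq: "\<And>q. q \<in> U \<Longrightarrow> Z q = Z' q" and p: "p \<in> U"
  shows "curvature A N X Y Z p = curvature A N X Y Z' p"
proof -
  have 1: "N V Z q = N V Z' q" if "VF V" "q \<in> U" for V q
    by (rule connection_cong[OF affine_N]) (use that Z eq in auto)
  have "N V (N W Z) p = N V (N W Z') p" if "VF V" "VF W" for V W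
    by (rule connection_cong[OF affine_N]) (use that Z p 1 in auto)
  then show ?thesis using 1 X Y p by (simp add: curvature_def)
qed

text \<open>Where \<open>tau\<close> does not vanish, the trace of the curvature, which multiplies it, vanishes.\<close>

lemma curvature_trace_zero:
  assumes X: "VF X" and Y: "VF Y" and p: "p \<in> U" and nz: "tau_sq p \<noteq> 0"
  shows "(\<Sum>j = 1..6. g p (curvature A N X Y (e j) p) (J p (e j p))) = 0"
proof -
  let ?L = "\<lambda>i. curvature A N X Y (e i)"
  have diag: "g p (?L i p) (e i p) = 0" if "i \<in> {1..6}" for i
    using Rm_skew34[of X Y "e i" "e i" p] X Y p that by (simp add: Rm_def)
  have "?L i p = J p (?L j p)"
    if ij: "i \<in> {1..6}" "j \<in> {1..6}" and eq: "\<And>q. q \<in> U \<Longrightarrow> e i q = JJ (e j) q" for i j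
  proof -
    have "?L i p = curvature A N X Y (JJ (e j)) p"
      by (rule curvature_cong[OF X Y _ _ eq p]) (use ij in simp_all)
    also have "\<dots> = J p (?L j p)" by (rule curvature_JJ[OF X Y _ p]) (use ij in simp)
    finally show ?thesis .
  qed
  from this[of 2 1] this[of 4 3] this[of 6 5]
  have even: "?L 2 p = J p (?L 1 p)" "?L 4 p = J p (?L 3 p)" "?L 6 p = J p (?L 5 p)"
    using e_even by simp_all
  define s where "s = g p (?L 1 p) (e 2 p) + g p (?L 3 p) (e 4 p) + g p (?L 5 p) (e 6 p)"
  have "tau (?L 2) (e 3) (e 5) p = tau (JJ (?L 1)) (e 3) (e 5) p"
    using X Y p by (simp add: tau_first even JJ_at)
  moreover note tau_trace[of "?L 1" "?L 3" "?L 5" p, folded s_def]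
    curvature_annihilates_tau[OF X Y _ _ _ p, of "e 1" "e 3" "e 5"]
    curvature_annihilates_tau[OF X Y _ _ _ p, of "e 2" "e 3" "e 5"]
  ultimately have "s * tau (e 2) (e 3) (e 5) p = 0" "s * tau (e 1) (e 3) (e 5) p = 0"
    using X Y p diag by simp_all
  then have s: "s = 0" using nz by (auto simp: tau_sq_def)
  have "(\<Sum>j = 1..6. g p (?L j p) (J p (e j p))) = 2 * s"
    using X Y p unfolding sum6 by (simp add: even e_even JJ_at g_J_left g_minus_right s_def)
  then show ?thesis using s by simp
qed

end

section \<open>The Hermitian scalar curvature\<close>

context nearly_kaehler_chern
begin

lemma nearly_kaehler_frame:
  assumes "DIM('e) = 6" and "adapted_frame A J g U e"
  shows "nearly_kaehler_frame A J g D N U e"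
proof -
  have "open U" using assms(2) by (simp add: adapted_frame_def)
  from nearly_kaehler_domain[OF this] assms show ?thesis
    by (simp add: nearly_kaehler_frame_def nearly_kaehler_frame_axioms_def)
qed

text \<open>A condition without reference to a frame, so that the statements which are obtained in different
  adapted frames can be combined on the whole manifold.\<close>

definition torsion_zero_at :: "'m \<Rightarrow> bool" where
  "torsion_zero_at p \<longleftrightarrow> (\<forall>U X Y. open U \<longrightarrow> p \<in> U \<longrightarrow> smooth_vf A U X \<longrightarrow> smooth_vf A U Y \<longrightarrow>
     torsion A N X Y p = 0)"

text \<open>Fields on another neighbourhood \<open>V\<close> of \<open>p\<close> are compared with the frame on \<open>U \<inter> V\<close>.\<close>

lemma torsion_zero_iff:
  assumes "DIM('e) = 6" and e: "adapted_frame A J g U e" and p: "p \<in> U"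
  shows "torsion_zero_at p \<longleftrightarrow> nearly_kaehler_frame.tau_sq A g N e p = 0"
proof -
  interpret nearly_kaehler_frame A J g D N U e by (rule nearly_kaehler_frame[OF assms(1,2)])
  show ?thesis
  proof
    assume "torsion_zero_at p"
    then have "T (e 1) (e 3) p = 0" "T (e 2) (e 3) p = 0"
      using U p unfolding torsion_zero_at_def by (auto dest!: spec[of _ U])
    then show "tau_sq p = 0"
      using p by (simp add: tau_sq_def tau_def g_zero_left)
  next
    assume z: "tau_sq p = 0"
    show "torsion_zero_at p"
      unfolding torsion_zero_at_def
    proof (intro allI impI)
      fix V X Y assume V: "open V" "p \<in> V" "smooth_vf A V X" "smooth_vf A V Y"
      have "adapted_frame A J g (U \<inter> V) e" by (rule adapted_frame_subset[OF e]) (use U V in auto)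
      then interpret UV: nearly_kaehler_frame A J g D N "U \<inter> V" e by (rule nearly_kaehler_frame[OF assms(1)])
      show "torsion A N X Y p = 0"
        by (rule UV.T_zero_if_tau_sq_zero[OF _ z]) (use V p smooth_vf_subset[of A V _ "U \<inter> V"] in auto)
    qed
  qed
qed

lemma torsion_zero_locally_constant:
  assumes dim: "DIM('e) = 6"
  obtains W where "open W" "p \<in> W" "\<And>q. q \<in> W \<Longrightarrow> torsion_zero_at q \<longleftrightarrow> torsion_zero_at p"
proof -
  obtain c U e where c: "c \<in> A" "U \<subseteq> cdom c" and p: "p \<in> U" and e: "adapted_frame A J g U e"
    by (rule adapted_frame_exists[of p]) (simp add: dim)
  interpret nearly_kaehler_frame A J g D N U e by (rule nearly_kaehler_frame[OF dim e])
  obtain W where "open W" "p \<in> W" "W \<subseteq> U" "\<And>q. q \<in> W \<Longrightarrow> tau_sq q = tau_sq p"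
    using tau_sq_locally_constant[OF c p] by blast
  then show ?thesis
    using that[of W] torsion_zero_iff[OF dim e] by (metis subsetD)
qed

text \<open>The zero set of the torsion and its complement are both open, so one of them is empty.  If the
  torsion were zero everywhere, so would be \<open>D J\<close>.\<close>

lemma torsion_nowhere_zero:
  assumes dim: "DIM('e) = 6" and conn: "connected (UNIV :: 'm set)" and nK: "\<not> Kaehler A J g D"
  shows "\<not> torsion_zero_at p"
proof -
  let ?Z = "{q. torsion_zero_at q}"
  have "open ?Z"
    by (subst open_subopen) (use torsion_zero_locally_constant[OF dim] in \<open>metis mem_Collect_eq subsetI\<close>)
  moreover have "open (- ?Z)"
    by (subst open_subopen) (use torsion_zero_locally_constant[OF dim] in \<open>metis ComplI ComplD mem_Collect_eq subsetI\<close>)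
  moreover have "\<forall>S :: 'm set. open S \<and> closed S \<longrightarrow> S = {} \<or> S = UNIV"
    using conn unfolding connected_clopen by simp
  ultimately have "?Z = {} \<or> ?Z = UNIV"
    unfolding closed_def by blast
  moreover have "?Z \<noteq> UNIV"
  proof
    assume Z: "?Z = UNIV"
    have "parallel_endo A D J"
      unfolding parallel_endo_def
    proof (intro allI impI ballI)
      fix U X Y p assume U: "open U" and X: "smooth_vf A U X" and Y: "smooth_vf A U Y" and p: "p \<in> U"
      interpret nearly_kaehler_domain A J g D N U by (rule nearly_kaehler_domain[OF U])
      have "T X W p = 0" if "VF W" for W
        using Z U X p that unfolding torsion_zero_at_def by auto
      then show "cov_endo D J X Y p = 0"
        using cov_endo_zero_if_T_zero[OF X Y p] Y by simp
    qed
    then show False using nK almost_Hermitian by (simp add: Kaehler_def)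
  qed
  ultimately show ?thesis by auto
qed

text \<open>The inner sum over \<open>j\<close> in the definition is, up to a constant factor, the complex trace of the
  curvature in the directions \<open>e\<^sub>i\<close>, \<open>J e\<^sub>i\<close>.
  The frame selected there is adapted, since adapted frames exist.\<close>

lemma hermitian_scalar_curvature_zero:
  assumes dim: "DIM('e) = 6" and conn: "connected (UNIV :: 'm set)" and nK: "\<not> Kaehler A J g D"
  shows "hermitian_scalar_curvature A J g N p = 0"
proof -
  define e where "e = (SOME e. \<exists>U. p \<in> U \<and> adapted_frame A J g U e)"
  obtain U0 e0 where "p \<in> U0" "adapted_frame A J g U0 e0"
    by (rule adapted_frame_exists[of p]) (simp_all add: dim)
  then have "\<exists>U. p \<in> U \<and> adapted_frame A J g U e"
    unfolding e_def by (intro someI[of "\<lambda>e. \<exists>U. p \<in> U \<and> adapted_frame A J g U e" e0]) blast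
  then obtain U where p: "p \<in> U" and e: "adapted_frame A J g U e" by blast
  interpret nearly_kaehler_frame A J g D N U e by (rule nearly_kaehler_frame[OF dim e])
  have "tau_sq p \<noteq> 0"
    using torsion_nowhere_zero[OF assms] torsion_zero_iff[OF dim e p] by blast
  then have "(\<Sum>j = 1..6. g p (curvature A N (e i) (JJ (e i)) (e j) p) (J p (e j p))) = 0"
    if "i \<in> {1..6}" for i
    using that p by (intro curvature_trace_zero) auto
  then have "frame_chern_scalar A J g N e p = 0"
    by (simp add: frame_chern_scalar_def dim)
  then show ?thesis
    by (simp add: hermitian_scalar_curvature_def chern_scalar_curvature_def e_def)
qed

end

theorem corollary3p7:
  fixes A :: "('m::{t2_space,second_countable_topology}, real ^ 6) chart set"
    and J :: "('m, real ^ 6) endo"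
    and g :: "('m, real ^ 6) metric_tensor"
    and D N :: "('m, real ^ 6) connection"
  assumes "compact (UNIV :: 'm set)"
    and "connected (UNIV :: 'm set)"
    and "levi_civita A g D"
    and "nearly_Kaehler A J g D"
    and "\<not> Kaehler A J g D"
    and "chern_connection A J g N"
  shows "\<forall>p. hermitian_scalar_curvature A J g N p = 0"
proof
  fix p
  interpret nearly_kaehler_chern A J g D N
    by unfold_locales (fact assms)+
  show "hermitian_scalar_curvature A J g N p = 0"
    by (rule hermitian_scalar_curvature_zero) (use assms in simp_all)
qed

end
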